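(* Let $H$ be a separable complex Hilbert space, $D=D^*$ with compact resolvent, $G$ a positive bounded Borel function with $G(D)\in\mathcal{L}^{1,\infty}(H)$, and $U:H\to L^2(F,\mu)$ a joint spectral representation of commuting bounded selfadjoint operators $A_1,\dots,A_n$ acting non-degenerately on $H$. For a measurable function $f$ on $F$ let $T_f=U^*M_fU$. Then: (i) $T_fG(D)\in\mathcal{L}^{1,\infty}$ implies $f\in L^2(F,\mu_2)$; (ii) $f\in L^2(F,\mu_{1,\infty})$ implies $T_fG(D)\in\mathcal{L}^{1,\infty}$. In case (ii), $\|T_fG(D)\|_{Z_1}\le\|f\|_{1,\infty,2}\,\|G(D)\|_{Z_1}^{1/2}$.
   Context: $\mathcal{L}^{1,\infty}(H)$ is the ideal of compact $T$ with $\|T\|_{1,\infty}=\sup_{k}\frac{1}{\log(1+k)}\sum_{n=1}^k\mu_n(T)<\infty$, $\mu_n(T)$ the singular values. $\|T\|_{Z_1}:=\limsup_{s\to1^+}(s-1)\mathrm{Tr}(|T|^s)^{1/s}$. $\{h_m\}$ is an orthonormal basis of eigenvectors of $D$, $Dh_m=\lambda_mh_m$. A joint spectral representation is a unitary $U:H\to L^2(F,\mu)$, $(F,\mu)$ a finite Borel measure space, with each $UA_iU^*$ a multiplication operator $M_{e_i}$ by a bounded function; it is assumed that there is a normal $^*$-homomorphism $f\mapsto f\circ e$, $e=(e_1,\dots,e_n)$, from the von Neumann algebra $\mathcal{M}\cong L^\infty(E,\mu_\eta)$ generated by the $A_i$ ($E$ the joint spectrum) into $L^\infty(F,\mu)$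 with $Uf(A_1,\dots,A_n)U^*=M_{f\circ e}$. $M_f$ is multiplication by $f$ on $L^2(F,\mu)$ (maximal domain); $T_fG(D)\in\mathcal{L}^{1,\infty}$ means $T_fG(D)$ is densely defined with bounded closure in $\mathcal{L}^{1,\infty}$. For $s>1$, $\mu_s$ is the finite measure on $F$, absolutely continuous with respect to $\mu$, with density $\sum_mG(\lambda_m)^s|(Uh_m)(x)|^2$. For $1\le p\le\infty$, $\|f\|_{1,\infty,p}:=\sup_{1<s\le2}(s-1)^{1/p}\|f\|_{L^p(F,\mu_s)}$ and $L^p(F,\mu_{1,\infty}):=\{f: f\in L^p(F,\mu_s)\ \forall s>1,\ \|f\|_{1,\infty,p}<\infty\}$. *)

theory Defs
  imports "HOL-Analysis.Analysis"
begin

section \<open>Complex Hilbert spaces\<close>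

text \<open>The inner product is linear in its first argument.\<close>

class chilbert_space = banach +
  fixes scaleC :: "complex \<Rightarrow> 'a \<Rightarrow> 'a"  (infixr "*\<^sub>C" 75)
    and cinner :: "'a \<Rightarrow> 'a \<Rightarrow> complex"
  assumes scaleC_add_right: "c *\<^sub>C (x + y) = c *\<^sub>C x + c *\<^sub>C y"
    and scaleC_add_left: "(c + d) *\<^sub>C x = c *\<^sub>C x + d *\<^sub>C x"
    and scaleC_scaleC: "c *\<^sub>C d *\<^sub>C x = (c * d) *\<^sub>C x"
    and scaleC_one: "1 *\<^sub>C x = x"
    and scaleR_scaleC: "r *\<^sub>R x = complex_of_real r *\<^sub>C x"
    and cinner_commute: "cinner x y = cnj (cinner y x)"
    and cinner_add_left: "cinner (x + y) z = cinner x z + cinner y z"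
    and cinner_scaleC_left: "cinner (c *\<^sub>C x) y = c * cinner x y"
    and norm_eq_sqrt_cinner: "norm x = sqrt (Re (cinner x x))"

interpretation cvec: vector_space "scaleC :: complex \<Rightarrow> 'a \<Rightarrow> 'a::chilbert_space"
  by unfold_locales
    (simp_all add: scaleC_add_right scaleC_add_left scaleC_scaleC scaleC_one)

definition onb :: "'i set \<Rightarrow> ('i \<Rightarrow> 'h::chilbert_space) \<Rightarrow> bool" where
  "onb I h \<longleftrightarrow>
     (\<forall>i\<in>I. \<forall>j\<in>I. cinner (h i) (h j) = (if i = j then 1 else 0)) \<and>
     closure (cvec.span (h ` I)) = UNIV"

definition orth_proj :: "'h::chilbert_space set \<Rightarrow> 'h \<Rightarrow> 'h" where
  "orth_proj V x = (THE y. y \<in> V \<and> (\<forall>v\<in>V. cinner (x - y) v = 0))"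


section \<open>Bounded and unbounded operators\<close>

text \<open>Everywhere defined operators are functions; possibly unbounded, partially defined
  operators are represented by their graphs. Since \<^term>\<open>R O S\<close> applies \<open>R\<close> first, the operator
  product \<open>S T\<close> has graph \<^term>\<open>T O S\<close> (with its maximal domain).\<close>

definition op_graph :: "('h \<Rightarrow> 'h) \<Rightarrow> ('h \<times> 'h) set" where
  "op_graph B = {(x, B x) |x. True}"

definition bounded_op :: "('h::chilbert_space \<Rightarrow> 'h) \<Rightarrow> bool" where
  "bounded_op B \<longleftrightarrow> bounded_linear B \<and> (\<forall>c x. B (c *\<^sub>C x) = c *\<^sub>C B x)"

definition compact_op :: "('h::chilbert_space \<Rightarrow> 'h) \<Rightarrow> bool" where
  "compact_op B \<longleftrightarrow> bounded_op B \<and> (\<forall>S. bounded S \<longrightarrow> compact (closure (B ` S)))"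

definition linear_graph :: "('h::chilbert_space \<times> 'h) set \<Rightarrow> bool" where
  "linear_graph T \<longleftrightarrow>
     (0, 0) \<in> T \<and>
     (\<forall>x y u v. (x, u) \<in> T \<longrightarrow> (y, v) \<in> T \<longrightarrow> (x + y, u + v) \<in> T) \<and>
     (\<forall>c x u. (x, u) \<in> T \<longrightarrow> (c *\<^sub>C x, c *\<^sub>C u) \<in> T) \<and>
     single_valued T"

definition adjoint_graph :: "('h::chilbert_space \<times> 'h) set \<Rightarrow> ('h \<times> 'h) set" where
  "adjoint_graph T = {(y, z). \<forall>(x, u)\<in>T. cinner u y = cinner x z}"

definition selfadjoint :: "('h::chilbert_space \<times> 'h) set \<Rightarrow> bool" where
  "selfadjoint T \<longleftrightarrow> linear_graph T \<and> closure (Domain T) = UNIV \<and> adjoint_graph T = T"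

text \<open>The right-hand graph below is that of the inverse of \<open>T - z\<close>.\<close>

definition compact_resolvent :: "('h::chilbert_space \<times> 'h) set \<Rightarrow> bool" where
  "compact_resolvent T \<longleftrightarrow>
     (\<exists>z R. compact_op R \<and> op_graph R = {(y - z *\<^sub>C x, x) |x y. (x, y) \<in> T})"

definition eigenspace :: "('h::chilbert_space \<times> 'h) set \<Rightarrow> real \<Rightarrow> 'h set" where
  "eigenspace S l = {x. (x, l *\<^sub>R x) \<in> S}"

text \<open>The functional calculus \<open>g(S) = \<Sum>\<^sub>l g(l) P\<^sub>l\<close>, where \<open>P\<^sub>l\<close> projects onto the kernel of \<open>S - l\<close>,
  for a selfadjoint operator \<open>S\<close> that has an orthonormal basis of eigenvectors and a Borel
  function \<open>g\<close> bounded on the eigenvalues. The spectral measure of such an \<open>S\<close> is purely atomic with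
  atoms \<open>P\<^sub>l\<close>, so this sum is the spectral integral of \<open>g\<close>; it converges unconditionally, and
  \<open>P\<^sub>l = 0\<close> unless \<open>l\<close> is an eigenvalue. It is only used for operators with compact resolvent
  and for positive compact operators.\<close>

definition fun_calc :: "('h::chilbert_space \<times> 'h) set \<Rightarrow> (real \<Rightarrow> real) \<Rightarrow> 'h \<Rightarrow> 'h" where
  "fun_calc S g x = (\<Sum>\<^sub>\<infinity>l. g l *\<^sub>R orth_proj (eigenspace S l) x)"

definition cadjoint :: "('h::chilbert_space \<Rightarrow> 'h) \<Rightarrow> 'h \<Rightarrow> 'h" where
  "cadjoint B y = (THE z. \<forall>x. cinner (B x) y = cinner x z)"

definition positive_op :: "('h::chilbert_space \<Rightarrow> 'h) \<Rightarrow> bool" where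
  "positive_op P \<longleftrightarrow> bounded_op P \<and> (\<forall>x. cinner (P x) x \<in> \<real> \<and> 0 \<le> Re (cinner (P x) x))"

definition abs_op :: "('h::chilbert_space \<Rightarrow> 'h) \<Rightarrow> 'h \<Rightarrow> 'h" where
  "abs_op T = (THE P. positive_op P \<and> P \<circ> P = cadjoint T \<circ> T)"


section \<open>The ideal L(1,infinity) and the zeta seminorm\<close>

text \<open>The eigenvalues of \<open>|T|\<close> of a compact operator \<open>T\<close> in decreasing order, repeated according to
  multiplicity and, if there are only finitely many nonzero ones, continued by zeros.
  Indexing starts at 0, so \<open>\<mu>\<^sub>n(T)\<close> is \<open>singular_values T (n - 1)\<close>.\<close>

definition singular_values :: "('h::chilbert_space \<Rightarrow> 'h) \<Rightarrow> nat \<Rightarrow> real" where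
  "singular_values T = (THE s. decseq s \<and> (\<forall>n. 0 \<le> s n) \<and>
     (\<forall>l>0. finite {n. s n = l} \<and>
            card {n. s n = l} = cvec.dim (eigenspace (op_graph (abs_op T)) l)))"

definition norm_L1inf :: "('h::chilbert_space \<Rightarrow> 'h) \<Rightarrow> ennreal" where
  "norm_L1inf T = (SUP k\<in>{1..}. ennreal ((\<Sum>n<k. singular_values T n) / ln (1 + real k)))"

definition L1inf :: "('h::chilbert_space \<Rightarrow> 'h) set" where
  "L1inf = {T. compact_op T \<and> norm_L1inf T < \<infinity>}"

text \<open>Powers of extended nonnegative reals, for exponents \<open>p > 0\<close>.\<close>

definition epowr :: "ennreal \<Rightarrow> real \<Rightarrow> ennreal" where
  "epowr x p = (if x = \<infinity> then \<infinity> else ennreal (enn2real x powr p))"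

text \<open>The trace of a positive operator; it does not depend on the basis.\<close>

definition trace_pos :: "('h::chilbert_space \<Rightarrow> 'h) \<Rightarrow> ennreal" where
  "trace_pos P = (\<Sum>\<^sub>\<infinity>b\<in>(SOME B. onb B (\<lambda>b. b)). ennreal (Re (cinner (P b) b)))"

definition norm_Z1 :: "('h::chilbert_space \<Rightarrow> 'h) \<Rightarrow> ennreal" where
  "norm_Z1 T = Limsup (at_right 1) (\<lambda>s. ennreal (s - 1) *
     epowr (trace_pos (fun_calc (op_graph (abs_op T)) (\<lambda>l. l powr s))) (1 / s))"

definition bounded_closure :: "('h::chilbert_space \<times> 'h) set \<Rightarrow> 'h \<Rightarrow> 'h" where
  "bounded_closure T = (THE B. op_graph B = closure T)"

definition closure_in_L1inf :: "('h::chilbert_space \<times> 'h) set \<Rightarrow> bool" where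
  "closure_in_L1inf T \<longleftrightarrow> closure (Domain T) = UNIV \<and>
     (\<exists>B. bounded_op B \<and> op_graph B = closure T) \<and> bounded_closure T \<in> L1inf"


section \<open>Function spaces\<close>

text \<open>Elements of \<open>L\<^sup>p\<close> are represented by functions, to be compared almost everywhere.\<close>

definition Lp_norm :: "ennreal \<Rightarrow> 'f measure \<Rightarrow> ('f \<Rightarrow> complex) \<Rightarrow> ennreal" where
  "Lp_norm p M f =
     (if p = \<infinity> then Inf {C. AE x in M. ennreal (cmod (f x)) \<le> C}
      else epowr (\<integral>\<^sup>+x. ennreal (cmod (f x) powr enn2real p) \<partial>M) (1 / enn2real p))"

definition Lp :: "ennreal \<Rightarrow> 'f measure \<Rightarrow> ('f \<Rightarrow> complex) set" where
  "Lp p M = {f \<in> borel_measurable M. Lp_norm p M f < \<infinity>}"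

text \<open>For a family \<open>m s\<close> of measures: \<open>sup\<^bsub>1 < s \<le> 2\<^esub> (s - 1)\<^bsup>1/p\<^esup> ||f||\<close> with the norm
  of \<open>L\<^sup>p(m s)\<close>. For \<open>p = \<infinity>\<close> the exponent is \<open>enn2real (1 / \<infinity>) = 0\<close>.\<close>

definition norm_1inf :: "ennreal \<Rightarrow> (real \<Rightarrow> 'f measure) \<Rightarrow> ('f \<Rightarrow> complex) \<Rightarrow> ennreal" where
  "norm_1inf p m f =
     (SUP s\<in>{1<..2}. ennreal ((s - 1) powr enn2real (1 / p)) * Lp_norm p (m s) f)"

definition Lp_1inf :: "ennreal \<Rightarrow> (real \<Rightarrow> 'f measure) \<Rightarrow> ('f \<Rightarrow> complex) set" where
  "Lp_1inf p m = {f. (\<forall>s>1. f \<in> Lp p (m s)) \<and> norm_1inf p m f < \<infinity>}"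

definition unitary_L2 :: "('h::chilbert_space \<Rightarrow> 'f \<Rightarrow> complex) \<Rightarrow> 'f measure \<Rightarrow> bool" where
  "unitary_L2 U M \<longleftrightarrow>
     (\<forall>x. U x \<in> Lp 2 M) \<and>
     (\<forall>x y. AE t in M. U (x + y) t = U x t + U y t) \<and>
     (\<forall>c x. AE t in M. U (c *\<^sub>C x) t = c * U x t) \<and>
     (\<forall>x y. (\<integral>t. U x t * cnj (U y t) \<partial>M) = cinner x y) \<and>
     (\<forall>u\<in>Lp 2 M. \<exists>x. AE t in M. U x t = u t)"

definition mult_op :: "'f measure \<Rightarrow> ('f \<Rightarrow> complex) \<Rightarrow> (('f \<Rightarrow> complex) \<times> ('f \<Rightarrow> complex)) set"
  where "mult_op M f = {(u, v). u \<in> Lp 2 M \<and> v \<in> Lp 2 M \<and> (AE t in M. v t = f t * u t)}"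

text \<open>The graph of \<open>U\<^sup>* M\<^sub>f U\<close>, for unitary \<open>U\<close>.\<close>

definition conj_mult_op ::
    "('h::chilbert_space \<Rightarrow> 'f \<Rightarrow> complex) \<Rightarrow> 'f measure \<Rightarrow> ('f \<Rightarrow> complex) \<Rightarrow> ('h \<times> 'h) set" where
  "conj_mult_op U M f = {(x, y). (U x, U y) \<in> mult_op M f}"

definition zeta_measure ::
    "('h::chilbert_space \<Rightarrow> 'f \<Rightarrow> complex) \<Rightarrow> 'f measure \<Rightarrow> 'i set \<Rightarrow> ('i \<Rightarrow> 'h) \<Rightarrow> ('i \<Rightarrow> real) \<Rightarrow>
     (real \<Rightarrow> real) \<Rightarrow> real \<Rightarrow> 'f measure" where
  "zeta_measure U M I h lam G s =
     density M (\<lambda>x. \<Sum>\<^sub>\<infinity>m\<in>I. ennreal (G (lam m) powr s * (cmod (U (h m) x))\<^sup>2))"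


section \<open>Joint spectral representations\<close>

definition commuting_selfadjoint :: "('n \<Rightarrow> 'h::chilbert_space \<Rightarrow> 'h) \<Rightarrow> bool" where
  "commuting_selfadjoint A \<longleftrightarrow>
     (\<forall>i. bounded_op (A i) \<and> selfadjoint (op_graph (A i))) \<and> (\<forall>i j. A i \<circ> A j = A j \<circ> A i)"

definition nondegenerate :: "('n \<Rightarrow> 'h::chilbert_space \<Rightarrow> 'h) \<Rightarrow> bool" where
  "nondegenerate A \<longleftrightarrow> closure (cvec.span (\<Union>i. range (A i))) = UNIV"

definition commutant :: "('h::chilbert_space \<Rightarrow> 'h) set \<Rightarrow> ('h \<Rightarrow> 'h) set" where
  "commutant S = {B. bounded_op B \<and> (\<forall>C\<in>S. B \<circ> C = C \<circ> B)}"

text \<open>The von Neumann algebra generated by a (nondegenerate) family of bounded selfadjoint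
  operators.\<close>

definition vn_algebra :: "('n \<Rightarrow> 'h::chilbert_space \<Rightarrow> 'h) \<Rightarrow> ('h \<Rightarrow> 'h) set" where
  "vn_algebra A = commutant (commutant (range A))"

text \<open>The joint spectrum in the generated commutative algebra: those \<open>l\<close> for which the
  \<open>A\<^sub>i - l\<^sub>i\<close> generate a proper ideal.\<close>

definition joint_spectrum :: "('n::finite \<Rightarrow> 'h::chilbert_space \<Rightarrow> 'h) \<Rightarrow> (real ^ 'n) set" where
  "joint_spectrum A = {l. \<nexists>B. (\<forall>i. B i \<in> vn_algebra A) \<and>
     (\<forall>x. (\<Sum>i\<in>UNIV. B i (A i x - (l $ i) *\<^sub>R x)) = x)}"

text \<open>\<open>\<Phi>\<close> is the functional calculus \<open>f \<mapsto> f(A\<^sub>1,\<dots>,A\<^sub>n)\<close>, a \<open>*\<close>-isomorphism of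
  \<open>L\<^sup>\<infinity>(E, \<mu>\<^sub>\<eta>)\<close> onto the generated von Neumann algebra. The spectral measure \<open>\<mu>\<^sub>\<eta>\<close> of the vector \<open>\<eta>\<close>
  is regarded as a Borel measure on \<open>\<real>\<^sup>n\<close> carried by \<open>E\<close>. Normality need not be
  required, being automatic for \<open>*\<close>-isomorphisms of von Neumann algebras.\<close>

definition joint_functional_calculus ::
    "('n::finite \<Rightarrow> 'h::chilbert_space \<Rightarrow> 'h) \<Rightarrow> 'h \<Rightarrow> (real ^ 'n) measure \<Rightarrow>
     (((real ^ 'n) \<Rightarrow> complex) \<Rightarrow> 'h \<Rightarrow> 'h) \<Rightarrow> bool" where
  "joint_functional_calculus A \<eta> \<mu>\<eta> \<Phi> \<longleftrightarrow>
     finite_measure \<mu>\<eta> \<and> sets \<mu>\<eta> = sets borel \<and> (AE l in \<mu>\<eta>. l \<in> joint_spectrum A) \<and>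
     \<Phi> ` Lp \<infinity> \<mu>\<eta> = vn_algebra A \<and>
     (\<forall>f\<in>Lp \<infinity> \<mu>\<eta>. \<forall>g\<in>Lp \<infinity> \<mu>\<eta>. \<Phi> f = \<Phi> g \<longleftrightarrow> (AE l in \<mu>\<eta>. f l = g l)) \<and>
     (\<forall>f\<in>Lp \<infinity> \<mu>\<eta>. \<forall>g\<in>Lp \<infinity> \<mu>\<eta>.
        \<Phi> (\<lambda>l. f l + g l) = (\<lambda>x. \<Phi> f x + \<Phi> g x) \<and>
        \<Phi> (\<lambda>l. f l * g l) = \<Phi> f \<circ> \<Phi> g) \<and>
     (\<forall>f\<in>Lp \<infinity> \<mu>\<eta>. \<forall>c. \<Phi> (\<lambda>l. c * f l) = (\<lambda>x. c *\<^sub>C \<Phi> f x)) \<and>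
     (\<forall>f\<in>Lp \<infinity> \<mu>\<eta>. \<Phi> (\<lambda>l. cnj (f l)) = cadjoint (\<Phi> f)) \<and>
     (\<forall>i. \<Phi> (\<lambda>l. complex_of_real (l $ i)) = A i) \<and>
     (\<forall>f\<in>Lp \<infinity> \<mu>\<eta>. cinner (\<Phi> f \<eta>) \<eta> = (\<integral>l. f l \<partial>\<mu>\<eta>))"

text \<open>Normal \<open>*\<close>-homomorphisms between spaces \<open>L\<^sup>\<infinity>\<close>; the last clause is ultraweak continuity, i.e.
  continuity with respect to the topologies \<open>\<sigma>(L\<^sup>\<infinity>, L\<^sup>1)\<close>.\<close>

definition normal_star_hom ::
    "'e measure \<Rightarrow> 'f measure \<Rightarrow> (('e \<Rightarrow> complex) \<Rightarrow> 'f \<Rightarrow> complex) \<Rightarrow> bool" where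
  "normal_star_hom N M \<pi> \<longleftrightarrow>
     (\<forall>f\<in>Lp \<infinity> N. \<pi> f \<in> Lp \<infinity> M) \<and>
     (\<forall>f\<in>Lp \<infinity> N. \<forall>g\<in>Lp \<infinity> N. (AE l in N. f l = g l) \<longrightarrow> (AE t in M. \<pi> f t = \<pi> g t)) \<and>
     (\<forall>f\<in>Lp \<infinity> N. \<forall>g\<in>Lp \<infinity> N.
        (AE t in M. \<pi> (\<lambda>l. f l + g l) t = \<pi> f t + \<pi> g t) \<and>
        (AE t in M. \<pi> (\<lambda>l. f l * g l) t = \<pi> f t * \<pi> g t)) \<and>
     (\<forall>f\<in>Lp \<infinity> N. \<forall>c. AE t in M. \<pi> (\<lambda>l. c * f l) t = c * \<pi> f t) \<and>
     (\<forall>f\<in>Lp \<infinity> N. AE t in M. \<pi> (\<lambda>l. cnj (f l)) t = cnj (\<pi> f t)) \<and>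
     (\<forall>g\<in>Lp 1 M. \<exists>k\<in>Lp 1 N. \<forall>f\<in>Lp \<infinity> N. (\<integral>t. \<pi> f t * g t \<partial>M) = (\<integral>l. f l * k l \<partial>N))"

definition joint_spectral_rep ::
    "('n::finite \<Rightarrow> 'h::chilbert_space \<Rightarrow> 'h) \<Rightarrow> ('h \<Rightarrow> 'f \<Rightarrow> complex) \<Rightarrow>
     ('f::topological_space) measure \<Rightarrow> ('f \<Rightarrow> real ^ 'n) \<Rightarrow> bool" where
  "joint_spectral_rep A U M e \<longleftrightarrow>
     finite_measure M \<and> sets M = sets borel \<and>
     unitary_L2 U M \<and>
     e \<in> borel_measurable M \<and> bounded (range e) \<and>
     (\<forall>i. op_graph (A i) = conj_mult_op U M (\<lambda>t. complex_of_real (e t $ i))) \<and>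
     (\<exists>\<eta> \<mu>\<eta> \<Phi>. joint_functional_calculus A \<eta> \<mu>\<eta> \<Phi> \<and>
        normal_star_hom \<mu>\<eta> M (\<lambda>f. f \<circ> e) \<and>
        (\<forall>f\<in>Lp \<infinity> \<mu>\<eta>. op_graph (\<Phi> f) = conj_mult_op U M (f \<circ> e)))"

end

theory Submission
  imports Defs
begin

text \<open>Let \<open>g\<^sub>m = G(\<lambda>\<^sub>m)\<close>. Then \<open>\<integral>|f|\<^sup>2 d\<mu>\<^sub>s = \<Sum>\<^sub>m g\<^sub>m\<^bsup>s\<^esup> \<parallel>T\<^sub>f h\<^sub>m\<parallel>\<^sup>2\<close> is the squared Hilbert-Schmidt norm of
  \<open>T\<^sub>f G(D)\<^bsup>s/2\<^esup>\<close>. For \<open>s = 2\<close> this is \<open>\<Sum>\<^sub>n \<mu>\<^sub>n(T\<^sub>f G(D))\<^sup>2\<close>, which is finite in case (i) since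
  \<open>\<mu>\<^sub>n = O(log n / n)\<close>. In case (ii), Hoelder's inequality for
  \<open>T\<^sub>f G(D) = T\<^sub>f G(D)\<^bsup>s/2\<^esup> G(D)\<^bsup>1 - s/2\<^esup>\<close> gives
  \<open>(s - 1) \<parallel>T\<^sub>f G(D)\<parallel>\<^sub>s \<le> \<parallel>f\<parallel>\<^bsub>1,\<infinity>,2\<^esub> (s - 1)\<^bsup>1/2\<^esup> (Tr G(D)\<^bsup>s\<^esup>)\<^bsup>1/s - 1/2\<^esup>\<close>, whose limit superior as
  \<open>s \<rightarrow> 1\<close> is the claimed bound; and a compact operator is in \<open>L\<^bsup>1,\<infinity>\<^esup>\<close> iff
  \<open>(s - 1) \<parallel>\<cdot>\<parallel>\<^sub>s\<close> is bounded near \<open>s = 1\<close>. Orthonormal series in the given basis replace the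
  projection theorem and Riesz representation throughout.\<close>

section \<open>Orthonormal bases\<close>

text \<open>The obstacle is that T_f is unbounded: the first factor of the Hoelder splitting is
  never formed as an operator. Only the vectors \<open>t m\<close>, images of \<open>h m\<close>
  under T_f, enter, and only where \<open>G (lam m) > 0\<close>: there, finiteness of the integral
  at s = 2 puts \<open>h m\<close> into the domain, while elsewhere \<open>h m\<close> may lie
  outside it. T_f G(D) is then built as a Hilbert-Schmidt operator from its values on the basis and
  identified with the graph product because multiplication graphs are closed. The power s/2 in the
  splitting is dictated by the density of the measure; the other factor has Schatten exponent
  \<open>1 / (1/s - 1/2)\<close>, and its norm is again a power of the trace of G(D) to the s. Both
  compact operators are handled through one datum, an orthonormal basis with
  \<open>cadjoint B (B e) = (q e)\<^sup>2 *\<^sub>R e\<close>. The definite descriptions are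
  evaluated from it once; afterwards only sums of powers of \<open>q\<close> occur. The seminorm
  bound is proved with strict slack, since the quantities involved may vanish and a limit superior
  controls only what lies strictly above it.\<close>

lemma cinner_add_right: "cinner x (y + z) = cinner x y + cinner x (z::'a::chilbert_space)"
  by (metis cinner_add_left cinner_commute complex_cnj_add)

lemma cinner_scaleC_right: "cinner x (c *\<^sub>C y) = cnj c * cinner x (y::'a::chilbert_space)"
  by (metis cinner_commute cinner_scaleC_left complex_cnj_mult)

lemma cinner_scaleR_left: "cinner (r *\<^sub>R x) y = of_real r * cinner x (y::'a::chilbert_space)"
  by (simp add: scaleR_scaleC cinner_scaleC_left)

lemma cinner_scaleR_right: "cinner x (r *\<^sub>R y) = of_real r * cinner x (y::'a::chilbert_space)"
  by (simp add: scaleR_scaleC cinner_scaleC_right)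

lemma cinner_self: "cinner x x = of_real ((norm (x::'a::chilbert_space))\<^sup>2)"
proof -
  have "Im (cinner x x) = 0"
    using arg_cong[OF cinner_commute[of x x], of Im] by simp
  moreover have "0 \<le> Re (cinner x x)"
    using norm_ge_zero[of x] unfolding norm_eq_sqrt_cinner by (metis real_sqrt_ge_0_iff)
  ultimately show ?thesis
    by (simp add: complex_eq_iff norm_eq_sqrt_cinner)
qed

lemma Re_cinner_self: "Re (cinner x x) = (norm (x::'a::chilbert_space))\<^sup>2"
  by (simp add: cinner_self)

lemma norm_scaleC: "norm (c *\<^sub>C (x::'a::chilbert_space)) = cmod c * norm x"
proof -
  have "of_real ((norm (c *\<^sub>C x))\<^sup>2) = c * (cnj c * of_real ((norm x)\<^sup>2))"
    unfolding cinner_self[symmetric] by (simp add: cinner_scaleC_left cinner_scaleC_right)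
  also have "\<dots> = of_real ((cmod c * norm x)\<^sup>2)"
    by (simp only: power_mult_distrib of_real_mult complex_norm_square mult.assoc)
  finally have "(norm (c *\<^sub>C x))\<^sup>2 = (cmod c * norm x)\<^sup>2"
    by (simp only: of_real_eq_iff)
  then show ?thesis
    by (simp add: power2_eq_iff_nonneg)
qed

lemma cinner_zero_left [simp]: "cinner 0 (y::'a::chilbert_space) = 0"
  by (metis add_cancel_left_left cinner_add_left)

lemma cinner_zero_right [simp]: "cinner (x::'a::chilbert_space) 0 = 0"
  by (metis add_cancel_left_left cinner_add_right)

lemma cinner_minus_left: "cinner (- x) (y::'a::chilbert_space) = - cinner x y"
  by (metis add.right_inverse cinner_add_left cinner_zero_left eq_neg_iff_add_eq_0 add.commute)

lemma cinner_diff_left: "cinner (x - z) (y::'a::chilbert_space) = cinner x y - cinner z y"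
  using cinner_add_left[of x "-z" y] by (simp add: cinner_minus_left)

lemma cinner_diff_right: "cinner x (y - (z::'a::chilbert_space)) = cinner x y - cinner x z"
  by (metis cinner_commute cinner_diff_left complex_cnj_diff)

lemma cinner_sum_left: "cinner (\<Sum>i\<in>A. f i) (y::'a::chilbert_space) = (\<Sum>i\<in>A. cinner (f i) y)"
  by (induction A rule: infinite_finite_induct) (simp_all add: cinner_add_left)

lemma cinner_sum_right: "cinner (y::'a::chilbert_space) (\<Sum>i\<in>A. f i) = (\<Sum>i\<in>A. cinner y (f i))"
  by (induction A rule: infinite_finite_induct) (simp_all add: cinner_add_right)

lemma norm_add_square:
  "(norm (x + (y::'a::chilbert_space)))\<^sup>2 = (norm x)\<^sup>2 + 2 * Re (cinner x y) + (norm y)\<^sup>2"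
proof -
  have "Re (cinner y x) = Re (cinner x y)"
    by (metis cinner_commute cnj.simps(1))
  then show ?thesis
    by (simp flip: Re_cinner_self add: cinner_add_left cinner_add_right)
qed

lemma norm_diff_square:
  "(norm (x - (y::'a::chilbert_space)))\<^sup>2 = (norm x)\<^sup>2 - 2 * Re (cinner x y) + (norm y)\<^sup>2"
  using norm_add_square[of x "-y"] cinner_diff_right[of x 0 y] by simp

lemma cinner_Cauchy_Schwarz: "cmod (cinner x (y::'a::chilbert_space)) \<le> norm x * norm y"
proof (cases "y = 0")
  case False
  \<comment> \<open>\<open>c *\<^sub>C y\<close> is the orthogonal projection of \<open>x\<close>
    onto the line through \<open>y\<close>; the inequality says that its squared distance to
    \<open>x\<close> is nonnegative.\<close>
  define c where "c = cinner x y / of_real ((norm y)\<^sup>2)"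
  have "0 \<le> (norm (x - c *\<^sub>C y))\<^sup>2"
    by simp
  also have "\<dots> = (norm x)\<^sup>2 - 2 * Re (cnj c * cinner x y) + (cmod c)\<^sup>2 * (norm y)\<^sup>2"
    by (simp add: norm_diff_square cinner_scaleC_right norm_scaleC power_mult_distrib)
  also have "cnj c * cinner x y = of_real ((cmod (cinner x y))\<^sup>2 / (norm y)\<^sup>2)"
    by (simp add: c_def complex_norm_square mult.commute del: of_real_power)
  also have "cmod c = cmod (cinner x y) / (norm y)\<^sup>2"
    by (simp add: c_def norm_divide norm_power)
  also have "(cmod (cinner x y) / (norm y)\<^sup>2)\<^sup>2 * (norm y)\<^sup>2 = (cmod (cinner x y))\<^sup>2 / (norm y)\<^sup>2"
    using False by (simp add: divide_simps power2_eq_square)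
  finally have "(cmod (cinner x y))\<^sup>2 / (norm y)\<^sup>2 \<le> (norm x)\<^sup>2"
    by simp
  then have "(cmod (cinner x y))\<^sup>2 \<le> (norm x * norm y)\<^sup>2"
    using False by (simp add: field_simps)
  then show ?thesis
    by (rule power2_le_imp_le) simp
qed simp

text \<open>Conjugation in the second argument is real-linear, so \<open>cinner\<close> is bilinear
  over the reals; continuity and termwise pairing with unordered sums follow from the general
  theory.\<close>

lemma bounded_bilinear_cinner: "bounded_bilinear (cinner :: 'a::chilbert_space \<Rightarrow> 'a \<Rightarrow> complex)"
  by (rule bounded_bilinear.intro)
     (auto simp: cinner_add_left cinner_add_right cinner_scaleR_left cinner_scaleR_right scaleR_conv_of_real
        intro!: exI[of _ 1] cinner_Cauchy_Schwarz)

lemmas bounded_linear_cinner_left = bounded_bilinear.bounded_linear_left[OF bounded_bilinear_cinner]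
lemmas bounded_linear_cinner_right = bounded_bilinear.bounded_linear_right[OF bounded_bilinear_cinner]
lemmas continuous_on_cinner = bounded_bilinear.continuous_on[OF bounded_bilinear_cinner]

lemma bounded_bilinear_scaleC: "bounded_bilinear (scaleC :: complex \<Rightarrow> 'a::chilbert_space \<Rightarrow> 'a)"
  by (rule bounded_bilinear.intro)
     (auto simp: scaleC_add_left scaleC_add_right scaleC_scaleC scaleR_scaleC norm_scaleC
        scaleR_conv_of_real mult.commute intro!: exI[of _ 1])

lemma bounded_opI:
  assumes "\<And>x y. B (x + y) = B x + B y" "\<And>c x. B (c *\<^sub>C x) = c *\<^sub>C B x" "\<And>x. norm (B x) \<le> K * norm x"
  shows "bounded_op (B::'a::chilbert_space \<Rightarrow> 'a)"
  unfolding bounded_op_def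
  by (auto intro!: bounded_linear_intro[where K=K] simp: assms scaleR_scaleC) (metis assms(3) mult.commute)

lemma bounded_op_linear: "bounded_op B \<Longrightarrow> bounded_linear B"
  by (simp add: bounded_op_def)

lemma bounded_op_scaleC: "bounded_op B \<Longrightarrow> B (c *\<^sub>C x) = c *\<^sub>C B x"
  by (simp add: bounded_op_def)

lemma bounded_op_add: "bounded_op B \<Longrightarrow> B (x + y) = B x + B y"
  by (simp add: bounded_op_def linear_simps)

lemma bounded_op_diff: "bounded_op B \<Longrightarrow> B (x - y) = B x - B y"
  by (simp add: bounded_op_def linear_simps)

lemma bounded_op_zero: "bounded_op B \<Longrightarrow> B 0 = 0"
  by (simp add: bounded_op_def linear_simps)

lemma bounded_op_scaleR: "bounded_op B \<Longrightarrow> B (r *\<^sub>R x) = r *\<^sub>R B x"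
  by (simp add: bounded_op_def linear_simps)

text \<open>Totality is left out because partial families occur: subfamilies of a basis, the growing
  families in the argument by Zorn's lemma, and the left singular vectors in Hoelder's
  inequality.\<close>

definition onfam :: "'i set \<Rightarrow> ('i \<Rightarrow> 'h::chilbert_space) \<Rightarrow> bool" where
  "onfam I h \<longleftrightarrow> (\<forall>i\<in>I. \<forall>j\<in>I. cinner (h i) (h j) = (if i = j then 1 else 0))"

lemma onb_onfam: "onb I h \<Longrightarrow> onfam I h"
  by (simp add: onb_def onfam_def)

lemma onfam_subset: "onfam I h \<Longrightarrow> J \<subseteq> I \<Longrightarrow> onfam J h"
  unfolding onfam_def by blast

lemma onfam_norm: "onfam I h \<Longrightarrow> i \<in> I \<Longrightarrow> norm (h i) = 1"
  by (simp add: onfam_def norm_eq_sqrt_cinner)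

lemma onfam_inj: "onfam I h \<Longrightarrow> inj_on h I"
  by (auto simp: onfam_def inj_on_def) (metis zero_neq_one)

lemma orthogonal_sum_norm:
  assumes "finite F" "\<And>i j. i \<in> F \<Longrightarrow> j \<in> F \<Longrightarrow> i \<noteq> j \<Longrightarrow> cinner (v i) (v j) = 0"
  shows "(norm (\<Sum>i\<in>F. v i :: 'h::chilbert_space))\<^sup>2 = (\<Sum>i\<in>F. (norm (v i))\<^sup>2)"
proof -
  have "cinner (\<Sum>i\<in>F. v i) (\<Sum>i\<in>F. v i) = (\<Sum>i\<in>F. \<Sum>j\<in>F. cinner (v i) (v j))"
    unfolding cinner_sum_left by (intro sum.cong refl cinner_sum_right)
  also have "\<dots> = (\<Sum>i\<in>F. \<Sum>j\<in>F. if i = j then cinner (v i) (v j) else 0)"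
    by (intro sum.cong refl) (use assms(2) in auto)
  also have "\<dots> = (\<Sum>i\<in>F. cinner (v i) (v i))"
    using assms(1) by simp
  finally show ?thesis
    by (simp flip: Re_cinner_self)
qed

text \<open>By Pythagoras the squared norm of a difference of nested partial sums is a difference of
  partial sums of the squared norms, so the net of finite sums is Cauchy and completeness gives its
  limit.\<close>

lemma orthogonal_summable:
  fixes v :: "'i \<Rightarrow> 'h::chilbert_space"
  assumes orth: "\<And>i j. i \<in> A \<Longrightarrow> j \<in> A \<Longrightarrow> i \<noteq> j \<Longrightarrow> cinner (v i) (v j) = 0"
    and summ: "(\<lambda>i. (norm (v i))\<^sup>2) summable_on A"
  shows "v summable_on A"
proof -
  obtain L where L: "(sum (\<lambda>i. (norm (v i))\<^sup>2) \<longlongrightarrow> L) (finite_subsets_at_top A)"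
    using summ unfolding summable_on_def has_sum_def by blast
  have "\<exists>P. eventually P (finite_subsets_at_top A) \<and>
      (\<forall>F F'. P F \<and> P F' \<longrightarrow> dist (sum v F) (sum v F') < e)" if "e > 0" for e
  proof -
    \<comment> \<open>Two partial sums within \<open>e\<^sup>2 / 8\<close> of \<open>L\<close>
      differ by less than \<open>(e/2)\<^sup>2\<close>, so \<open>sum v F\<close> lies within
      \<open>e / 2\<close> of \<open>sum v F0\<close>.\<close>
    have "\<forall>\<^sub>F F in finite_subsets_at_top A. dist (\<Sum>i\<in>F. (norm (v i))\<^sup>2) L < e\<^sup>2 / 8"
      using tendstoD[OF L, of "e\<^sup>2 / 8"] that by simp
    then obtain F0 where F0: "finite F0" "F0 \<subseteq> A"
      "\<And>F. finite F \<Longrightarrow> F0 \<subseteq> F \<Longrightarrow> F \<subseteq> A \<Longrightarrow> dist (\<Sum>i\<in>F. (norm (v i))\<^sup>2) L < e\<^sup>2 / 8"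
      by (auto simp: eventually_finite_subsets_at_top)
    define P where "P F \<longleftrightarrow> finite F \<and> F0 \<subseteq> F \<and> F \<subseteq> A" for F
    have "norm (sum v F - sum v F0) < e / 2" if "P F" for F
    proof -
      have "(norm (sum v F - sum v F0))\<^sup>2 = (norm (\<Sum>i\<in>F-F0. v i))\<^sup>2"
        using that by (simp add: P_def sum_diff)
      also have "\<dots> = (\<Sum>i\<in>F-F0. (norm (v i))\<^sup>2)"
        by (rule orthogonal_sum_norm) (use that orth in \<open>auto simp: P_def\<close>)
      also have "\<dots> = (\<Sum>i\<in>F. (norm (v i))\<^sup>2) - (\<Sum>i\<in>F0. (norm (v i))\<^sup>2)"
        using that by (simp add: P_def sum_diff)
      also have "\<dots> < e\<^sup>2 / 4"
      proof -
        have "dist (\<Sum>i\<in>F. (norm (v i))\<^sup>2) L < e\<^sup>2 / 8"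
          by (rule F0(3)) (use that in \<open>auto simp: P_def\<close>)
        moreover have "dist (\<Sum>i\<in>F0. (norm (v i))\<^sup>2) L < e\<^sup>2 / 8"
          by (rule F0(3)) (use F0 in auto)
        ultimately show ?thesis
          unfolding dist_real_def by linarith
      qed
      also have "\<dots> = (e/2)\<^sup>2"
        by (simp add: power_divide)
      finally show ?thesis
        by (rule power2_less_imp_less) (use \<open>e > 0\<close> in simp)
    qed
    then have "dist (sum v F) (sum v F') < e" if "P F" "P F'" for F F'
      using that by (metis dist_norm dist_triangle_half_l)
    moreover have "eventually P (finite_subsets_at_top A)"
      using F0(1,2) by (auto simp: P_def eventually_finite_subsets_at_top)
    ultimately show ?thesis
      by blast
  qed
  then have "cauchy_filter (filtermap (sum v) (finite_subsets_at_top A))"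
    by (simp add: cauchy_filter_metric_filtermap)
  moreover have "complete (UNIV::'h set)"
    by (meson Cauchy_convergent UNIV_I complete_def convergent_def)
  ultimately obtain L' where "(sum v \<longlongrightarrow> L') (finite_subsets_at_top A)"
    using complete_uniform[where S="UNIV::'h set"] by (force simp add: filterlim_def)
  then show ?thesis
    using summable_on_def has_sum_def by blast
qed

lemma bessel_finite:
  assumes "onfam I h" "finite F" "F \<subseteq> I"
  shows "(\<Sum>i\<in>F. (cmod (cinner x (h i)))\<^sup>2) \<le> (norm x)\<^sup>2"
proof -
  define y where "y = (\<Sum>i\<in>F. cinner x (h i) *\<^sub>C h i)"
  have y1: "(norm y)\<^sup>2 = (\<Sum>i\<in>F. (cmod (cinner x (h i)))\<^sup>2)"
    unfolding y_def
    by (subst orthogonal_sum_norm)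
       (use assms in \<open>auto simp: norm_scaleC power_mult_distrib onfam_norm subset_iff
          cinner_scaleC_left cinner_scaleC_right onfam_def intro!: sum.cong\<close>)
  have "cinner x y = (\<Sum>i\<in>F. of_real ((cmod (cinner x (h i)))\<^sup>2))"
    unfolding y_def cinner_sum_right cinner_scaleC_right complex_norm_square
    by (simp add: mult.commute)
  then have "Re (cinner x y) = (norm y)\<^sup>2"
    by (simp add: y1)
  then have "(norm (x - y))\<^sup>2 = (norm x)\<^sup>2 - (norm y)\<^sup>2"
    by (simp add: norm_diff_square)
  then show ?thesis
    using y1 by (metis diff_ge_0_iff_ge zero_le_power2)
qed

lemma bessel_summable:
  assumes "onfam I h"
  shows "(\<lambda>i. (cmod (cinner x (h i)))\<^sup>2) summable_on I"
  by (rule nonneg_bdd_above_summable_on) (auto intro!: bdd_aboveI bessel_finite[OF assms])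

lemma onfam_series_summable:
  assumes "onfam I h" "(\<lambda>i. (cmod (c i))\<^sup>2) summable_on I"
  shows "(\<lambda>i. c i *\<^sub>C h i) summable_on I"
proof (rule orthogonal_summable)
  show "(\<lambda>i. (norm (c i *\<^sub>C h i))\<^sup>2) summable_on I"
    using assms by (simp add: norm_scaleC onfam_norm cong: summable_on_cong)
qed (use assms in \<open>auto simp: onfam_def cinner_scaleC_left cinner_scaleC_right\<close>)

lemma has_sum_cinner_left:
  "(f has_sum S) A \<Longrightarrow> ((\<lambda>i. cinner (f i) (y::'h::chilbert_space)) has_sum cinner S y) A"
  by (rule has_sum_bounded_linear[OF bounded_linear_cinner_left])

lemma has_sum_single:
  assumes "k \<in> A" "\<And>i. i \<in> A \<Longrightarrow> i \<noteq> k \<Longrightarrow> f i = 0"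
  shows "(f has_sum f k) A"
  by (rule has_sum_finite_neutralI[where B="{k}"]) (use assms in auto)

lemma onfam_series_coeff:
  assumes "onfam I h" "((\<lambda>i. c i *\<^sub>C h i) has_sum y) I" "k \<in> I"
  shows "cinner y (h k) = c k"
proof -
  have "((\<lambda>i. cinner (c i *\<^sub>C h i) (h k)) has_sum cinner y (h k)) I"
    by (rule has_sum_cinner_left[OF assms(2)])
  moreover have "((\<lambda>i. cinner (c i *\<^sub>C h i) (h k)) has_sum cinner (c k *\<^sub>C h k) (h k)) I"
    by (rule has_sum_single) (use assms in \<open>auto simp: cinner_scaleC_left onfam_def\<close>)
  ultimately have "cinner y (h k) = cinner (c k *\<^sub>C h k) (h k)"
    by (rule has_sum_unique)
  then show ?thesis
    using assms by (simp add: cinner_scaleC_left onfam_def)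
qed

lemma span_closure_induct:
  assumes "closure (cvec.span S) = UNIV" "closed {x. P x}" "P (0::'h::chilbert_space)"
    "\<And>x y. P x \<Longrightarrow> P y \<Longrightarrow> P (x + y)" "\<And>c x. P x \<Longrightarrow> P (c *\<^sub>C x)" "\<And>x. x \<in> S \<Longrightarrow> P x"
  shows "P x"
proof -
  have "x \<in> {x. P x}" if "x \<in> cvec.span S" for x
    using that by (induction rule: cvec.span_induct_alt) (simp_all add: assms(3-))
  then have "closure (cvec.span S) \<subseteq> {x. P x}"
    by (intro closure_minimal assms(2)) auto
  then show ?thesis
    using assms(1) by auto
qed

lemma onb_eq_zero:
  assumes "onb I h" "\<And>i. i \<in> I \<Longrightarrow> cinner x (h i) = 0"
  shows "x = 0"
proof -
  have "cinner x y = 0" for y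
  proof (rule span_closure_induct[where S="h ` I"])
    show "closed {y. cinner x y = 0}"
      by (intro closed_Collect_eq continuous_on_cinner continuous_intros)
  qed (use assms in \<open>auto simp: onb_def cinner_add_right cinner_scaleC_right\<close>)
  from this[of x] show ?thesis
    by (simp add: cinner_self)
qed

text \<open>Bessel's inequality makes the series converge to some \<open>y\<close> with the same
  coefficients as \<open>x\<close>; totality then forces \<open>y = x\<close>.\<close>

lemma onb_expansion:
  assumes "onb I h"
  shows "((\<lambda>i. cinner x (h i) *\<^sub>C h i) has_sum x) I"
proof -
  have on: "onfam I h"
    using assms by (rule onb_onfam)
  obtain y where y: "((\<lambda>i. cinner x (h i) *\<^sub>C h i) has_sum y) I"
    using onfam_series_summable[OF on bessel_summable[OF on]] unfolding summable_on_def by blast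
  have "x - y = 0"
    by (rule onb_eq_zero[OF assms])
       (use onfam_series_coeff[OF on y] in \<open>simp add: cinner_diff_left\<close>)
  then show ?thesis
    using y by simp
qed

lemma onb_parseval_cinner:
  assumes "onb I h"
  shows "((\<lambda>i. cinner x (h i) * cinner (h i) y) has_sum cinner x y) I"
  using has_sum_cinner_left[OF onb_expansion[OF assms]] by (simp add: cinner_scaleC_left)

lemma onb_parseval:
  assumes "onb I h"
  shows "((\<lambda>i. (cmod (cinner x (h i)))\<^sup>2) has_sum (norm x)\<^sup>2) I"
proof -
  have "cinner x (h i) * cinner (h i) x = of_real ((cmod (cinner x (h i)))\<^sup>2)" for i
    by (metis cinner_commute complex_norm_square)
  then have "((\<lambda>i. of_real ((cmod (cinner x (h i)))\<^sup>2)) has_sum (of_real ((norm x)\<^sup>2) :: complex)) I"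
    using onb_parseval_cinner[OF assms, of x x] by (simp only: cinner_self)
  then show ?thesis
    by (simp only: has_sum_of_real_iff)
qed

lemma onb_extI:
  assumes "onb I h" "\<And>i. i \<in> I \<Longrightarrow> cinner x (h i) = cinner y (h i)"
  shows "x = y"
  using onb_eq_zero[OF assms(1), of "x - y"] assms(2) by (simp add: cinner_diff_left)

lemma bounded_op_eq_onb:
  assumes "onb I h" "bounded_op P" "bounded_op Q" "\<And>i. i \<in> I \<Longrightarrow> P (h i) = Q (h i)"
  shows "P = Q"
proof
  fix x
  have *: "((\<lambda>i. cinner x (h i) *\<^sub>C P (h i)) has_sum P x) I" if "bounded_op P" for P
    using has_sum_bounded_linear[OF bounded_op_linear[OF that] onb_expansion[OF assms(1), of x]]
    by (simp add: bounded_op_scaleC[OF that])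
  show "P x = Q x"
    using *[OF assms(2)] *[OF assms(3)] assms(4) by (metis (no_types, lifting) has_sum_cong has_sum_unique)
qed

text \<open>Subtracting from \<open>x\<close> the sum of its own series leaves a vector orthogonal
  to the family, hence 0, so \<open>x\<close> is a limit of finite combinations. This certifies that
  a maximal family of eigenvectors is a basis.\<close>

lemma onbI:
  assumes "onfam I h" "\<And>x. (\<And>i. i \<in> I \<Longrightarrow> cinner x (h i) = 0) \<Longrightarrow> x = 0"
  shows "onb I h"
proof -
  have "x \<in> closure (cvec.span (h ` I))" for x
  proof -
    obtain y where y: "((\<lambda>i. cinner x (h i) *\<^sub>C h i) has_sum y) I"
      using onfam_series_summable[OF assms(1) bessel_summable[OF assms(1)]] unfolding summable_on_def by blast
    have "x - y = 0"
      by (rule assms(2)) (use onfam_series_coeff[OF assms(1) y] in \<open>simp add: cinner_diff_left\<close>)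
    then have "x = y"
      by simp
    moreover have "y \<in> closure (cvec.span (h ` I))"
    proof (rule Lim_in_closed_set[OF closed_closure])
      show "(sum (\<lambda>i. cinner x (h i) *\<^sub>C h i) \<longlongrightarrow> y) (finite_subsets_at_top I)"
        using y by (simp add: has_sum_def)
      show "\<forall>\<^sub>F F in finite_subsets_at_top I.
          (\<Sum>i\<in>F. cinner x (h i) *\<^sub>C h i) \<in> closure (cvec.span (h ` I))"
        by (rule eventually_finite_subsets_at_top_weakI, rule subsetD[OF closure_subset])
           (blast intro: cvec.span_sum cvec.span_scale cvec.span_base)
    qed simp
    ultimately show ?thesis by simp
  qed
  then show ?thesis
    using assms(1) by (auto simp: onb_def onfam_def)
qed

section \<open>Spectral theory of compact operators\<close>

lemma cinner_ext_right: "(\<And>x. cinner x y = cinner x (z::'h::chilbert_space)) \<Longrightarrow> y = z"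
  by (metis cinner_diff_right cinner_self eq_iff_diff_eq_0 norm_eq_zero of_real_eq_0_iff zero_eq_power2)

lemma cadjoint_eqI:
  assumes "\<And>x. cinner (B x) y = cinner x z"
  shows "cadjoint B y = z"
  unfolding cadjoint_def by (rule the_equality) (use assms in \<open>auto intro: cinner_ext_right\<close>)

lemma bounded_op_has_sum:
  assumes "onb I h" "bounded_op B"
  shows "((\<lambda>i. cinner x (h i) *\<^sub>C B (h i)) has_sum B x) I"
  using has_sum_bounded_linear[OF bounded_op_linear[OF assms(2)] onb_expansion[OF assms(1), of x]]
  by (simp add: bounded_op_scaleC[OF assms(2)])

lemma le_square_if_le_mult_sqrt:
  fixes S :: real
  assumes "0 \<le> S" "S \<le> M * sqrt S"
  shows "S \<le> M\<^sup>2"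
proof (cases "S = 0")
  case False
  then have "sqrt S * sqrt S \<le> M * sqrt S" "0 < sqrt S"
    using assms by auto
  then have "sqrt S \<le> M"
    by (metis mult_le_cancel_right_pos)
  then have "(sqrt S)\<^sup>2 \<le> M\<^sup>2"
    using assms(1) by (intro power_mono) auto
  then show ?thesis
    using assms(1) by simp
qed simp

text \<open>The representing vector must have the coefficients \<open>c i\<close>. They are square
  summable because testing \<open>B\<close> on a finite sum with these same coefficients bounds the
  sum \<open>S\<close> of their squares by a multiple of \<open>sqrt S\<close>, hence by a
  constant.\<close>

lemma cadjoint_ex:
  fixes h :: "'i \<Rightarrow> 'h::chilbert_space" and B :: "'h \<Rightarrow> 'h"
  assumes "onb I h" "bounded_op B"
  shows "\<exists>z. \<forall>x. cinner (B x) y = cinner x z"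
proof -
  have on: "onfam I h"
    using assms by (simp add: onb_onfam)
  define c where "c i = cnj (cinner (B (h i)) y)" for i
  obtain K where K: "0 \<le> K" "\<And>x. norm (B x) \<le> norm x * K"
    using bounded_linear.nonneg_bounded[OF bounded_op_linear[OF assms(2)]] by blast
  have "(\<Sum>i\<in>F. (cmod (c i))\<^sup>2) \<le> (K * norm y)\<^sup>2" if F: "finite F" "F \<subseteq> I" for F
  proof (rule le_square_if_le_mult_sqrt)
    define x where "x = (\<Sum>i\<in>F. c i *\<^sub>C h i)"
    have nx: "(norm x)\<^sup>2 = (\<Sum>i\<in>F. (cmod (c i))\<^sup>2)"
      unfolding x_def by (subst orthogonal_sum_norm)
        (use F on in \<open>auto simp: norm_scaleC power_mult_distrib onfam_norm subset_iff
          cinner_scaleC_left cinner_scaleC_right onfam_def intro!: sum.cong\<close>)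
    have "B x = (\<Sum>i\<in>F. c i *\<^sub>C B (h i))"
      unfolding x_def by (simp add: linear_sum[OF bounded_linear.linear[OF bounded_op_linear[OF assms(2)]]]
          bounded_op_scaleC[OF assms(2)])
    then have "cinner (B x) y = (\<Sum>i\<in>F. c i * cnj (c i))"
      by (simp add: cinner_sum_left cinner_scaleC_left c_def)
    also have "\<dots> = of_real (\<Sum>i\<in>F. (cmod (c i))\<^sup>2)"
      by (simp add: complex_norm_square del: of_real_power)
    finally have "(\<Sum>i\<in>F. (cmod (c i))\<^sup>2) = cmod (cinner (B x) y)"
      by (simp add: sum_nonneg del: of_real_sum)
    also have "\<dots> \<le> norm (B x) * norm y"
      by (rule cinner_Cauchy_Schwarz)
    also have "\<dots> \<le> norm x * K * norm y"
      by (intro mult_right_mono K) auto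
    also have "norm x = sqrt (\<Sum>i\<in>F. (cmod (c i))\<^sup>2)"
      using nx by (metis norm_ge_zero real_sqrt_unique)
    finally show "(\<Sum>i\<in>F. (cmod (c i))\<^sup>2) \<le> (K * norm y) * sqrt (\<Sum>i\<in>F. (cmod (c i))\<^sup>2)"
      by (simp add: mult_ac)
  qed (auto intro: sum_nonneg)
  then have "(\<lambda>i. (cmod (c i))\<^sup>2) summable_on I"
    by (intro nonneg_bdd_above_summable_on) (auto intro!: bdd_aboveI)
  from onfam_series_summable[OF on this] obtain z where z: "((\<lambda>i. c i *\<^sub>C h i) has_sum z) I"
    unfolding summable_on_def by blast
  have "cinner (B x) y = cinner x z" for x
  proof -
    have "((\<lambda>i. cinner x (h i) * cinner (B (h i)) y) has_sum cinner (B x) y) I"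
      using has_sum_cinner_left[OF bounded_op_has_sum[OF assms]] by (simp add: cinner_scaleC_left)
    moreover have "cinner (h i) z = cinner (B (h i)) y" if "i \<in> I" for i
      using onfam_series_coeff[OF on z that] cinner_commute[of "h i" z] by (simp add: c_def)
    then have "((\<lambda>i. cinner x (h i) * cinner (B (h i)) y) has_sum cinner x z) I"
      using onb_parseval_cinner[OF assms(1), of x z] by (simp cong: has_sum_cong)
    ultimately show ?thesis
      by (rule has_sum_unique)
  qed
  then show ?thesis
    by blast
qed

lemma cinner_cadjoint:
  fixes h :: "'i \<Rightarrow> 'h::chilbert_space" and B :: "'h \<Rightarrow> 'h"
  assumes "onb I h" "bounded_op B"
  shows "cinner (B x) y = cinner x (cadjoint B y)"
  using cadjoint_ex[OF assms, of y] cadjoint_eqI[of B y] by metis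

lemma cinner_cadjoint_left:
  fixes h :: "'i \<Rightarrow> 'h::chilbert_space" and B :: "'h \<Rightarrow> 'h"
  assumes "onb I h" "bounded_op B"
  shows "cinner (cadjoint B x) y = cinner x (B y)"
  by (metis assms cinner_cadjoint cinner_commute)

lemma bounded_op_bound:
  assumes "bounded_op B"
  obtains K where "0 < K" "\<And>x. norm (B x) \<le> K * norm x"
  using bounded_linear.pos_bounded[OF bounded_op_linear[OF assms]] by (metis mult.commute)

lemma bounded_op_cadjoint:
  fixes h :: "'i \<Rightarrow> 'h::chilbert_space" and B :: "'h \<Rightarrow> 'h"
  assumes "onb I h" "bounded_op B"
  shows "bounded_op (cadjoint B)"
proof -
  obtain K where K: "0 < K" "\<And>x. norm (B x) \<le> K * norm x"
    using bounded_op_bound[OF assms(2)] by blast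
  show ?thesis
  proof (rule bounded_opI)
    show "cadjoint B (x + y) = cadjoint B x + cadjoint B y" for x y
      by (rule cadjoint_eqI) (simp add: cinner_add_right cinner_cadjoint[OF assms])
    show "cadjoint B (c *\<^sub>C x) = c *\<^sub>C cadjoint B x" for c x
      by (rule cadjoint_eqI) (simp add: cinner_scaleC_right cinner_cadjoint[OF assms])
    show "norm (cadjoint B x) \<le> K * norm x" for x
    proof -
      have "(norm (cadjoint B x))\<^sup>2 = Re (cinner (B (cadjoint B x)) x)"
        by (simp add: cinner_cadjoint[OF assms] Re_cinner_self)
      also have "\<dots> \<le> norm (B (cadjoint B x)) * norm x"
        by (meson cinner_Cauchy_Schwarz complex_Re_le_cmod order_trans)
      also have "\<dots> \<le> K * norm (cadjoint B x) * norm x"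
        by (intro mult_right_mono K) auto
      finally have "norm (cadjoint B x) * norm (cadjoint B x) \<le> K * norm x * norm (cadjoint B x)"
        by (simp add: power2_eq_square mult_ac)
      then show ?thesis
        using K(1) by (cases "cadjoint B x = 0") (auto simp: mult_le_cancel_right)
    qed
  qed
qed

lemma bounded_op_compose: "bounded_op A \<Longrightarrow> bounded_op B \<Longrightarrow> bounded_op (A \<circ> B)"
  unfolding bounded_op_def by (auto simp: o_def intro: bounded_linear_compose)

lemma compact_op_bounded: "compact_op B \<Longrightarrow> bounded_op B"
  by (simp add: compact_op_def)

lemma tendsto_bounded_op: "bounded_op B \<Longrightarrow> (f \<longlongrightarrow> a) F \<Longrightarrow> ((\<lambda>x. B (f x)) \<longlongrightarrow> B a) F"
  by (rule bounded_linear.tendsto[OF bounded_op_linear])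

lemma compact_op_subseq:
  assumes "compact_op B" "\<And>n. norm (x n :: 'h::chilbert_space) \<le> 1"
  obtains r y where "strict_mono (r :: nat \<Rightarrow> nat)" "(\<lambda>n. B (x (r n))) \<longlonglongrightarrow> y"
proof -
  have "compact (closure (B ` cball 0 1))"
    using assms(1) unfolding compact_op_def by blast
  moreover have "B (x n) \<in> closure (B ` cball 0 1)" for n
    by (rule subsetD[OF closure_subset], rule imageI) (simp add: assms(2))
  ultimately obtain l r where "strict_mono (r :: nat \<Rightarrow> nat)" "((\<lambda>n. B (x n)) \<circ> r) \<longlonglongrightarrow> l"
    using seq_compactE[of "closure (B ` cball 0 1)" "\<lambda>n. B (x n)"]
    unfolding compact_eq_seq_compact_metric by metis
  then show ?thesis
    using that by (simp add: o_def)
qed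

text \<open>The Rayleigh quotient of \<open>B\<^sup>* B\<close> attains its supremum on an invariant subspace.\<close>
lemma compact_op_eigenvector:
  fixes h :: "'i \<Rightarrow> 'h::chilbert_space" and B :: "'h \<Rightarrow> 'h"
  assumes onb: "onb I h" and B: "compact_op B"
    and W: "closed W" "\<And>x y. x \<in> W \<Longrightarrow> y \<in> W \<Longrightarrow> x + y \<in> W" "\<And>c x. x \<in> W \<Longrightarrow> c *\<^sub>C x \<in> W"
    and inv: "\<And>x. x \<in> W \<Longrightarrow> cadjoint B (B x) \<in> W"
    and ne: "w \<in> W" "w \<noteq> 0"
  shows "\<exists>x\<in>W. norm x = 1 \<and> (\<exists>k\<ge>0. cadjoint B (B x) = k\<^sup>2 *\<^sub>R x)"
proof -
  have bB: "bounded_op B"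
    by (rule compact_op_bounded[OF B])
  obtain K where K: "0 < K" "\<And>x. norm (B x) \<le> K * norm x"
    using bounded_op_bound[OF bB] by blast
  have scR: "c *\<^sub>R x \<in> W" if "x \<in> W" for c x
    using W(3)[OF that] by (simp add: scaleR_scaleC)
  define S where "S = {norm (B x) |x. x \<in> W \<and> norm x = 1}"
  define s where "s = Sup S"
  have unit: "(1 / norm x) *\<^sub>R x \<in> W" "norm ((1 / norm x) *\<^sub>R x) = 1" if "x \<in> W" "x \<noteq> 0" for x
    using that by (auto intro: scR)
  have "S \<noteq> {}"
    using unit[OF ne] unfolding S_def by blast
  have bdd: "bdd_above S"
    unfolding S_def by (rule bdd_aboveI[where M=K]) (use K in \<open>auto, metis mult.right_neutral\<close>)
  have s_le: "norm (B x) \<le> s * norm x" if "x \<in> W" for x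
  proof (cases "x = 0")
    case False
    have "norm (B ((1 / norm x) *\<^sub>R x)) \<le> s"
      unfolding s_def by (rule cSup_upper[OF _ bdd]) (use unit[OF that False] in \<open>auto simp: S_def\<close>)
    then show ?thesis
      using False by (simp add: bounded_op_scaleR[OF bB] field_simps)
  qed (simp add: bounded_op_zero[OF bB])
  have s0: "0 \<le> s"
    using s_le[OF unit(1)[OF ne]] unit(2)[OF ne] by (metis mult.right_neutral norm_ge_zero order_trans)
  have "\<exists>x. x \<in> W \<and> norm x = 1 \<and> s - 1 / real (Suc n) < norm (B x)" for n
    using less_cSup_iff[OF \<open>S \<noteq> {}\<close> bdd, of "s - 1 / real (Suc n)"]
    unfolding s_def[symmetric] by (auto simp: S_def)
  then obtain x where x: "\<And>n. x n \<in> W" "\<And>n. norm (x n) = 1" "\<And>n. s - 1 / real (Suc n) < norm (B (x n))"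
    by metis
  show ?thesis
  proof (cases "s = 0")
    \<comment> \<open>Here \<open>B\<close> vanishes on \<open>W\<close>, so every unit vector of
      \<open>W\<close> is an eigenvector with \<open>k = 0\<close>.\<close>
    case True
    have "B (x 0) = 0"
      using s_le[OF x(1)[of 0]] True by simp
    moreover have "cadjoint B 0 = 0"
      by (rule cadjoint_eqI) simp
    ultimately show ?thesis
      using x(1,2)[of 0] by (intro bexI[of _ "x 0"]) (auto intro!: exI[of _ 0])
  next
    case False
    then have "0 < s"
      using s0 by simp
    have lim: "(\<lambda>n. norm (B (x n))) \<longlonglongrightarrow> s"
    proof (rule tendsto_sandwich)
      show "(\<lambda>n. s - 1 / real (Suc n)) \<longlonglongrightarrow> s"
        using tendsto_diff[OF tendsto_const LIMSEQ_inverse_real_of_nat, of s] by (simp add: inverse_eq_divide)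
      show "\<forall>\<^sub>F n in sequentially. s - 1 / real (Suc n) \<le> norm (B (x n))"
        using x(3) by (intro always_eventually) (auto intro: less_imp_le)
      show "\<forall>\<^sub>F n in sequentially. norm (B (x n)) \<le> s"
        using s_le[OF x(1)] x(2) by (intro always_eventually) simp
    qed simp
    let ?K = "\<lambda>x. cadjoint B (B x)"
    have bK: "bounded_op ?K"
      using bounded_op_compose[OF bounded_op_cadjoint[OF onb bB] bB] by (simp add: o_def)
    have nK: "norm (?K y) \<le> s\<^sup>2 * norm y" if "y \<in> W" for y
    proof -
      have "(norm (?K y))\<^sup>2 = Re (cinner (B (?K y)) (B y))"
        by (simp add: cinner_cadjoint[OF onb bB] Re_cinner_self)
      also have "\<dots> \<le> norm (B (?K y)) * norm (B y)"
        by (meson cinner_Cauchy_Schwarz complex_Re_le_cmod order_trans)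
      also have "\<dots> \<le> (s * norm (?K y)) * (s * norm y)"
        by (intro mult_mono s_le that inv) (use s0 in auto)
      finally have "norm (?K y) * norm (?K y) \<le> s\<^sup>2 * norm y * norm (?K y)"
        by (simp add: power2_eq_square mult_ac)
      then show ?thesis
        by (cases "?K y = 0") (auto simp: mult_le_cancel_right)
    qed
    \<comment> \<open>Compactness controls only \<open>B (x n)\<close>, so the maximising sequence
      is first shown to be asymptotically an eigenvector: the squared defect is at most
      \<open>2 * s\<^sup>2 * (s\<^sup>2 - (norm (B (x n)))\<^sup>2)\<close>.\<close>
    have diff: "(\<lambda>n. ?K (x n) - s\<^sup>2 *\<^sub>R x n) \<longlonglongrightarrow> 0"
    proof -
      have "(norm (?K (x n) - s\<^sup>2 *\<^sub>R x n))\<^sup>2 \<le> 2 * s\<^sup>2 * (s\<^sup>2 - (norm (B (x n)))\<^sup>2)" for n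
      proof -
        have "Re (cinner (?K (x n)) (s\<^sup>2 *\<^sub>R x n)) = s\<^sup>2 * (norm (B (x n)))\<^sup>2"
          by (simp add: cinner_scaleR_right cinner_cadjoint_left[OF onb bB] Re_cinner_self del: of_real_power)
        moreover have "(norm (?K (x n)))\<^sup>2 \<le> (s\<^sup>2)\<^sup>2"
          using nK[OF x(1)[of n]] x(2)[of n] by (intro power_mono) auto
        moreover have "(norm (s\<^sup>2 *\<^sub>R x n))\<^sup>2 = (s\<^sup>2)\<^sup>2"
          by (simp add: x(2))
        ultimately have "(norm (?K (x n) - s\<^sup>2 *\<^sub>R x n))\<^sup>2 \<le> (s\<^sup>2)\<^sup>2 - 2 * (s\<^sup>2 * (norm (B (x n)))\<^sup>2) + (s\<^sup>2)\<^sup>2"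
          unfolding norm_diff_square by linarith
        then show ?thesis
          by (simp add: algebra_simps power2_eq_square)
      qed
      moreover have "(\<lambda>n. 2 * s\<^sup>2 * (s\<^sup>2 - (norm (B (x n)))\<^sup>2)) \<longlonglongrightarrow> 2 * s\<^sup>2 * (s\<^sup>2 - s\<^sup>2)"
        by (intro tendsto_intros lim)
      ultimately have "(\<lambda>n. (norm (?K (x n) - s\<^sup>2 *\<^sub>R x n))\<^sup>2) \<longlonglongrightarrow> 0"
        by (rule_tac tendsto_sandwich[where f="\<lambda>_. 0" and h="\<lambda>n. 2 * s\<^sup>2 * (s\<^sup>2 - (norm (B (x n)))\<^sup>2)"])
          (simp_all add: always_eventually)
      then show ?thesis
        by (simp add: tendsto_norm_zero_iff)
    qed
    obtain r y where r: "strict_mono (r :: nat \<Rightarrow> nat)" "(\<lambda>n. B (x (r n))) \<longlonglongrightarrow> y"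
      using compact_op_subseq[OF B, of x] x(2) by auto
    \<comment> \<open>Along the subsequence \<open>s\<^sup>2 *\<^sub>R x (r n)\<close> differs from
      \<open>?K (x (r n))\<close> by a null sequence, and the latter tends to
      \<open>cadjoint B y\<close>; dividing by \<open>s\<^sup>2 > 0\<close> recovers the limit of
      the vectors themselves.\<close>
    define u where "u = (1 / s\<^sup>2) *\<^sub>R cadjoint B y"
    have "(\<lambda>n. ?K (x (r n)) - (?K (x (r n)) - s\<^sup>2 *\<^sub>R x (r n))) \<longlonglongrightarrow> cadjoint B y - 0"
      using LIMSEQ_subseq_LIMSEQ[OF diff r(1)]
      by (intro tendsto_diff tendsto_bounded_op[OF bounded_op_cadjoint[OF onb bB] r(2)]) (simp add: o_def)
    then have "(\<lambda>n. (1 / s\<^sup>2) *\<^sub>R (s\<^sup>2 *\<^sub>R x (r n))) \<longlonglongrightarrow> u"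
      unfolding u_def by (intro tendsto_scaleR tendsto_const) simp
    then have xu: "(\<lambda>n. x (r n)) \<longlonglongrightarrow> u"
      using \<open>0 < s\<close> by simp
    have "u \<in> W"
      by (rule closed_sequentially[OF W(1) _ xu]) (simp add: x(1))
    moreover have "norm u = 1"
      using tendsto_norm[OF xu] by (simp add: x(2) LIMSEQ_const_iff)
    moreover have "?K u - s\<^sup>2 *\<^sub>R u = 0"
    proof (rule LIMSEQ_unique)
      show "(\<lambda>n. ?K (x (r n)) - s\<^sup>2 *\<^sub>R x (r n)) \<longlonglongrightarrow> ?K u - s\<^sup>2 *\<^sub>R u"
        by (intro tendsto_intros tendsto_bounded_op[OF bK] xu)
      show "(\<lambda>n. ?K (x (r n)) - s\<^sup>2 *\<^sub>R x (r n)) \<longlonglongrightarrow> 0"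
        using LIMSEQ_subseq_LIMSEQ[OF diff r(1)] by (simp add: o_def)
    qed
    ultimately show ?thesis
      using s0 by auto
  qed
qed

text \<open>Zorn's lemma gives a maximal orthonormal set of eigenvectors of \<open>B\<close>
  followed by its adjoint. Its orthogonal complement is closed and, by symmetry, invariant, so a
  nonzero vector there would produce a further eigenvector. The numbers \<open>q e\<close> are the
  singular values, with 0 on the kernel.\<close>

theorem compact_op_spectral:
  fixes h :: "'i \<Rightarrow> 'h::chilbert_space" and B :: "'h \<Rightarrow> 'h"
  assumes onb: "onb I h" and B: "compact_op B"
  shows "\<exists>E q. onb E (\<lambda>x. x) \<and> (\<forall>e\<in>E. 0 \<le> q e \<and> cadjoint B (B e) = (q e)\<^sup>2 *\<^sub>R e)"
proof -
  have bB: "bounded_op B"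
    by (rule compact_op_bounded[OF B])
  let ?K = "\<lambda>x. cadjoint B (B x)"
  define C where "C = {E. onfam E (\<lambda>x. x) \<and> (\<forall>e\<in>E. \<exists>k\<ge>0. ?K e = k\<^sup>2 *\<^sub>R e)}"
  have "\<Union>c \<in> C" if c: "subset.chain C c" for c
  proof -
    have "onfam (\<Union>c) (\<lambda>x. x)"
      unfolding onfam_def
    proof (intro ballI)
      fix x y assume "x \<in> \<Union>c" "y \<in> \<Union>c"
      then obtain X Y where XY: "X \<in> c" "Y \<in> c" "x \<in> X" "y \<in> Y"
        by blast
      then have "X \<subseteq> Y \<or> Y \<subseteq> X"
        using c unfolding subset.chain_def by blast
      then obtain Z where "Z \<in> c" "x \<in> Z" "y \<in> Z"
        using XY by blast
      then show "cinner x y = (if x = y then 1 else 0)"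
        using c unfolding subset.chain_def C_def onfam_def by blast
    qed
    then show ?thesis
      using c unfolding subset.chain_def C_def by blast
  qed
  from subset_Zorn'[OF this] obtain E where E: "E \<in> C" and max: "\<And>X. X \<in> C \<Longrightarrow> E \<subseteq> X \<Longrightarrow> X = E"
    by blast
  have on: "onfam E (\<lambda>x. x)" and eig: "\<And>e. e \<in> E \<Longrightarrow> \<exists>k\<ge>0. ?K e = k\<^sup>2 *\<^sub>R e"
    using E by (auto simp: C_def)
  have "onb E (\<lambda>x. x)"
  proof (rule onbI[OF on], rule ccontr)
    fix w assume w: "\<And>i. i \<in> E \<Longrightarrow> cinner w i = 0" "w \<noteq> 0"
    define W where "W = {x. \<forall>e\<in>E. cinner x e = 0}"
    have "\<exists>x\<in>W. norm x = 1 \<and> (\<exists>k\<ge>0. ?K x = k\<^sup>2 *\<^sub>R x)"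
    proof (rule compact_op_eigenvector[OF onb B])
      show "closed W"
        unfolding W_def Ball_def
        by (intro closed_Collect_all closed_Collect_imp closed_Collect_eq continuous_on_cinner
            continuous_intros) simp
      show "?K x \<in> W" if "x \<in> W" for x
        unfolding W_def
      proof (intro CollectI ballI)
        fix e assume "e \<in> E"
        then obtain k where k: "?K e = k\<^sup>2 *\<^sub>R e"
          using eig by blast
        have "cinner (?K x) e = cinner x (?K e)"
          by (simp add: cinner_cadjoint_left[OF onb bB] cinner_cadjoint[OF onb bB])
        then show "cinner (?K x) e = 0"
          using that \<open>e \<in> E\<close> by (simp add: k cinner_scaleR_right W_def)
      qed
    qed (use w in \<open>auto simp: W_def cinner_add_left cinner_scaleC_left\<close>)
    then obtain x k where x: "x \<in> W" "norm x = 1" "k \<ge> 0" "?K x = k\<^sup>2 *\<^sub>R x"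
      by blast
    have xe: "cinner e x = 0" "cinner x e = 0" if "e \<in> E" for e
      using x(1) that cinner_commute[of e x] by (auto simp: W_def)
    have "onfam (insert x E) (\<lambda>x. x)"
      using on x(2) xe cinner_self[of x] by (auto simp: onfam_def)
    then have "insert x E \<in> C"
      using x(3,4) eig by (auto simp: C_def)
    then have "x \<in> E"
      using max[of "insert x E"] by auto
    then show False
      using xe[of x] x(2) cinner_self[of x] by simp
  qed
  moreover obtain q where "\<And>e. e \<in> E \<Longrightarrow> q e \<ge> 0 \<and> ?K e = (q e)\<^sup>2 *\<^sub>R e"
    using eig by metis
  ultimately show ?thesis
    by blast
qed

section \<open>Operators diagonal in an orthonormal basis, and the absolute value of an
  operator\<close>

lemma diag_coeff:
  assumes "onb I h" "bounded_op P" "\<And>i. i \<in> I \<Longrightarrow> P (h i) = q i *\<^sub>R h i" "i \<in> I"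
  shows "cinner (P x) (h i) = of_real (q i) * cinner x (h i)"
proof -
  have "((\<lambda>i. cinner x (h i) *\<^sub>C P (h i)) has_sum P x) I"
    by (rule bounded_op_has_sum[OF assms(1,2)])
  then have "((\<lambda>i. (cinner x (h i) * of_real (q i)) *\<^sub>C h i) has_sum P x) I"
    using assms(3) by (simp add: scaleR_scaleC scaleC_scaleC cong: has_sum_cong)
  then show ?thesis
    using onfam_series_coeff[OF onb_onfam[OF assms(1)] _ assms(4)] by (metis mult.commute)
qed

lemma diag_cadjoint:
  assumes "onb I h" "bounded_op P" "\<And>i. i \<in> I \<Longrightarrow> P (h i) = q i *\<^sub>R h i" "i \<in> I"
  shows "cadjoint P (h i) = q i *\<^sub>R h i"
  by (rule cadjoint_eqI) (simp add: diag_coeff[OF assms] cinner_scaleR_right)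

lemma diag_op_exists:
  assumes onb: "onb I h" and q: "\<And>i. i \<in> I \<Longrightarrow> \<bar>q i\<bar> \<le> C"
  shows "\<exists>P. bounded_op P \<and> (\<forall>i\<in>I. P (h i) = q i *\<^sub>R (h i :: 'h::chilbert_space))"
proof -
  have on: "onfam I h"
    by (rule onb_onfam[OF onb])
  have le: "(cmod (of_real (q i) * cinner x (h i)))\<^sup>2 \<le> C\<^sup>2 * (cmod (cinner x (h i)))\<^sup>2" if "i \<in> I" for i x
    using q[OF that] by (auto simp: norm_mult power_mult_distrib intro!: mult_right_mono abs_le_square_iff[THEN iffD1])
  have sb: "(\<lambda>i. C\<^sup>2 * (cmod (cinner x (h i)))\<^sup>2) summable_on I" for x
    by (intro summable_on_cmult_right bessel_summable[OF on])
  have "(\<lambda>i. (cmod (of_real (q i) * cinner x (h i)))\<^sup>2) summable_on I" for x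
    by (rule summable_on_comparison_test[OF sb le]) auto
  from onfam_series_summable[OF on this]
  obtain P where P: "\<And>x. ((\<lambda>i. (of_real (q i) * cinner x (h i)) *\<^sub>C h i) has_sum P x) I"
    unfolding summable_on_def by metis
  have coeff: "cinner (P x) (h i) = of_real (q i) * cinner x (h i)" if "i \<in> I" for i x
    by (rule onfam_series_coeff[OF on P that])
  have "bounded_op P"
  proof (rule bounded_opI)
    show "P (x + y) = P x + P y" for x y
      by (rule onb_extI[OF onb]) (simp add: coeff cinner_add_left algebra_simps)
    show "P (c *\<^sub>C x) = c *\<^sub>C P x" for c x
      by (rule onb_extI[OF onb]) (simp add: coeff cinner_scaleC_left algebra_simps)
    show "norm (P x) \<le> \<bar>C\<bar> * norm x" for x
    proof -
      have "(norm (P x))\<^sup>2 \<le> C\<^sup>2 * (norm x)\<^sup>2"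
        by (rule has_sum_mono[OF onb_parseval[OF onb] has_sum_cmult_right[OF onb_parseval[OF onb]]])
           (use le coeff in simp)
      then have "(norm (P x))\<^sup>2 \<le> (\<bar>C\<bar> * norm x)\<^sup>2"
        by (simp add: power_mult_distrib)
      then show ?thesis
        by (rule power2_le_imp_le) simp
    qed
  qed
  moreover have "P (h i) = q i *\<^sub>R h i" if "i \<in> I" for i
    by (rule onb_extI[OF onb]) (use on that in \<open>auto simp: coeff cinner_scaleR_left onfam_def\<close>)
  ultimately show ?thesis
    by blast
qed

lemma diag_positive:
  assumes "onb I h" "bounded_op P" "\<And>i. i \<in> I \<Longrightarrow> P (h i) = q i *\<^sub>R h i" "\<And>i. i \<in> I \<Longrightarrow> 0 \<le> q i"
  shows "positive_op P"
  unfolding positive_op_def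
proof (intro conjI allI assms(2))
  fix x
  have "((\<lambda>i. cinner (P x) (h i) * cinner (h i) x) has_sum cinner (P x) x) I"
    by (rule onb_parseval_cinner[OF assms(1)])
  moreover have "cinner (P x) (h i) * cinner (h i) x = of_real (q i * (cmod (cinner x (h i)))\<^sup>2)" if "i \<in> I" for i
    using cinner_commute[of "h i" x]
    by (simp add: diag_coeff[OF assms(1-3) that] complex_norm_square mult.assoc del: of_real_power)
  ultimately have *: "((\<lambda>i. of_real (q i * (cmod (cinner x (h i)))\<^sup>2)) has_sum cinner (P x) x) I"
    by (simp cong: has_sum_cong)
  have "((\<lambda>_. 0) has_sum Im (cinner (P x) x)) I"
    using has_sum_Im[OF *] by simp
  then have "Im (cinner (P x) x) = 0"
    by (rule has_sum_unique) simp
  then show "cinner (P x) x \<in> \<real>"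
    by (simp add: complex_is_Real_iff)
  show "0 \<le> Re (cinner (P x) x)"
    using has_sum_Re[OF *] by (rule has_sum_nonneg) (simp add: assms(4))
qed

text \<open>The defect \<open>y = P x - q *\<^sub>R x\<close> satisfies
  \<open>P y = - (q *\<^sub>R y)\<close>, which contradicts positivity if \<open>q > 0\<close> and
  \<open>y\<close> is nonzero. If \<open>q = 0\<close>, positivity at
  \<open>x + t *\<^sub>R y\<close> for all real \<open>t\<close> takes over. This is uniqueness of
  the positive square root, one eigenvector at a time.\<close>

lemma positive_op_sqrt_eigen:
  assumes "positive_op P" "P (P x) = q\<^sup>2 *\<^sub>R x" "0 \<le> q"
  shows "P x = q *\<^sub>R x"
proof -
  have bP: "bounded_op P" and pos: "\<And>x. cinner (P x) x \<in> \<real>" "\<And>x. 0 \<le> Re (cinner (P x) x)"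
    using assms(1) by (auto simp: positive_op_def)
  define y where "y = P x - q *\<^sub>R x"
  have Py: "P y = - (q *\<^sub>R y)"
    by (simp add: y_def bounded_op_diff[OF bP] bounded_op_scaleR[OF bP] assms(2) algebra_simps power2_eq_square)
  have "y = 0"
  proof (cases "q = 0")
    case False
    have "cinner (P y) y = - of_real (q * (norm y)\<^sup>2)"
      by (simp add: Py cinner_minus_left cinner_scaleR_left cinner_self)
    then have "q * (norm y)\<^sup>2 \<le> 0"
      using pos(2)[of y] by simp
    then show ?thesis
      using False assms(3) by (simp add: mult_le_0_iff)
  next
    case True
    then have y: "y = P x" "P y = 0"
      using Py by (auto simp: y_def)
    have "0 \<le> Re (cinner y x) + t * (norm y)\<^sup>2" for t
    proof -
      have "P (x + t *\<^sub>R y) = y"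
        using y by (simp add: bounded_op_add[OF bP] bounded_op_scaleR[OF bP])
      then show ?thesis
        using pos(2)[of "x + t *\<^sub>R y"]
        by (simp add: cinner_add_right cinner_scaleR_right Re_cinner_self)
    qed
    \<comment> \<open>This \<open>t\<close> would make the nonnegative expression equal to -1 if
      \<open>y\<close> were nonzero.\<close>
    from this[of "- (Re (cinner y x) + 1) / (norm y)\<^sup>2"] show ?thesis
      by (cases "y = 0") auto
  qed
  then show ?thesis
    by (simp add: y_def)
qed

lemma singular_vectors_cinner:
  assumes onb: "onb I h" and B: "bounded_op B"
    and K: "\<And>i. i \<in> I \<Longrightarrow> cadjoint B (B (h i)) = (q i)\<^sup>2 *\<^sub>R h i" and ij: "i \<in> I" "j \<in> I"
  shows "cinner (B (h i)) (B (h j)) = (if i = j then of_real ((q i)\<^sup>2) else 0)"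
  using onb_onfam[OF onb] ij
  by (auto simp: cinner_cadjoint[OF onb B] K cinner_scaleR_right onfam_def)

lemma singular_vectors_norm:
  assumes onb: "onb I h" and B: "bounded_op B"
    and K: "\<And>i. i \<in> I \<Longrightarrow> cadjoint B (B (h i)) = (q i)\<^sup>2 *\<^sub>R h i" and i: "i \<in> I" "0 \<le> q i"
  shows "norm (B (h i)) = q i"
proof -
  have "(norm (B (h i)))\<^sup>2 = (q i)\<^sup>2"
    using singular_vectors_cinner[OF onb B K i(1) i(1)] by (simp flip: Re_cinner_self)
  then show ?thesis
    using i(2) by (simp add: power2_eq_iff_nonneg)
qed

text \<open>Resolves the definite description: the operator with eigenvalues \<open>q i\<close> on
  the basis is a positive root, and any other positive root has the same eigenvalues by
  \<open>positive_op_sqrt_eigen\<close>.\<close>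

lemma abs_op_diag:
  assumes onb: "onb I h" and B: "bounded_op B"
    and K: "\<And>i. i \<in> I \<Longrightarrow> cadjoint B (B (h i)) = (q i)\<^sup>2 *\<^sub>R h i" and q: "\<And>i. i \<in> I \<Longrightarrow> 0 \<le> q i"
  shows "positive_op (abs_op B)" "\<And>i. i \<in> I \<Longrightarrow> abs_op B (h i) = q i *\<^sub>R h i"
proof -
  obtain C where C: "0 < C" "\<And>x. norm (B x) \<le> C * norm x"
    using bounded_op_bound[OF B] by blast
  have "\<bar>q i\<bar> \<le> C" if "i \<in> I" for i
    using C(2)[of "h i"] singular_vectors_norm[OF onb B K that q[OF that]] onfam_norm[OF onb_onfam[OF onb] that] q[OF that]
    by simp
  from diag_op_exists[OF onb, of q C, OF this]
  obtain P where P: "bounded_op P" "\<And>i. i \<in> I \<Longrightarrow> P (h i) = q i *\<^sub>R h i"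
    by blast
  have "abs_op B = P"
    unfolding abs_op_def
  proof (rule the_equality)
    have "P \<circ> P = cadjoint B \<circ> B"
      by (rule bounded_op_eq_onb[OF onb bounded_op_compose[OF P(1) P(1)]
            bounded_op_compose[OF bounded_op_cadjoint[OF onb B] B]])
         (simp add: P(2) bounded_op_scaleR[OF P(1)] K power2_eq_square)
    then show "positive_op P \<and> P \<circ> P = cadjoint B \<circ> B"
      using diag_positive[OF onb P q] by blast
    fix Q assume Q: "positive_op Q \<and> Q \<circ> Q = cadjoint B \<circ> B"
    show "Q = P"
    proof (rule bounded_op_eq_onb[OF onb _ P(1)])
      show "bounded_op Q"
        using Q by (simp add: positive_op_def)
      fix i assume i: "i \<in> I"
      have "Q (Q (h i)) = (q i)\<^sup>2 *\<^sub>R h i"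
        using Q K[OF i] by (metis comp_apply)
      then show "Q (h i) = P (h i)"
        using positive_op_sqrt_eigen[of Q "h i" "q i"] Q q[OF i] P(2)[OF i] by simp
    qed
  qed
  then show "positive_op (abs_op B)" "\<And>i. i \<in> I \<Longrightarrow> abs_op B (h i) = q i *\<^sub>R h i"
    using diag_positive[OF onb P q] P by auto
qed

text \<open>Distinct \<open>h i\<close> have orthogonal images of norm \<open>q i\<close>, so
  infinitely many with \<open>q i\<close> at least \<open>\<epsilon>\<close> would give images at
  mutual distance at least \<open>\<epsilon>\<close>, without a convergent subsequence.\<close>

lemma compact_op_finite_singular:
  assumes onb: "onb I h" and B: "compact_op B"
    and K: "\<And>i. i \<in> I \<Longrightarrow> cadjoint B (B (h i)) = (q i)\<^sup>2 *\<^sub>R h i" and \<epsilon>: "0 < \<epsilon>"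
  shows "finite {i \<in> I. \<epsilon> \<le> q i}"
proof (rule ccontr)
  assume "infinite {i \<in> I. \<epsilon> \<le> q i}"
  then obtain f :: "nat \<Rightarrow> _" where f: "inj f" "range f \<subseteq> {i \<in> I. \<epsilon> \<le> q i}"
    by (meson infinite_countable_subset)
  have bB: "bounded_op B"
    by (rule compact_op_bounded[OF B])
  have fI: "f n \<in> I" "\<epsilon> \<le> q (f n)" for n
    using f(2) by auto
  obtain r y where r: "strict_mono (r :: nat \<Rightarrow> nat)" "(\<lambda>n. B (h (f (r n)))) \<longlonglongrightarrow> y"
    by (rule compact_op_subseq[OF B, of "\<lambda>n. h (f n)"])
       (simp add: onfam_norm[OF onb_onfam[OF onb]] fI, blast)
  then have "Cauchy (\<lambda>n. B (h (f (r n))))"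
    by (intro LIMSEQ_imp_Cauchy)
  then obtain N where N: "\<And>m n. m \<ge> N \<Longrightarrow> n \<ge> N \<Longrightarrow> norm (B (h (f (r m))) - B (h (f (r n)))) < \<epsilon>"
    using \<epsilon> unfolding Cauchy_iff by blast
  define i j where "i = f (r N)" and "j = f (r (Suc N))"
  have ij: "i \<noteq> j" "i \<in> I" "j \<in> I" "\<epsilon> \<le> q i" "\<epsilon> \<le> q j"
    using f(1) r(1) fI by (auto simp: i_def j_def inj_eq strict_mono_eq)
  have "(norm (B (h i) - B (h j)))\<^sup>2 = (norm (B (h i)))\<^sup>2 + (norm (B (h j)))\<^sup>2"
    using singular_vectors_cinner[OF onb bB K ij(2,3)] ij(1) by (simp add: norm_diff_square)
  also have "\<dots> = (q i)\<^sup>2 + (q j)\<^sup>2"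
    using singular_vectors_norm[OF onb bB K ij(2)] singular_vectors_norm[OF onb bB K ij(3)] ij \<epsilon> by simp
  also have "\<dots> \<ge> \<epsilon>\<^sup>2"
    using ij \<epsilon> by (meson add_increasing2 power_mono less_imp_le zero_le_power2)
  finally have "\<epsilon> \<le> norm (B (h i) - B (h j))"
    by (rule power2_le_imp_le) simp
  then show False
    using N[of N "Suc N"] by (simp add: i_def j_def)
qed

section \<open>Singular values, functional calculus and traces\<close>

lemma has_sum_ennreal:
  assumes "(f has_sum S) A" "\<And>i. i \<in> A \<Longrightarrow> 0 \<le> f i"
  shows "((\<lambda>i. ennreal (f i)) has_sum ennreal S) A"
proof -
  have "((\<lambda>F. ennreal (sum f F)) \<longlongrightarrow> ennreal S) (finite_subsets_at_top A)"
    using assms(1) unfolding has_sum_def by (rule tendsto_ennrealI)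
  moreover have "\<forall>\<^sub>F F in finite_subsets_at_top A. ennreal (sum f F) = (\<Sum>i\<in>F. ennreal (f i))"
    by (rule eventually_finite_subsets_at_top_weakI) (use assms(2) in \<open>auto intro!: sum_ennreal[symmetric]\<close>)
  ultimately show ?thesis
    unfolding has_sum_def by (rule Lim_transform_eventually)
qed

lemma infsum_ennreal:
  "(f has_sum S) A \<Longrightarrow> (\<And>i. i \<in> A \<Longrightarrow> 0 \<le> f i) \<Longrightarrow> (\<Sum>\<^sub>\<infinity>i\<in>A. ennreal (f i)) = ennreal S"
  by (rule infsumI[OF has_sum_ennreal])

lemma infsum_mono_set_ennreal: "A \<subseteq> B \<Longrightarrow> infsum f A \<le> infsum (f :: 'a \<Rightarrow> ennreal) B"
  by (rule infsum_mono_neutral) (auto intro: nonneg_summable_on_complete)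

text \<open>Tonelli's theorem for arbitrary index sets: both sides are suprema of finite sums, and a
  finite subset of the \<open>Sigma\<close> set lies over finitely many first coordinates. The
  resulting interchange underlies the independence of traces from the basis.\<close>

lemma infsum_Sigma_ennreal:
  fixes f :: "'a \<times> 'b \<Rightarrow> ennreal"
  shows "(\<Sum>\<^sub>\<infinity>x\<in>A. \<Sum>\<^sub>\<infinity>y\<in>B x. f (x, y)) = infsum f (Sigma A B)"
proof -
  have fin: "(\<Sum>x\<in>X. \<Sum>\<^sub>\<infinity>y\<in>B x. f (x, y)) = infsum f (Sigma X B)" if "finite X" for X
  proof -
    have "(\<Sum>\<^sub>\<infinity>y\<in>B x. f (x, y)) = infsum f (Pair x ` B x)" for x
      by (subst infsum_reindex) (auto simp: o_def inj_on_def)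
    moreover have "(\<Sum>x\<in>X. infsum f (Pair x ` B x)) = infsum f (\<Union>x\<in>X. Pair x ` B x)"
      by (rule sum_infsum) (use that in \<open>auto intro: nonneg_summable_on_complete\<close>)
    moreover have "(\<Union>x\<in>X. Pair x ` B x) = Sigma X B"
      by auto
    ultimately show ?thesis
      by simp
  qed
  show ?thesis
  proof (rule antisym)
    show "(\<Sum>\<^sub>\<infinity>x\<in>A. \<Sum>\<^sub>\<infinity>y\<in>B x. f (x, y)) \<le> infsum f (Sigma A B)"
      unfolding nonneg_infsum_complete[of A, OF zero_le]
    proof (rule SUP_least)
      fix X assume X: "X \<in> {F. finite F \<and> F \<subseteq> A}"
      then have "(\<Sum>x\<in>X. \<Sum>\<^sub>\<infinity>y\<in>B x. f (x, y)) = infsum f (Sigma X B)"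
        using fin by blast
      also have "\<dots> \<le> infsum f (Sigma A B)"
        by (rule infsum_mono_set_ennreal) (use X in auto)
      finally show "(\<Sum>x\<in>X. \<Sum>\<^sub>\<infinity>y\<in>B x. f (x, y)) \<le> infsum f (Sigma A B)" .
    qed
    show "infsum f (Sigma A B) \<le> (\<Sum>\<^sub>\<infinity>x\<in>A. \<Sum>\<^sub>\<infinity>y\<in>B x. f (x, y))"
      unfolding nonneg_infsum_complete[of "Sigma A B", OF zero_le]
    proof (rule SUP_least)
      fix F assume F: "F \<in> {F. finite F \<and> F \<subseteq> Sigma A B}"
      have "sum f F = infsum f F"
        using F by simp
      also have "\<dots> \<le> infsum f (Sigma (fst ` F) B)"
        by (rule infsum_mono_set_ennreal) (use F in force)
      also have "\<dots> = (\<Sum>x\<in>fst ` F. \<Sum>\<^sub>\<infinity>y\<in>B x. f (x, y))"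
        using fin[of "fst ` F"] F by simp
      also have "\<dots> \<le> (\<Sum>\<^sub>\<infinity>x\<in>A. \<Sum>\<^sub>\<infinity>y\<in>B x. f (x, y))"
        using F infsum_mono_set_ennreal[of "fst ` F" A "\<lambda>x. \<Sum>\<^sub>\<infinity>y\<in>B x. f (x, y)"] by force
      finally show "sum f F \<le> (\<Sum>\<^sub>\<infinity>x\<in>A. \<Sum>\<^sub>\<infinity>y\<in>B x. f (x, y))" .
    qed
  qed
qed

lemma infsum_swap_ennreal:
  fixes f :: "'a \<Rightarrow> 'b \<Rightarrow> ennreal"
  shows "(\<Sum>\<^sub>\<infinity>x\<in>A. \<Sum>\<^sub>\<infinity>y\<in>B. f x y) = (\<Sum>\<^sub>\<infinity>y\<in>B. \<Sum>\<^sub>\<infinity>x\<in>A. f x y)"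
proof -
  have "bij_betw (\<lambda>(x, y). (y, x)) (A \<times> B) (B \<times> A)"
    by (rule bij_betwI[of _ _ _ "\<lambda>(x, y). (y, x)"]) auto
  from infsum_reindex_bij_betw[OF this, of "\<lambda>(y, x). f x y"] show ?thesis
    using infsum_Sigma_ennreal[where f="\<lambda>(x, y). f x y" and A=A and B="\<lambda>_. B"]
      infsum_Sigma_ennreal[where f="\<lambda>(y, x). f x y" and A=B and B="\<lambda>_. A"]
    by (simp add: case_prod_unfold)
qed

text \<open>Grouping the terms by their value shows that the sum depends only on the multiplicities
  of the positive values; this is how families over different index sets are compared.\<close>

lemma infsum_fibers_ennreal:
  fixes f :: "'i \<Rightarrow> real" and \<phi> :: "real \<Rightarrow> ennreal"
  assumes "\<And>i. i \<in> A \<Longrightarrow> 0 \<le> f i" "\<phi> 0 = 0" "\<And>l. 0 < l \<Longrightarrow> finite {i\<in>A. f i = l}"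
  shows "(\<Sum>\<^sub>\<infinity>i\<in>A. \<phi> (f i)) = (\<Sum>\<^sub>\<infinity>l\<in>{0<..}. of_nat (card {i\<in>A. f i = l}) * \<phi> l)"
proof -
  have "(\<Sum>\<^sub>\<infinity>i\<in>A. \<phi> (f i)) = (\<Sum>\<^sub>\<infinity>i\<in>{i\<in>A. 0 < f i}. \<phi> (f i))"
    by (rule infsum_cong_neutral) (use assms(1,2) in \<open>force simp: order.order_iff_strict\<close>)+
  also have "\<dots> = (\<Sum>\<^sub>\<infinity>p\<in>Sigma {0<..} (\<lambda>l. {i\<in>A. f i = l}). \<phi> (fst p))"
    by (rule infsum_reindex_bij_witness[of _ snd "\<lambda>i. (f i, i)"]) auto
  also have "\<dots> = (\<Sum>\<^sub>\<infinity>l\<in>{0<..}. \<Sum>\<^sub>\<infinity>i\<in>{i\<in>A. f i = l}. \<phi> l)"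
    using infsum_Sigma_ennreal[where f="\<lambda>p. \<phi> (fst p)" and A="{0<..}" and B="\<lambda>l. {i\<in>A. f i = l}"] by simp
  also have "\<dots> = (\<Sum>\<^sub>\<infinity>l\<in>{0<..}. of_nat (card {i\<in>A. f i = l}) * \<phi> l)"
    by (rule infsum_cong) (use assms(3) in auto)
  finally show ?thesis .
qed

text \<open>The condition in \<open>singular_values\<close>, with the dimension of an eigenspace
  replaced by the number of basis indices. Zero is exempt from counting, so finite families are
  padded by zeros and infinitely many zeros of \<open>q\<close> are ignored.\<close>

definition rearrangement :: "'i set \<Rightarrow> ('i \<Rightarrow> real) \<Rightarrow> (nat \<Rightarrow> real) \<Rightarrow> bool" where
  "rearrangement I q s \<longleftrightarrow> decseq s \<and> (\<forall>n. 0 \<le> s n) \<and>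
     (\<forall>l>0. finite {n. s n = l} \<and> card {n. s n = l} = card {i\<in>I. q i = l})"

context
  fixes I :: "'i set" and q :: "'i \<Rightarrow> real"
  assumes q_nonneg: "\<And>i. i \<in> I \<Longrightarrow> 0 \<le> q i"
    and q_finite: "\<And>l. 0 < l \<Longrightarrow> finite {i\<in>I. l \<le> q i}"
begin

text \<open>By monotonicity \<open>{n. l \<le> s n}\<close> is an initial segment, and its size is
  the sum of the multiplicities over the finitely many values of \<open>q\<close> that are at least
  \<open>l\<close>. Thus the counting function of \<open>q\<close> determines
  \<open>s\<close>.\<close>

lemma rearrangement_le_iff:
  assumes s: "rearrangement I q (s :: nat \<Rightarrow> real)" and l: "0 < l"
  shows "l \<le> s n \<longleftrightarrow> n < card {i\<in>I. l \<le> q i}"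
proof -
  have dec: "decseq s" and fib: "\<And>l. 0 < l \<Longrightarrow> finite {n. s n = l}"
    "\<And>l. 0 < l \<Longrightarrow> card {n. s n = l} = card {i\<in>I. q i = l}"
    using s by (auto simp: rearrangement_def)
  let ?V = "q ` {i\<in>I. l \<le> q i}"
  have fV: "finite ?V"
    using q_finite[OF l] by simp
  have "\<exists>i\<in>I. q i = s n" if "l \<le> s n" for n
  proof -
    have "0 < s n" using l that by simp
    have "card {k. s k = s n} \<noteq> 0"
      using fib(1)[OF \<open>0 < s n\<close>] by auto
    then have "{i\<in>I. q i = s n} \<noteq> {}"
      unfolding fib(2)[OF \<open>0 < s n\<close>] by (metis card.empty)
    then show ?thesis by blast
  qed
  then have eq: "{n. l \<le> s n} = (\<Union>v\<in>?V. {n. s n = v})"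
    by force
  have V0: "0 < v" if "v \<in> ?V" for v
    using that l by auto
  have fin: "finite {n. l \<le> s n}"
    unfolding eq using fV V0 fib(1) by blast
  have "card {n. l \<le> s n} = (\<Sum>v\<in>?V. card {n. s n = v})"
    unfolding eq by (rule card_UN_disjoint) (use fV V0 fib(1) in auto)
  also have "\<dots> = (\<Sum>v\<in>?V. card {i\<in>I. q i = v})"
    by (intro sum.cong refl fib(2) V0)
  also have "\<dots> = card (\<Union>v\<in>?V. {i\<in>I. q i = v})"
  proof (rule card_UN_disjoint[symmetric])
    show "\<forall>v\<in>?V. finite {i\<in>I. q i = v}"
    proof
      fix v assume "v \<in> ?V"
      show "finite {i\<in>I. q i = v}"
        by (rule finite_subset[OF _ q_finite[OF V0[OF \<open>v \<in> ?V\<close>]]]) auto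
    qed
  qed (use fV in auto)
  also have "(\<Union>v\<in>?V. {i\<in>I. q i = v}) = {i\<in>I. l \<le> q i}"
    by auto
  finally have card: "card {n. l \<le> s n} = card {i\<in>I. l \<le> q i}" .
  have down: "m \<in> {n. l \<le> s n}" if "k \<in> {n. l \<le> s n}" "m \<le> k" for m k
    using that(1) decseqD[OF dec that(2)] by simp
  obtain K where "{n. l \<le> s n} = {..<K}"
  proof (cases "{n. l \<le> s n} = {}")
    case False
    define m where "m = Max {n. l \<le> s n}"
    have "n \<in> {n. l \<le> s n} \<longleftrightarrow> n \<in> {..<Suc m}" for n
      using Max_ge[OF fin, of n] down[of m n] Max_in[OF fin False]
      by (metis m_def lessThan_iff less_Suc_eq_le)
    then show ?thesis
      using that[of "Suc m"] by blast
  qed (use that[of 0] in simp)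
  then show ?thesis
    using card by (metis card_lessThan lessThan_iff mem_Collect_eq)
qed

lemma rearrangement_unique:
  assumes "rearrangement I q s" "rearrangement I q t"
  shows "s = t"
proof
  fix n
  have "l \<le> s n \<longleftrightarrow> l \<le> t n" if "0 < l" for l
    using rearrangement_le_iff[OF assms(1) that] rearrangement_le_iff[OF assms(2) that] by simp
  moreover have "0 \<le> s n" "0 \<le> t n"
    using assms by (auto simp: rearrangement_def)
  ultimately show "s n = t n"
    by (metis order_antisym order_le_less order_refl)
qed

lemma rearrangement_exists: "\<exists>s. rearrangement I q s"
proof -
  define M where "M l = card {i\<in>I. l \<le> q i}" for l
  \<comment> \<open>\<open>s n\<close> is the generalised inverse of the decreasing counting
    function \<open>M\<close>. The inserted 0 keeps the supremum meaningful and supplies the padding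
    once \<open>n\<close> exceeds all counts.\<close>
  define S where "S n = insert 0 {l. 0 < l \<and> n < M l}" for n
  define s where "s n = Sup (S n)" for n
  have M_mono: "M b \<le> M a" if "0 < a" "a \<le> b" for a b
    unfolding M_def by (rule card_mono[OF q_finite[OF that(1)]]) (use that in auto)
  have bdd: "bdd_above (S n)" for n
  proof -
    let ?X = "insert 1 (q ` {i\<in>I. 1 \<le> q i})"
    have fX: "finite ?X"
      using q_finite[of 1] by simp
    have "l \<le> Max ?X" if "l \<in> S n" for l
    proof (cases "l \<le> 1")
      case True
      then show ?thesis using Max_ge[OF fX, of 1] by simp
    next
      case False
      then have "M l \<noteq> 0"
        using that by (auto simp: S_def)
      then have "{i\<in>I. l \<le> q i} \<noteq> {}"
        unfolding M_def by (metis card.empty)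
      then obtain i where "i \<in> I" "l \<le> q i"
        by blast
      then show ?thesis using False Max_ge[OF fX, of "q i"] by auto
    qed
    then show ?thesis by (rule bdd_aboveI)
  qed
  have ne: "S n \<noteq> {}" for n
    by (simp add: S_def)
  have s0: "0 \<le> s n" for n
    unfolding s_def by (rule cSup_upper[OF _ bdd]) (simp add: S_def)
  have le_iff: "l \<le> s n \<longleftrightarrow> n < M l" if l: "0 < l" for l n
  proof
    assume "n < M l"
    then show "l \<le> s n"
      unfolding s_def by (intro cSup_upper[OF _ bdd]) (simp add: S_def l)
  next
    assume ls: "l \<le> s n"
    \<comment> \<open>Only finitely many values of \<open>q\<close> lie in \<open>[l/2, l)\<close>.
      A level \<open>m\<close> strictly between the largest of them and \<open>l\<close> has the
      same count as \<open>l\<close>, so \<open>M\<close> is left-continuous at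
      \<open>l\<close>.\<close>
    let ?X = "insert (l/2) (q ` {i\<in>I. l/2 \<le> q i \<and> q i < l})"
    have fX: "finite ?X"
      using q_finite[of "l/2"] l by (auto intro: finite_subset[rotated])
    define m where "m = (Max ?X + l) / 2"
    have "Max ?X < l"
      using fX l by (subst Max_less_iff) auto
    then have m: "m < l" "Max ?X < m"
      by (auto simp: m_def)
    have "l / 2 < m"
      using Max_ge[OF fX, of "l/2"] m by simp
    then have "0 < m"
      using l by simp
    have "q i < m" if "i \<in> I" "q i < l" for i
    proof (cases "l/2 \<le> q i")
      case True
      then show ?thesis using that Max_ge[OF fX, of "q i"] m by auto
    qed (use \<open>l / 2 < m\<close> in simp)
    then have "{i\<in>I. m \<le> q i} = {i\<in>I. l \<le> q i}"
      using m by (auto simp: not_less[symmetric])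
    then have "M m = M l"
      by (simp add: M_def)
    have "m < Sup (S n)"
      using ls m by (simp add: s_def)
    then obtain l' where "l' \<in> S n" "m < l'"
      using less_cSup_iff[OF ne bdd] by blast
    then have "n < M l'"
      using \<open>0 < m\<close> by (auto simp: S_def)
    also have "M l' \<le> M m"
      using M_mono \<open>0 < m\<close> \<open>m < l'\<close> by simp
    finally show "n < M l"
      by (simp add: \<open>M m = M l\<close>)
  qed
  have "rearrangement I q s"
    unfolding rearrangement_def
  proof (intro conjI allI impI s0)
    show "decseq s"
    proof (rule antimonoI)
      fix n m :: nat assume "n \<le> m"
      show "s m \<le> s n"
      proof (cases "s m = 0")
        case False
        then have "0 < s m"
          using s0[of m] by simp
        then show ?thesis
          using le_iff[of "s m" m] le_iff[of "s m" n] \<open>n \<le> m\<close> by simp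
      qed (simp add: s0)
    qed
    fix l :: real assume l: "0 < l"
    \<comment> \<open>\<open>N\<close> counts strictly above \<open>l\<close>; the value
      \<open>l\<close> is then taken exactly at the indices from \<open>N\<close> to
      \<open>M l - 1\<close>.\<close>
    define N where "N = card {i\<in>I. l < q i}"
    have lt_iff: "l < s n \<longleftrightarrow> n < N" for n
    proof
      assume "l < s n"
      then have "n < M (s n)"
        using le_iff[of "s n" n] l by simp
      also have "M (s n) \<le> N"
        unfolding M_def N_def
        by (rule card_mono[OF finite_subset[OF _ q_finite[OF l]]]) (use \<open>l < s n\<close> in auto)
      finally show "n < N" .
    next
      assume n: "n < N"
      let ?X = "q ` {i\<in>I. l < q i}"
      have fX: "finite ?X"
        by (intro finite_imageI finite_subset[OF _ q_finite[OF l]]) auto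
      have "{i\<in>I. l < q i} \<noteq> {}"
        using n unfolding N_def by (metis card.empty not_less_zero)
      then have "?X \<noteq> {}"
        by blast
      then have "Min ?X \<in> ?X"
        using fX by (intro Min_in)
      then have lm: "l < Min ?X"
        by auto
      have "N \<le> M (Min ?X)"
        unfolding N_def M_def
        by (rule card_mono[OF q_finite]) (use lm l fX in auto)
      then have "Min ?X \<le> s n"
        using le_iff[of "Min ?X" n] lm l n by simp
      then show "l < s n"
        using lm by simp
    qed
    have eq: "{n. s n = l} = {..<M l} - {..<N}"
    proof (intro set_eqI)
      fix n
      have "s n = l \<longleftrightarrow> l \<le> s n \<and> \<not> l < s n"
        by linarith
      then show "n \<in> {n. s n = l} \<longleftrightarrow> n \<in> {..<M l} - {..<N}"
        by (auto simp: le_iff[OF l] lt_iff)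
    qed
    have "N \<le> M l"
      unfolding N_def M_def by (rule card_mono[OF q_finite[OF l]]) auto
    have "{i\<in>I. q i = l} = {i\<in>I. l \<le> q i} - {i\<in>I. l < q i}"
      by auto
    moreover have "card ({i\<in>I. l \<le> q i} - {i\<in>I. l < q i}) = M l - N"
      unfolding M_def N_def
    proof (rule card_Diff_subset)
      show "finite {i\<in>I. l < q i}"
        by (rule finite_subset[OF _ q_finite[OF l]]) auto
    qed auto
    ultimately have "card {i\<in>I. q i = l} = M l - N"
      by simp
    then show "finite {n. s n = l}" "card {n. s n = l} = card {i\<in>I. q i = l}"
      using \<open>N \<le> M l\<close> by (auto simp: eq card_Diff_subset)
  qed
  then show ?thesis
    by blast
qed

text \<open>\<open>\<phi> 0 = 0\<close> is essential: the numbers of zeros in \<open>s\<close> and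
  in \<open>q\<close> may differ.\<close>

lemma rearrangement_infsum:
  fixes \<phi> :: "real \<Rightarrow> ennreal"
  assumes "rearrangement I q s" "\<phi> 0 = 0"
  shows "(\<Sum>\<^sub>\<infinity>n. \<phi> (s n)) = (\<Sum>\<^sub>\<infinity>i\<in>I. \<phi> (q i))"
proof -
  have fin: "finite {i\<in>I. q i = l}" if "0 < l" for l
    using q_finite[OF that] by (rule finite_subset[rotated]) auto
  have "(\<Sum>\<^sub>\<infinity>n. \<phi> (s n)) = (\<Sum>\<^sub>\<infinity>l\<in>{0<..}. of_nat (card {n\<in>UNIV. s n = l}) * \<phi> l)"
    by (rule infsum_fibers_ennreal) (use assms in \<open>auto simp: rearrangement_def\<close>)
  also have "\<dots> = (\<Sum>\<^sub>\<infinity>l\<in>{0<..}. of_nat (card {i\<in>I. q i = l}) * \<phi> l)"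
    by (rule infsum_cong) (use assms in \<open>auto simp: rearrangement_def\<close>)
  also have "\<dots> = (\<Sum>\<^sub>\<infinity>i\<in>I. \<phi> (q i))"
    by (rule infsum_fibers_ennreal[symmetric]) (use assms q_nonneg fin in auto)
  finally show ?thesis .
qed

end

section \<open>Eigenspaces and singular values read off from a basis of eigenvectors\<close>

lemma onfam_independent:
  assumes "onfam J h" "finite J"
  shows "cvec.independent (h ` J)"
proof -
  have "u v = 0" if s: "(\<Sum>v\<in>h ` J. u v *\<^sub>C v) = 0" and "v \<in> h ` J" for u v
  proof -
    obtain j where j: "j \<in> J" "v = h j"
      using \<open>v \<in> h ` J\<close> by blast
    have "(\<Sum>i\<in>J. u (h i) *\<^sub>C h i) = 0"
      using s by (simp add: sum.reindex[OF onfam_inj[OF assms(1)]])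
    then have "((\<lambda>i. u (h i) *\<^sub>C h i) has_sum 0) J"
      using assms(2) by (intro has_sum_finiteI) auto
    from onfam_series_coeff[OF assms(1) this j(1)] show ?thesis
      by (simp add: j)
  qed
  then show ?thesis
    using assms(2) by (subst cvec.dependent_finite) auto
qed

lemma eigenspace_diag:
  assumes "onb I h" "bounded_op P" "\<And>i. i \<in> I \<Longrightarrow> P (h i) = q i *\<^sub>R h i"
  shows "eigenspace (op_graph P) l = {x. \<forall>i\<in>I. q i \<noteq> l \<longrightarrow> cinner x (h i) = 0}"
proof -
  have "P x = l *\<^sub>R x \<longleftrightarrow> (\<forall>i\<in>I. cinner (P x) (h i) = cinner (l *\<^sub>R x) (h i))" for x
    using onb_extI[OF assms(1)] by metis
  then have "l *\<^sub>R x = P x \<longleftrightarrow> (\<forall>i\<in>I. q i \<noteq> l \<longrightarrow> cinner x (h i) = 0)" for x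
    unfolding eq_commute[of _ "P x"]
    by (auto simp: diag_coeff[OF assms] cinner_scaleR_left)
  then show ?thesis
    by (auto simp: eigenspace_def op_graph_def)
qed

text \<open>An unbounded operator cannot be applied to an infinite series termwise, so membership in
  the domain comes from selfadjointness: if the coefficients of \<open>x\<close> vanish off the
  value \<open>l\<close>, Parseval's identity puts \<open>(x, l *\<^sub>R x)\<close> into the
  adjoint graph, which is \<open>S\<close>.\<close>

lemma eigenspace_selfadjoint:
  assumes onb: "onb I h" and S: "selfadjoint S" and eig: "\<And>i. i \<in> I \<Longrightarrow> (h i, q i *\<^sub>R h i) \<in> S"
  shows "eigenspace S l = {x. \<forall>i\<in>I. q i \<noteq> l \<longrightarrow> cinner x (h i) = 0}"
proof (intro set_eqI iffI)
  have adj: "adjoint_graph S = S"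
    using S by (simp add: selfadjoint_def)
  have sym: "cinner u (h i) = of_real (q i) * cinner z (h i)" if "(z, u) \<in> S" "i \<in> I" for z u i
  proof -
    have "(h i, q i *\<^sub>R h i) \<in> adjoint_graph S"
      using eig that adj by simp
    then show ?thesis
      using that by (auto simp: adjoint_graph_def cinner_scaleR_right)
  qed
  fix x
  show "x \<in> {x. \<forall>i\<in>I. q i \<noteq> l \<longrightarrow> cinner x (h i) = 0}" if "x \<in> eigenspace S l"
    using that sym[of x "l *\<^sub>R x"] by (auto simp: eigenspace_def cinner_scaleR_left)
  assume x: "x \<in> {x. \<forall>i\<in>I. q i \<noteq> l \<longrightarrow> cinner x (h i) = 0}"
  have "cinner u x = cinner z (l *\<^sub>R x)" if zu: "(z, u) \<in> S" for z u
  proof -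
    have "cinner u (h i) * cinner (h i) x = of_real l * (cinner z (h i) * cinner (h i) x)" if i: "i \<in> I" for i
      using sym[OF zu i] x i cinner_commute[of "h i" x] by (cases "q i = l") auto
    then have "((\<lambda>i. of_real l * (cinner z (h i) * cinner (h i) x)) has_sum cinner u x) I"
      using onb_parseval_cinner[OF onb, of u x] by (metis (no_types, lifting) has_sum_cong)
    moreover have "((\<lambda>i. of_real l * (cinner z (h i) * cinner (h i) x)) has_sum of_real l * cinner z x) I"
      by (intro has_sum_cmult_right onb_parseval_cinner[OF onb])
    ultimately have "cinner u x = of_real l * cinner z x"
      by (rule has_sum_unique)
    then show ?thesis
      by (simp add: cinner_scaleR_right)
  qed
  then have "(x, l *\<^sub>R x) \<in> adjoint_graph S"
    by (auto simp: adjoint_graph_def)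
  then show "x \<in> eigenspace S l"
    using adj by (simp add: eigenspace_def)
qed

lemma dim_eigenspace:
  assumes onb: "onb I h" and E: "V = {x. \<forall>i\<in>I. q i \<noteq> l \<longrightarrow> cinner x (h i) = 0}"
    and fin: "finite {i\<in>I. q i = l}"
  shows "cvec.dim V = card {i\<in>I. q i = l}"
proof -
  let ?J = "{i\<in>I. q i = l}"
  have on: "onfam I h" "onfam ?J h"
    using onb_onfam[OF onb] onfam_subset[of I h ?J] by auto
  have "V = cvec.span (h ` ?J)"
  proof (intro set_eqI iffI)
    fix x assume "x \<in> V"
    then have x: "\<And>i. i \<in> I \<Longrightarrow> q i \<noteq> l \<Longrightarrow> cinner x (h i) = 0"
      by (auto simp: E)
    have "((\<lambda>i. cinner x (h i) *\<^sub>C h i) has_sum (\<Sum>i\<in>?J. cinner x (h i) *\<^sub>C h i)) I"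
      by (rule has_sum_finite_neutralI[OF fin]) (use x in auto)
    then have "x = (\<Sum>i\<in>?J. cinner x (h i) *\<^sub>C h i)"
      using has_sum_unique[OF onb_expansion[OF onb, of x]] by blast
    also have "\<dots> \<in> cvec.span (h ` ?J)"
      by (blast intro: cvec.span_sum cvec.span_scale cvec.span_base)
    finally show "x \<in> cvec.span (h ` ?J)" .
  next
    fix x assume "x \<in> cvec.span (h ` ?J)"
    moreover have "h ` ?J \<subseteq> V"
      using on(1) by (auto simp: E onfam_def)
    moreover have "cvec.subspace V"
      by (auto simp: cvec.subspace_def E cinner_add_left cinner_scaleC_left)
    ultimately show "x \<in> V"
      using cvec.span_minimal by blast
  qed
  then have "cvec.dim V = card (h ` ?J)"
    using cvec.dim_span_eq_card_independent[OF onfam_independent[OF on(2) fin]] by simp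
  also have "\<dots> = card ?J"
    by (rule card_image[OF onfam_inj[OF on(2)]])
  finally show ?thesis .
qed

lemma singular_values_rearrangement:
  fixes h :: "'i \<Rightarrow> 'h::chilbert_space" and B :: "'h \<Rightarrow> 'h"
  assumes onb: "onb I h" and B: "compact_op B"
    and K: "\<And>i. i \<in> I \<Longrightarrow> cadjoint B (B (h i)) = (q i)\<^sup>2 *\<^sub>R h i" and q: "\<And>i. i \<in> I \<Longrightarrow> 0 \<le> q i"
  shows "rearrangement I q (singular_values B)"
proof -
  have bB: "bounded_op B"
    by (rule compact_op_bounded[OF B])
  have fin: "\<And>l. 0 < l \<Longrightarrow> finite {i\<in>I. l \<le> q i}"
    by (rule compact_op_finite_singular[OF onb B K])
  have fin': "finite {i\<in>I. q i = l}" if "0 < l" for l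
    using fin[OF that] by (rule finite_subset[rotated]) auto
  note ab = abs_op_diag[OF onb bB K q]
  have "cvec.dim (eigenspace (op_graph (abs_op B)) l) = card {i\<in>I. q i = l}" if "0 < l" for l
    by (rule dim_eigenspace[OF onb eigenspace_diag[OF onb _ ab(2)] fin'[OF that]])
       (use ab(1) in \<open>simp add: positive_op_def\<close>)
  then have "(decseq s \<and> (\<forall>n. 0 \<le> s n) \<and> (\<forall>l>0. finite {n. s n = l} \<and>
      card {n. s n = l} = cvec.dim (eigenspace (op_graph (abs_op B)) l))) = rearrangement I q s" for s
    unfolding rearrangement_def by auto
  then have eq: "singular_values B = (THE s. rearrangement I q s)"
    by (simp add: singular_values_def)
  obtain s where s: "rearrangement I q s"
    using rearrangement_exists[OF q fin] by blast
  show ?thesis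
    unfolding eq by (rule theI[where P="rearrangement I q", OF s]) (rule rearrangement_unique[OF q fin _ s])
qed

lemma singular_values_props:
  fixes h :: "'i \<Rightarrow> 'h::chilbert_space" and B :: "'h \<Rightarrow> 'h"
  assumes onb: "onb I h" and B: "compact_op B"
    and K: "\<And>i. i \<in> I \<Longrightarrow> cadjoint B (B (h i)) = (q i)\<^sup>2 *\<^sub>R h i" and q: "\<And>i. i \<in> I \<Longrightarrow> 0 \<le> q i"
  shows "decseq (singular_values B)" "\<And>n. 0 \<le> singular_values B n"
    "\<And>\<phi>. \<phi> 0 = (0::ennreal) \<Longrightarrow> (\<Sum>\<^sub>\<infinity>n. \<phi> (singular_values B n)) = (\<Sum>\<^sub>\<infinity>i\<in>I. \<phi> (q i))"
proof -
  have fin: "\<And>l. 0 < l \<Longrightarrow> finite {i\<in>I. l \<le> q i}"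
    by (rule compact_op_finite_singular[OF onb B K])
  note r = singular_values_rearrangement[OF assms]
  show "decseq (singular_values B)" "\<And>n. 0 \<le> singular_values B n"
    using r by (simp_all add: rearrangement_def)
  show "\<And>\<phi>. \<phi> 0 = (0::ennreal) \<Longrightarrow> (\<Sum>\<^sub>\<infinity>n. \<phi> (singular_values B n)) = (\<Sum>\<^sub>\<infinity>i\<in>I. \<phi> (q i))"
    by (rule rearrangement_infsum[OF q fin r])
qed

section \<open>Spectral projections, functional calculus and trace\<close>

lemma onb_coeffs_exist:
  assumes onb: "onb I h" and le: "\<And>i. i \<in> I \<Longrightarrow> cmod (c i) \<le> cmod (cinner x (h i))"
  shows "\<exists>y. \<forall>i\<in>I. cinner y (h i) = c i"
proof -
  have on: "onfam I h"
    by (rule onb_onfam[OF onb])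
  have "(\<lambda>i. (cmod (c i))\<^sup>2) summable_on I"
    by (rule summable_on_comparison_test[OF bessel_summable[OF on, of x]])
       (simp_all add: le power_mono)
  from onfam_series_summable[OF on this] obtain y where "((\<lambda>i. c i *\<^sub>C h i) has_sum y) I"
    unfolding summable_on_def by blast
  then show ?thesis
    using onfam_series_coeff[OF on] by blast
qed

lemma orth_proj_coeff:
  fixes x :: "'h::chilbert_space"
  assumes onb: "onb I h" and V: "V = {x. \<forall>i\<in>I. i \<notin> J \<longrightarrow> cinner x (h i) = 0}" and i: "i \<in> I"
  shows "cinner (orth_proj V x) (h i) = (if i \<in> J then cinner x (h i) else 0)"
proof -
  obtain y where y: "\<And>i. i \<in> I \<Longrightarrow> cinner y (h i) = (if i \<in> J then cinner x (h i) else 0)"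
    using onb_coeffs_exist[OF onb, of "\<lambda>i. if i \<in> J then cinner x (h i) else 0" x] by fastforce
  have "orth_proj V x = y"
    unfolding orth_proj_def
  proof (rule the_equality)
    have "cinner (x - y) v = 0" if "v \<in> V" for v
    proof -
      have "cinner (x - y) (h i) * cinner (h i) v = 0" if "i \<in> I" for i
        using y[OF that] \<open>v \<in> V\<close> that cinner_commute[of "h i" v] by (auto simp: V cinner_diff_left)
      then have "((\<lambda>i. 0) has_sum cinner (x - y) v) I"
        using onb_parseval_cinner[OF onb, of "x - y" v] by (metis (no_types, lifting) has_sum_cong)
      then show ?thesis
        by (rule has_sum_unique) simp
    qed
    then show *: "y \<in> V \<and> (\<forall>v\<in>V. cinner (x - y) v = 0)"
      using y by (simp add: V)
    fix z assume z: "z \<in> V \<and> (\<forall>v\<in>V. cinner (x - z) v = 0)"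
    have zy: "z - y \<in> V"
      using z * by (auto simp: V cinner_diff_left)
    have "cinner (z - y) (z - y) = cinner (x - y) (z - y) - cinner (x - z) (z - y)"
      by (simp add: cinner_diff_left)
    also have "\<dots> = 0"
      using z * zy by simp
    finally show "z = y"
      by (simp add: cinner_self)
  qed
  then show ?thesis
    using y[OF i] by simp
qed

text \<open>The spectral projections \<open>p l\<close> of \<open>x\<close> are mutually orthogonal
  with squared norms summing to at most \<open>(norm x)\<^sup>2\<close>; with \<open>\<phi>\<close>
  bounded on the values \<open>q i\<close>, the sum over all real \<open>l\<close> converges.
  Pairing with \<open>h i\<close> leaves only the term at \<open>l = q i\<close>.\<close>

lemma fun_calc_coeff:
  fixes h :: "'i \<Rightarrow> 'h::chilbert_space"
  assumes onb: "onb I h" and E: "\<And>l. eigenspace S l = {x. \<forall>i\<in>I. q i \<noteq> l \<longrightarrow> cinner x (h i) = 0}"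
    and C: "\<And>i. i \<in> I \<Longrightarrow> \<bar>\<phi> (q i)\<bar> \<le> C" and i: "i \<in> I"
  shows "cinner (fun_calc S \<phi> x) (h i) = of_real (\<phi> (q i)) * cinner x (h i)"
proof -
  define p where "p l = orth_proj (eigenspace S l) x" for l
  have p: "cinner (p l) (h i) = (if q i = l then cinner x (h i) else 0)" if "i \<in> I" for i l
    unfolding p_def using orth_proj_coeff[OF onb _ that, of "eigenspace S l" "{i. q i = l}" x] E by simp
  have orth: "cinner (p l) (p k) = 0" if "l \<noteq> k" for l k
  proof -
    have "cinner (p l) (h i) * cinner (h i) (p k) = 0" if "i \<in> I" for i
      using p[OF that] cinner_commute[of "h i" "p k"] \<open>l \<noteq> k\<close> by auto
    then have "((\<lambda>i. 0) has_sum cinner (p l) (p k)) I"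
      using onb_parseval_cinner[OF onb, of "p l" "p k"] by (metis (no_types, lifting) has_sum_cong)
    then show ?thesis
      by (rule has_sum_unique) simp
  qed
  have p_sum: "(\<lambda>l. (norm (p l))\<^sup>2) summable_on UNIV"
  proof (rule nonneg_bdd_above_summable_on)
    have "(\<Sum>l\<in>F. (norm (p l))\<^sup>2) \<le> (norm x)\<^sup>2" if "finite F" for F
    proof -
      have "(\<Sum>l\<in>F. (norm (p l))\<^sup>2) = (norm (\<Sum>l\<in>F. p l))\<^sup>2"
        by (rule orthogonal_sum_norm[symmetric]) (use that orth in auto)
      also have "\<dots> \<le> (norm x)\<^sup>2"
      proof (rule has_sum_mono[OF onb_parseval[OF onb] onb_parseval[OF onb]])
        fix i assume "i \<in> I"
        then show "(cmod (cinner (\<Sum>l\<in>F. p l) (h i)))\<^sup>2 \<le> (cmod (cinner x (h i)))\<^sup>2"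
          using that by (simp add: cinner_sum_left p sum.delta)
      qed
      finally show ?thesis .
    qed
    then show "bdd_above (sum (\<lambda>l. (norm (p l))\<^sup>2) ` {F. F \<subseteq> UNIV \<and> finite F})"
      by (auto intro!: bdd_aboveI)
  qed simp
  have "(\<lambda>l. \<phi> l *\<^sub>R p l) summable_on UNIV"
  proof (rule orthogonal_summable)
    have "(norm (\<phi> l *\<^sub>R p l))\<^sup>2 \<le> C\<^sup>2 * (norm (p l))\<^sup>2" for l
    proof (cases "\<exists>i\<in>I. q i = l")
      case True
      then have "\<bar>\<phi> l\<bar> \<le> C"
        using C by auto
      then have "\<bar>\<phi> l\<bar>\<^sup>2 \<le> C\<^sup>2"
        by (intro power_mono) auto
      then show ?thesis
        by (simp add: power_mult_distrib mult_right_mono)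
    next
      \<comment> \<open>A real number that is no \<open>q i\<close> has zero projection, so an
        arbitrarily large \<open>\<phi> l\<close> does no harm there.\<close>
      case False
      then have "p l = 0"
        using p by (intro onb_eq_zero[OF onb]) auto
      then show ?thesis by simp
    qed
    then show "(\<lambda>l. (norm (\<phi> l *\<^sub>R p l))\<^sup>2) summable_on UNIV"
      by (intro summable_on_comparison_test[OF summable_on_cmult_right[OF p_sum, of "C\<^sup>2"]]) auto
  qed (simp add: cinner_scaleR_left cinner_scaleR_right orth)
  then have "((\<lambda>l. \<phi> l *\<^sub>R p l) has_sum fun_calc S \<phi> x) UNIV"
    unfolding fun_calc_def p_def by (rule has_sum_infsum)
  from has_sum_cinner_left[OF this, of "h i"]
  have "((\<lambda>l. cinner (\<phi> l *\<^sub>R p l) (h i)) has_sum cinner (fun_calc S \<phi> x) (h i)) UNIV" .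
  moreover have "((\<lambda>l. cinner (\<phi> l *\<^sub>R p l) (h i)) has_sum cinner (\<phi> (q i) *\<^sub>R p (q i)) (h i)) UNIV"
    by (rule has_sum_single) (auto simp: cinner_scaleR_left p[OF i])
  ultimately show ?thesis
    using has_sum_unique by (fastforce simp: cinner_scaleR_left p[OF i])
qed

lemma onb_set:
  assumes "onb I h"
  shows "onb (h ` I) (\<lambda>x. x)"
  using assms onfam_inj[OF onb_onfam[OF assms]] by (auto simp: onb_def inj_on_eq_iff)

lemma diag_form_has_sum:
  fixes h :: "'i \<Rightarrow> 'h::chilbert_space"
  assumes onb: "onb I h" and P: "\<And>i. i \<in> I \<Longrightarrow> cinner y (h i) = of_real (p i) * cinner x (h i)"
  shows "((\<lambda>i. p i * (cmod (cinner x (h i)))\<^sup>2) has_sum Re (cinner y x)) I"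
proof -
  have "cinner y (h i) * cinner (h i) x = of_real (p i * (cmod (cinner x (h i)))\<^sup>2)" if "i \<in> I" for i
    using cinner_commute[of "h i" x] P[OF that] by (simp add: complex_norm_square mult.assoc del: of_real_power)
  then have "((\<lambda>i. of_real (p i * (cmod (cinner x (h i)))\<^sup>2)) has_sum cinner y x) I"
    using onb_parseval_cinner[OF onb, of y x] by (simp cong: has_sum_cong)
  from has_sum_Re[OF this] show ?thesis
    by simp
qed

lemma onb_sum_cmod_cinner:
  fixes h :: "'i \<Rightarrow> 'h::chilbert_space"
  assumes onb: "onb I h" and "0 \<le> c" and "norm x = 1"
  shows "(\<Sum>\<^sub>\<infinity>i\<in>I. ennreal (c * (cmod (cinner (h i) x))\<^sup>2)) = ennreal c"
proof -
  have "((\<lambda>i. c * (cmod (cinner x (h i)))\<^sup>2) has_sum c * (norm x)\<^sup>2) I"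
    by (intro has_sum_cmult_right onb_parseval[OF onb])
  moreover have "cmod (cinner x (h i)) = cmod (cinner (h i) x)" for i
    by (metis cinner_commute complex_mod_cnj)
  ultimately have "((\<lambda>i. c * (cmod (cinner (h i) x))\<^sup>2) has_sum c) I"
    using assms(3) by simp
  then show ?thesis
    by (rule infsum_ennreal) (simp add: assms(2))
qed

text \<open>\<open>SOME\<close> picks an unknown basis. Parseval's identity in \<open>h\<close>, an
  interchange of sums, and Parseval's identity in that basis remove it.\<close>

lemma trace_pos_diag:
  fixes h :: "'i \<Rightarrow> 'h::chilbert_space"
  assumes onb: "onb I h" and P: "\<And>i x. i \<in> I \<Longrightarrow> cinner (P x) (h i) = of_real (p i) * cinner x (h i)"
    and p: "\<And>i. i \<in> I \<Longrightarrow> 0 \<le> p i"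
  shows "trace_pos P = (\<Sum>\<^sub>\<infinity>i\<in>I. ennreal (p i))"
proof -
  define X where "X = (SOME X::'h set. onb X (\<lambda>b. b))"
  have X: "onb X (\<lambda>b. b)"
    unfolding X_def by (rule someI[of "\<lambda>X. onb X (\<lambda>b. b)"]) (rule onb_set[OF onb])
  have "ennreal (Re (cinner (P b) b)) = (\<Sum>\<^sub>\<infinity>i\<in>I. ennreal (p i * (cmod (cinner b (h i)))\<^sup>2))" for b
    by (rule infsum_ennreal[OF diag_form_has_sum[OF onb P], symmetric]) (simp_all add: p)
  then have "trace_pos P = (\<Sum>\<^sub>\<infinity>b\<in>X. \<Sum>\<^sub>\<infinity>i\<in>I. ennreal (p i * (cmod (cinner b (h i)))\<^sup>2))"
    unfolding trace_pos_def X_def by simp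
  also have "\<dots> = (\<Sum>\<^sub>\<infinity>i\<in>I. \<Sum>\<^sub>\<infinity>b\<in>X. ennreal (p i * (cmod (cinner b (h i)))\<^sup>2))"
    by (rule infsum_swap_ennreal)
  also have "\<dots> = (\<Sum>\<^sub>\<infinity>i\<in>I. ennreal (p i))"
    by (rule infsum_cong) (use onb_sum_cmod_cinner[OF X p onfam_norm[OF onb_onfam[OF onb]]] in simp)
  finally show ?thesis .
qed

text \<open>The squared Hilbert-Schmidt norm, in an arbitrary basis and in a basis of right singular
  vectors; Parseval's identity and an interchange of sums connect the two.\<close>

lemma sum_norm_square_singular:
  fixes h :: "'i \<Rightarrow> 'h::chilbert_space" and B :: "'h \<Rightarrow> 'h"
  assumes onb: "onb I h" and E: "onb E k" and B: "bounded_op B"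
    and K: "\<And>e. e \<in> E \<Longrightarrow> cadjoint B (B (k e)) = (q e)\<^sup>2 *\<^sub>R k e"
  shows "(\<Sum>\<^sub>\<infinity>i\<in>I. ennreal ((norm (B (h i)))\<^sup>2)) = (\<Sum>\<^sub>\<infinity>e\<in>E. ennreal ((q e)\<^sup>2))"
proof -
  have "ennreal ((norm (B x))\<^sup>2) = (\<Sum>\<^sub>\<infinity>e\<in>E. ennreal ((q e)\<^sup>2 * (cmod (cinner x (k e)))\<^sup>2))" for x
  proof -
    have "cinner (cadjoint B (B x)) (k e) = of_real ((q e)\<^sup>2) * cinner x (k e)" if "e \<in> E" for e
      by (simp add: cinner_cadjoint_left[OF E B] cinner_cadjoint[OF E B] K[OF that] cinner_scaleR_right)
    from diag_form_has_sum[OF E this]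
    have "((\<lambda>e. (q e)\<^sup>2 * (cmod (cinner x (k e)))\<^sup>2) has_sum (norm (B x))\<^sup>2) E"
      by (simp add: cinner_cadjoint_left[OF E B] Re_cinner_self)
    then show ?thesis
      by (rule infsum_ennreal[symmetric]) simp
  qed
  then have "(\<Sum>\<^sub>\<infinity>i\<in>I. ennreal ((norm (B (h i)))\<^sup>2)) =
      (\<Sum>\<^sub>\<infinity>i\<in>I. \<Sum>\<^sub>\<infinity>e\<in>E. ennreal ((q e)\<^sup>2 * (cmod (cinner (h i) (k e)))\<^sup>2))"
    by simp
  also have "\<dots> = (\<Sum>\<^sub>\<infinity>e\<in>E. \<Sum>\<^sub>\<infinity>i\<in>I. ennreal ((q e)\<^sup>2 * (cmod (cinner (h i) (k e)))\<^sup>2))"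
    by (rule infsum_swap_ennreal)
  also have "\<dots> = (\<Sum>\<^sub>\<infinity>e\<in>E. ennreal ((q e)\<^sup>2))"
    by (rule infsum_cong) (use onb_sum_cmod_cinner[OF onb _ onfam_norm[OF onb_onfam[OF E]]] in simp)
  finally show ?thesis .
qed

lemma trace_abs_op_powr:
  fixes h :: "'i \<Rightarrow> 'h::chilbert_space" and B :: "'h \<Rightarrow> 'h"
  assumes onb: "onb I h" and B: "bounded_op B"
    and K: "\<And>i. i \<in> I \<Longrightarrow> cadjoint B (B (h i)) = (q i)\<^sup>2 *\<^sub>R h i" and q: "\<And>i. i \<in> I \<Longrightarrow> 0 \<le> q i"
    and s: "0 < s"
  shows "trace_pos (fun_calc (op_graph (abs_op B)) (\<lambda>l. l powr s)) = (\<Sum>\<^sub>\<infinity>i\<in>I. ennreal (q i powr s))"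
proof (rule trace_pos_diag[OF onb])
  note ab = abs_op_diag[OF onb B K q]
  have bab: "bounded_op (abs_op B)"
    using ab(1) by (simp add: positive_op_def)
  obtain C where C: "0 < C" "\<And>x. norm (B x) \<le> C * norm x"
    using bounded_op_bound[OF B] by blast
  have qC: "q i \<le> C" if "i \<in> I" for i
    using C(2)[of "h i"] singular_vectors_norm[OF onb B K that q[OF that]] onfam_norm[OF onb_onfam[OF onb] that]
    by simp
  fix i x assume i: "i \<in> I"
  show "cinner (fun_calc (op_graph (abs_op B)) (\<lambda>l. l powr s) x) (h i) = of_real (q i powr s) * cinner x (h i)"
    by (rule fun_calc_coeff[OF onb eigenspace_diag[OF onb bab ab(2)] _ i, where C="C powr s"])
       (use q qC s in \<open>auto intro: powr_mono2\<close>)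
qed simp

section \<open>Schatten norms and logarithmic averages\<close>

text \<open>Stands in for comparison with the integral of \<open>t powr (- p)\<close> over
  \<open>[x, x + 1]\<close>. Divided by \<open>y powr (1 - p)\<close> with \<open>y = x + 1\<close>,
  it is a Bernoulli inequality, proved from bounds on \<open>ln\<close> and
  \<open>exp\<close>.\<close>

lemma powr_telescope:
  fixes x p :: real
  assumes "0 < x" "1 < p"
  shows "(p - 1) * (x + 1) powr (- p) \<le> x powr (1 - p) - (x + 1) powr (1 - p)"
proof -
  define y where "y = x + 1"
  have y: "0 < y" "0 < x / y"
    using assms by (auto simp: y_def)
  have "ln (x / y) \<le> x / y - 1"
    using ln_le_minus_one[OF y(2)] .
  also have "\<dots> = - 1 / y"
    using y by (simp add: y_def field_simps)
  finally have "(p - 1) * ln (x / y) \<le> (p - 1) * (- 1 / y)"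
    using assms(2) by (intro mult_left_mono) auto
  then have "1 + (p - 1) / y \<le> 1 + (1 - p) * ln (x / y)"
    by (simp add: algebra_simps)
  also have "\<dots> \<le> exp ((1 - p) * ln (x / y))"
    by (rule exp_ge_add_one_self)
  also have "\<dots> = (x / y) powr (1 - p)"
    using y assms(1) by (simp add: powr_def)
  finally have "y powr (1 - p) * (1 + (p - 1) / y) \<le> y powr (1 - p) * (x / y) powr (1 - p)"
    by (intro mult_left_mono) auto
  also have "\<dots> = x powr (1 - p)"
    using y assms(1) by (simp add: powr_divide)
  also have "y powr (1 - p) * (1 + (p - 1) / y) = y powr (1 - p) + (p - 1) * (y powr (1 - p) / y)"
    by (simp add: algebra_simps)
  also have "y powr (1 - p) / y = y powr (- p)"
    using y(1) powr_diff[of y "1 - p" 1] by simp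
  finally show ?thesis
    by (simp add: y_def)
qed

lemma sum_inverse_powr_le:
  fixes p :: real
  assumes "1 < p"
  shows "(\<Sum>n<k. real (Suc n) powr (- p)) \<le> p / (p - 1)"
proof -
  \<comment> \<open>Subtracting \<open>real (Suc k) powr (1 - p)\<close> makes the claim inductive
    by telescoping; \<open>p\<close> on the right is the starting value, with equality for
    \<open>k = 0\<close>.\<close>
  have "(p - 1) * (\<Sum>n<Suc k. real (Suc n) powr (- p)) \<le> p - real (Suc k) powr (1 - p)" for k
  proof (induction k)
    case (Suc k)
    have "(p - 1) * (\<Sum>n<Suc (Suc k). real (Suc n) powr (- p)) =
        (p - 1) * (\<Sum>n<Suc k. real (Suc n) powr (- p)) + (p - 1) * (real (Suc k) + 1) powr (- p)"
      by (simp add: algebra_simps)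
    also have "\<dots> \<le> (p - real (Suc k) powr (1 - p)) + (real (Suc k) powr (1 - p) - (real (Suc k) + 1) powr (1 - p))"
      by (intro add_mono Suc.IH powr_telescope assms) auto
    finally show ?case
      by (simp add: algebra_simps)
  qed simp
  moreover have "(\<Sum>n<k. real (Suc n) powr (- p)) \<le> (\<Sum>n<Suc k. real (Suc n) powr (- p))"
    by simp
  ultimately have "(p - 1) * (\<Sum>n<k. real (Suc n) powr (- p)) \<le> p"
    by (smt (verit, best) assms mult_le_cancel_left_pos powr_ge_zero)
  then show ?thesis
    using assms by (simp add: field_simps)
qed

text \<open>Abel summation: the induction carries the boundary term \<open>w k * d k\<close>, which
  can only shrink when \<open>w k\<close> is replaced by the next weight; its nonnegativity gives
  the claim.\<close>

lemma decseq_sum_mult_le: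
  fixes s a w :: "nat \<Rightarrow> real"
  assumes "decseq w" "\<And>n. 0 \<le> w n" "\<And>k. (\<Sum>n<k. s n) \<le> (\<Sum>n<k. a n)"
  shows "(\<Sum>n<k. s n * w n) \<le> (\<Sum>n<k. a n * w n)"
proof -
  define d where "d k = (\<Sum>n<k. a n) - (\<Sum>n<k. s n)" for k
  have d0: "0 \<le> d k" for k
    using assms(3)[of k] by (simp add: d_def)
  have "w k * d k \<le> (\<Sum>n<k. a n * w n) - (\<Sum>n<k. s n * w n)" for k
  proof (induction k)
    case (Suc k)
    have "w (Suc k) * d (Suc k) \<le> w k * d (Suc k)"
      using decseqD[OF assms(1), of k "Suc k"] d0 by (intro mult_right_mono) auto
    also have "\<dots> = w k * d k + (a k - s k) * w k"
      by (simp add: d_def algebra_simps)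
    finally show ?case
      using Suc.IH by (simp add: algebra_simps)
  qed (simp add: d_def)
  moreover have "0 \<le> w k * d k"
    using assms(2) d0 by simp
  ultimately show ?thesis
    by (metis diff_ge_0_iff_ge order_trans)
qed

text \<open>By Abel summation and Young's inequality, \<open>\<Sum>s\<^sub>n\<^sup>p \<le> \<Sum>a\<^sub>n s\<^sub>n\<^bsup>p-1\<^esup>\<close> with
  \<open>a\<^sub>n = C (ln (n + 2) - ln (n + 1)) \<le> C / (n + 1)\<close> is dominated by \<open>\<Sum>a\<^sub>n\<^sup>p\<close>.\<close>
lemma log_sum_imp_powr_sum:
  fixes s :: "nat \<Rightarrow> real"
  assumes dec: "decseq s" and nonneg: "\<And>n. 0 \<le> s n"
    and C: "0 \<le> C" "\<And>k. 1 \<le> k \<Longrightarrow> (\<Sum>n<k. s n) \<le> C * ln (1 + real k)" and p: "1 < p"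
  shows "(\<Sum>n<k. s n powr p) \<le> C powr p * (p / (p - 1))"
proof -
  define a where "a n = C * (ln (real (Suc (Suc n))) - ln (real (Suc n)))" for n
  have a_sum: "(\<Sum>n<k. a n) = C * ln (real (Suc k))" for k
    unfolding a_def sum_distrib_left[symmetric]
    by (subst sum_lessThan_telescope[of "\<lambda>n. ln (real (Suc n))"]) simp
  have a0: "0 \<le> a n" for n
    unfolding a_def using C(1) by (intro mult_nonneg_nonneg) auto
  have a_le: "a n \<le> C * (1 / real (Suc n))" for n
  proof -
    have "ln (real (Suc (Suc n))) - ln (real (Suc n)) = ln (1 + 1 / real (Suc n))"
    proof -
      have eq: "1 + 1 / real (Suc n) = real (Suc (Suc n)) / real (Suc n)"
        by (simp add: field_simps)
      show ?thesis
        unfolding eq by (simp add: ln_div del: of_nat_Suc)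
    qed
    also have "\<dots> \<le> 1 / real (Suc n)"
      by (rule ln_add_one_self_le_self) simp
    finally show ?thesis
      unfolding a_def using C(1) by (intro mult_left_mono)
  qed
  let ?w = "\<lambda>n. s n powr (p - 1)"
  have "(\<Sum>n<k. s n * ?w n) \<le> (\<Sum>n<k. a n * ?w n)"
  proof (rule decseq_sum_mult_le)
    show "decseq ?w"
      using dec nonneg p by (auto simp: decseq_def intro!: powr_mono2)
    show "(\<Sum>n<k. s n) \<le> (\<Sum>n<k. a n)" for k
      unfolding a_sum using C(2)[of k] by (cases "k = 0") (auto simp: add.commute)
  qed simp
  moreover have "s n * ?w n = s n powr p" for n
    using nonneg[of n] p powr_mult_base[of "s n" "p - 1"] by simp
  ultimately have 1: "(\<Sum>n<k. s n powr p) \<le> (\<Sum>n<k. a n * ?w n)"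
    by simp
  have young: "a n * ?w n \<le> a n powr p / p + (p - 1) / p * s n powr p" for n
  proof -
    have "a n * ?w n \<le> a n powr p / p + ?w n powr (p / (p - 1)) / (p / (p - 1))"
      by (rule Youngs_inequality) (use p a0 in \<open>auto simp: field_simps\<close>)
    also have "?w n powr (p / (p - 1)) = s n powr p"
      using p by (simp add: powr_powr)
    finally show ?thesis
      by (simp add: mult.commute)
  qed
  have "(\<Sum>n<k. a n * ?w n) \<le> (\<Sum>n<k. a n powr p / p + (p - 1) / p * s n powr p)"
    by (rule sum_mono[OF young])
  also have "\<dots> = (\<Sum>n<k. a n powr p) / p + (p - 1) / p * (\<Sum>n<k. s n powr p)"
    by (simp add: sum.distrib sum_divide_distrib sum_distrib_left)
  finally have "(\<Sum>n<k. s n powr p) \<le> (\<Sum>n<k. a n powr p) / p + (p - 1) / p * (\<Sum>n<k. s n powr p)"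
    using 1 by simp
  \<comment> \<open>The fraction \<open>(p - 1) / p\<close> of the sum on the right is absorbed on
    the left, where the fraction \<open>1 / p\<close> remains.\<close>
  then have "(\<Sum>n<k. s n powr p) \<le> (\<Sum>n<k. a n powr p)"
    using p by (simp add: field_simps)
  also have "\<dots> \<le> (\<Sum>n<k. C powr p * real (Suc n) powr (- p))"
  proof (rule sum_mono)
    fix n
    have "a n powr p \<le> (C * (1 / real (Suc n))) powr p"
      using a_le[of n] a0[of n] p by (intro powr_mono2) auto
    also have "\<dots> = C powr p * real (Suc n) powr (- p)"
      using C(1) by (simp add: powr_divide powr_minus_divide)
    finally show "a n powr p \<le> C powr p * real (Suc n) powr (- p)" .
  qed
  also have "\<dots> \<le> C powr p * (p / (p - 1))"
    unfolding sum_distrib_left[symmetric] by (intro mult_left_mono sum_inverse_powr_le p) simp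
  finally show ?thesis .
qed

text \<open>Hoelder's inequality against the constant sequence 1, obtained from Young's inequality
  termwise after a rescaling.\<close>

lemma sum_le_powr_mean:
  fixes s :: "nat \<Rightarrow> real"
  assumes nonneg: "\<And>n. 0 \<le> s n" and p: "1 < p" and a: "0 < a" "(\<Sum>n<k. s n powr p) \<le> a powr p" and k: "0 < k"
  shows "(\<Sum>n<k. s n) \<le> a * real k powr (1 - 1 / p)"
proof -
  \<comment> \<open>The scale makes \<open>a powr p * c powr p = real k\<close>: the two parts of
    Young's bound, \<open>real k / p\<close> and \<open>real k * (1 - 1 / p)\<close>, then add up to
    \<open>real k\<close>.\<close>
  define c where "c = real k powr (1 / p) / a"
  have c0: "0 < c"
    using a k by (simp add: c_def)
  have young: "s n * c \<le> (s n * c) powr p / p + (1 - 1 / p)" for n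
    using Youngs_inequality[of p "p / (p - 1)" "s n * c" 1] p nonneg[of n] c0
    by (simp add: field_simps)
  have "(\<Sum>n<k. s n) * c \<le> (\<Sum>n<k. (s n * c) powr p / p + (1 - 1 / p))"
    unfolding sum_distrib_right by (rule sum_mono[OF young])
  also have "\<dots> = (\<Sum>n<k. s n powr p) * c powr p / p + real k * (1 - 1 / p)"
    using nonneg c0 by (simp add: powr_mult sum.distrib sum_divide_distrib sum_distrib_right)
  also have "\<dots> \<le> a powr p * c powr p / p + real k * (1 - 1 / p)"
    using a p by (intro add_right_mono divide_right_mono mult_right_mono) auto
  also have "a powr p * c powr p = real k"
    using a k p by (simp add: c_def powr_divide powr_powr)
  finally have "(\<Sum>n<k. s n) * c \<le> real k"
    using p by (simp add: field_simps)
  then have "(\<Sum>n<k. s n) \<le> real k / c"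
    using c0 by (simp add: field_simps)
  also have "\<dots> = a * (real k powr 1 / real k powr (1 / p))"
    using k by (simp add: c_def)
  also have "\<dots> = a * real k powr (1 - 1 / p)"
    by (simp only: powr_diff)
  finally show ?thesis .
qed

text \<open>The exponent \<open>p = 1 + 1 / (2 ln (1 + k))\<close> balances \<open>k\<^bsup>1 - 1/p\<^esup>\<close> against \<open>1 / (p - 1)\<close>.\<close>
lemma powr_sum_imp_log_sum:
  fixes s :: "nat \<Rightarrow> real"
  assumes nonneg: "\<And>n. 0 \<le> s n" and K: "0 < K"
    and le: "\<And>p k. 1 < p \<Longrightarrow> p < 2 \<Longrightarrow> (\<Sum>n<k. s n powr p) \<le> (K / (p - 1)) powr p" and k: "1 \<le> k"
  shows "(\<Sum>n<k. s n) \<le> 2 * exp 1 * K * ln (1 + real k)"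
proof -
  define L where "L = ln (1 + real k)"
  have "ln 2 \<le> L"
    unfolding L_def using k by (subst ln_le_cancel_iff) auto
  \<comment> \<open>This puts \<open>p\<close> below 2, the range in which the hypothesis is
    available.\<close>
  then have L: "1 / 2 < L"
    using ln2_ge_two_thirds by simp
  define p where "p = 1 + 1 / (2 * L)"
  have p: "1 < p" "p < 2"
    using L by (auto simp: p_def field_simps)
  have "(\<Sum>n<k. s n) \<le> (K / (p - 1)) * real k powr (1 - 1 / p)"
    by (rule sum_le_powr_mean[OF nonneg p(1) _ le[OF p]]) (use K p k in auto)
  also have "\<dots> \<le> (K / (p - 1)) * exp 1"
  proof (rule mult_left_mono)
    have "real k powr (1 - 1 / p) \<le> (1 + real k) powr (1 - 1 / p)"
      using p by (intro powr_mono2) auto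
    also have "\<dots> \<le> (1 + real k) powr (p - 1)"
    proof (rule powr_mono)
      have "(p - 1) * (1 - 1 / p) \<ge> 0"
        using p by (intro mult_nonneg_nonneg) auto
      then show "1 - 1 / p \<le> p - 1"
        using p by (simp add: field_simps)
    qed simp
    \<comment> \<open>\<open>(p - 1) * L = 1 / 2\<close> by the choice of \<open>p\<close>, while
      \<open>1 / (p - 1) = 2 * L\<close> produces the factor 2 in the result.\<close>
    also have "\<dots> = exp (1 / 2)"
      using L by (simp add: powr_def p_def flip: L_def)
    also have "\<dots> \<le> exp 1"
      by simp
    finally show "real k powr (1 - 1 / p) \<le> exp 1" .
  qed (use K p in auto)
  also have "\<dots> = 2 * exp 1 * K * L"
    using L by (simp add: p_def)
  finally show ?thesis
    by (simp add: L_def)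
qed

text \<open>Young's inequality twice: for \<open>x\<close> against the weighted geometric mean of
  \<open>y\<close> and \<open>z\<close>, then for \<open>y\<close> against \<open>z\<close> with the
  weights divided by \<open>d = \<beta> + \<gamma>\<close>.\<close>

lemma weighted_amgm3:
  fixes x y z :: real
  assumes "0 < \<alpha>" "0 < \<beta>" "0 < \<gamma>" "\<alpha> + \<beta> + \<gamma> = 1" "0 \<le> x" "0 \<le> y" "0 \<le> z"
  shows "x powr \<alpha> * y powr \<beta> * z powr \<gamma> \<le> \<alpha> * x + \<beta> * y + \<gamma> * z"
proof (cases "x = 0 \<or> y = 0 \<or> z = 0")
  case True
  then have "x powr \<alpha> * y powr \<beta> * z powr \<gamma> = 0"
    by auto
  also have "0 \<le> \<alpha> * x + \<beta> * y + \<gamma> * z"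
    using assms by (intro add_nonneg_nonneg mult_nonneg_nonneg) auto
  finally show ?thesis .
next
  case False
  then have pos: "0 < x" "0 < y" "0 < z"
    using assms by auto
  define d where "d = \<beta> + \<gamma>"
  have d: "0 < d" "\<alpha> + d = 1"
    using assms by (auto simp: d_def)
  have "x powr \<alpha> * y powr \<beta> * z powr \<gamma> = x powr \<alpha> * (y powr (\<beta>/d) * z powr (\<gamma>/d)) powr d"
    using pos d(1) by (simp add: powr_mult powr_powr)
  also have "\<dots> \<le> \<alpha> * x + d * (y powr (\<beta>/d) * z powr (\<gamma>/d))"
    by (rule Youngs_inequality_0) (use assms d pos in auto)
  also have "\<dots> \<le> \<alpha> * x + d * (\<beta>/d * y + \<gamma>/d * z)"
    using assms d pos by (intro add_left_mono mult_left_mono Youngs_inequality_0)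
      (auto simp: d_def add_divide_distrib[symmetric])
  also have "\<dots> = \<alpha> * x + \<beta> * y + \<gamma> * z"
    using d by (simp add: field_simps)
  finally show ?thesis .
qed

text \<open>The factors are normalised by the positive bounds \<open>X\<close>, \<open>Y\<close>,
  \<open>Z\<close> rather than by the sums themselves, which may vanish; then the weighted mean
  inequality is summed.\<close>

lemma Hoelder_sum3:
  fixes x y z :: "'a \<Rightarrow> real"
  assumes exps: "0 < \<alpha>" "0 < \<beta>" "0 < \<gamma>" "\<alpha> + \<beta> + \<gamma> = 1"
    and nonneg: "\<And>t. t \<in> T \<Longrightarrow> 0 \<le> x t" "\<And>t. t \<in> T \<Longrightarrow> 0 \<le> y t" "\<And>t. t \<in> T \<Longrightarrow> 0 \<le> z t"
    and pos: "0 < X" "0 < Y" "0 < Z"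
    and le: "(\<Sum>t\<in>T. x t) \<le> X" "(\<Sum>t\<in>T. y t) \<le> Y" "(\<Sum>t\<in>T. z t) \<le> Z"
  shows "(\<Sum>t\<in>T. x t powr \<alpha> * y t powr \<beta> * z t powr \<gamma>) \<le> X powr \<alpha> * Y powr \<beta> * Z powr \<gamma>"
proof -
  define c where "c = X powr \<alpha> * Y powr \<beta> * Z powr \<gamma>"
  have c: "0 \<le> c"
    by (simp add: c_def)
  have "x t powr \<alpha> * y t powr \<beta> * z t powr \<gamma> \<le> c * (\<alpha> / X * x t + \<beta> / Y * y t + \<gamma> / Z * z t)" if "t \<in> T" for t
  proof -
    have "x t powr \<alpha> * y t powr \<beta> * z t powr \<gamma> =
        c * ((x t / X) powr \<alpha> * (y t / Y) powr \<beta> * (z t / Z) powr \<gamma>)"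
      using pos nonneg[OF that] by (simp add: c_def powr_divide)
    also have "\<dots> \<le> c * (\<alpha> * (x t / X) + \<beta> * (y t / Y) + \<gamma> * (z t / Z))"
      by (intro mult_left_mono c weighted_amgm3 exps) (use pos nonneg[OF that] in auto)
    finally show ?thesis
      by simp
  qed
  then have "(\<Sum>t\<in>T. x t powr \<alpha> * y t powr \<beta> * z t powr \<gamma>)
      \<le> (\<Sum>t\<in>T. c * (\<alpha> / X * x t + \<beta> / Y * y t + \<gamma> / Z * z t))"
    by (rule sum_mono)
  also have "\<dots> = c * (\<alpha> / X * (\<Sum>t\<in>T. x t) + \<beta> / Y * (\<Sum>t\<in>T. y t) + \<gamma> / Z * (\<Sum>t\<in>T. z t))"
    unfolding sum_distrib_left[symmetric] sum.distrib by (rule refl)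
  also have "\<dots> \<le> c * (\<alpha> / X * X + \<beta> / Y * Y + \<gamma> / Z * Z)"
    using pos exps by (intro mult_left_mono c add_mono le) auto
  also have "\<dots> = c"
    using pos exps by simp
  finally show ?thesis
    by (simp add: c_def)
qed

lemma has_sum_sum:
  fixes f :: "'a \<Rightarrow> 'b \<Rightarrow> 'c::topological_comm_monoid_add"
  assumes "\<And>j. j \<in> J \<Longrightarrow> (f j has_sum S j) A"
  shows "((\<lambda>i. \<Sum>j\<in>J. f j i) has_sum (\<Sum>j\<in>J. S j)) A"
  using assms by (induction J rule: infinite_finite_induct) (auto intro!: has_sum_add)

text \<open>Hoelder's inequality for the product of \<open>T g\<^bsup>s/2\<^esup>\<close> and \<open>g\<^bsup>1 - s/2\<^esup>\<close>, expanded in the bases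
  \<open>h\<close> (eigenvectors of \<open>g\<close>) and \<open>E\<close> (eigenvectors of \<open>B\<^sup>* B\<close>), where \<open>B = T g\<close> and \<open>t = T h\<close>.\<close>
lemma schatten_Hoelder:
  fixes h :: "'i \<Rightarrow> 'h::chilbert_space" and B :: "'h \<Rightarrow> 'h"
  assumes onb: "onb I h" and E: "onb E (\<lambda>x. x)" and B: "bounded_op B"
    and K: "\<And>e. e \<in> E \<Longrightarrow> cadjoint B (B e) = (q e)\<^sup>2 *\<^sub>R e" and q: "\<And>e. e \<in> E \<Longrightarrow> 0 \<le> q e"
    and g: "\<And>i. i \<in> I \<Longrightarrow> 0 \<le> g i" and t: "\<And>i. i \<in> I \<Longrightarrow> B (h i) = g i *\<^sub>R t i"
    and s: "1 < s" "s < 2" and pos: "0 < a" "0 < c"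
    and a: "\<And>J. finite J \<Longrightarrow> J \<subseteq> I \<Longrightarrow> (\<Sum>i\<in>J. g i powr s * (norm (t i))\<^sup>2) \<le> a"
    and c: "\<And>J. finite J \<Longrightarrow> J \<subseteq> I \<Longrightarrow> (\<Sum>i\<in>J. g i powr s) \<le> c"
    and F: "finite F" "F \<subseteq> E"
  shows "(\<Sum>e\<in>F. q e powr s) \<le> (a powr (1/2) * c powr (1/s - 1/2)) powr s"
proof -
  \<comment> \<open>Zero singular values are dropped so that \<open>B e\<close> can be normalised;
    they contribute nothing to the sum because \<open>0 powr s = 0\<close>.\<close>
  define G where "G = {e\<in>F. 0 < q e}"
  have G: "finite G" "G \<subseteq> E" "\<And>e. e \<in> G \<Longrightarrow> 0 < q e"
    using F by (auto simp: G_def)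
  define Q where "Q = (\<Sum>e\<in>G. q e powr s)"
  have FQ: "(\<Sum>e\<in>F. q e powr s) = Q"
    unfolding Q_def by (rule sum.mono_neutral_right) (use F q in \<open>force simp: G_def\<close>)+
  show ?thesis
  proof (cases "G = {}")
    case True
    then show ?thesis
      unfolding FQ by (simp add: Q_def)
  next
    case False
    then have Q: "0 < Q"
      unfolding Q_def using G by (intro sum_pos) (auto dest!: G(3))
    \<comment> \<open>The left singular vectors, orthonormal because \<open>B\<close> followed by
      its adjoint is diagonal on \<open>E\<close>.\<close>
    define v where "v e = (1 / q e) *\<^sub>R B e" for e
    have von: "onfam G v"
      unfolding onfam_def
    proof (intro ballI)
      fix e e' assume e: "e \<in> G" "e' \<in> G"
      then have "cinner (B e) (B e') = (if e = e' then of_real ((q e)\<^sup>2) else 0)"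
        using singular_vectors_cinner[OF E B K, of e e'] G(2) by (auto simp: subset_iff)
      then show "cinner (v e) (v e') = (if e = e' then 1 else 0)"
        using G(3)[OF e(1)] G(3)[OF e(2)]
        by (simp add: v_def cinner_scaleR_left cinner_scaleR_right power2_eq_square)
    qed
    have nB: "norm (B e) = q e" if "e \<in> G" for e
      using singular_vectors_norm[OF E B K _ q] that G(2) by blast
    define w where "w e i = cmod (cinner e (h i))" for e i
    define u where "u e i = cmod (cinner (t i) (v e))" for e i
    have w0: "0 \<le> w e i" and u0: "0 \<le> u e i" for e i
      by (auto simp: w_def u_def)
    \<comment> \<open>Each of the three families is summed by Bessel's inequality in one system:
      \<open>X\<close> over \<open>e\<close> by \<open>v\<close>, \<open>Y\<close> over
      \<open>i\<close> by \<open>h\<close>, \<open>Z\<close> over \<open>e\<close> by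
      \<open>E\<close>. The bounds are \<open>a\<close>, \<open>Q\<close> and
      \<open>c\<close>.\<close>
    define X where "X = (\<lambda>(e, i). g i powr s * (u e i)\<^sup>2)"
    define Y where "Y = (\<lambda>(e, i). q e powr s * (w e i)\<^sup>2)"
    define Z where "Z = (\<lambda>(e, i). g i powr s * (w e i)\<^sup>2)"
    \<comment> \<open>The weight \<open>1/2\<close> belongs to the Hilbert-Schmidt factor,
      \<open>?c\<close> to the factor of Schatten exponent \<open>1 / ?c\<close>, and
      \<open>?b\<close> to the dual test weights \<open>q e powr (s - 1)\<close>.\<close>
    let ?b = "(s - 1) / s" and ?c = "1/s - 1/2"
    have exps: "0 < (1/2::real)" "0 < ?b" "0 < ?c" "1/2 + ?b + ?c = 1"
      using s by (auto simp: field_simps)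
    have term_eq: "q e powr (s - 1) * (w e i * (g i * u e i)) = X (e, i) powr (1/2) * Y (e, i) powr ?b * Z (e, i) powr ?c"
      if e: "e \<in> G" and i: "i \<in> I" for e i
    proof (cases "w e i = 0 \<or> g i = 0")
      case True
      then show ?thesis
        by (auto simp: X_def Y_def Z_def)
    next
      case False
      then have p: "0 < w e i" "0 < g i" "0 < q e"
        using w0[of e i] g[OF i] G(3)[OF e] by auto
      have sq: "(w e i)\<^sup>2 = w e i powr 2"
        using p by simp
      have x1: "X (e, i) powr (1/2) = g i powr (s/2) * u e i"
        using u0[of e i] by (simp add: X_def powr_mult powr_powr powr_half_sqrt)
      have x2: "Y (e, i) powr ?b = q e powr (s - 1) * w e i powr (2 * ?b)"
        using s by (simp add: Y_def powr_mult powr_powr sq)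
      have x3: "Z (e, i) powr ?c = g i powr (s * ?c) * w e i powr (2 * ?c)"
        by (simp add: Z_def powr_mult powr_powr sq)
      have x4: "g i powr (s/2) * g i powr (s * ?c) = g i"
      proof -
        have "s/2 + s * ?c = 1"
          using s by (simp add: field_simps)
        then show ?thesis
          using p by (simp flip: powr_add)
      qed
      have x5: "w e i powr (2 * ?b) * w e i powr (2 * ?c) = w e i"
      proof -
        have "2 * ?b + 2 * ?c = 1"
          using s by (simp add: field_simps)
        then show ?thesis
          using p(1) by (metis less_imp_le powr_add powr_one)
      qed
      have "X (e, i) powr (1/2) * Y (e, i) powr ?b * Z (e, i) powr ?c =
          q e powr (s - 1) * ((w e i powr (2 * ?b) * w e i powr (2 * ?c)) *
            ((g i powr (s/2) * g i powr (s * ?c)) * u e i))"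
        unfolding x1 x2 x3 by (simp only: mult_ac)
      then show ?thesis
        unfolding x4 x5 by simp
    qed
    have main: "(\<Sum>e\<in>G. q e powr (s - 1) * (\<Sum>i\<in>J. w e i * (g i * u e i))) \<le> a powr (1/2) * Q powr ?b * c powr ?c"
      if J: "finite J" "J \<subseteq> I" for J
    proof -
      have "(\<Sum>e\<in>G. q e powr (s - 1) * (\<Sum>i\<in>J. w e i * (g i * u e i)))
          = (\<Sum>p\<in>G \<times> J. X p powr (1/2) * Y p powr ?b * Z p powr ?c)"
        unfolding sum_distrib_left sum.cartesian_product using J(2)
        by (intro sum.cong refl) (auto simp: term_eq subset_iff)
      also have "\<dots> \<le> a powr (1/2) * Q powr ?b * c powr ?c"
      proof (rule Hoelder_sum3[OF exps])
        have "(\<Sum>p\<in>G \<times> J. X p) = (\<Sum>i\<in>J. g i powr s * (\<Sum>e\<in>G. (u e i)\<^sup>2))"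
          unfolding X_def sum_distrib_left by (subst sum.swap) (simp add: sum.cartesian_product)
        also have "\<dots> \<le> (\<Sum>i\<in>J. g i powr s * (norm (t i))\<^sup>2)"
          unfolding u_def by (intro sum_mono mult_left_mono bessel_finite[OF von G(1)]) auto
        also have "\<dots> \<le> a"
          by (rule a[OF J])
        finally show "(\<Sum>p\<in>G \<times> J. X p) \<le> a" .
        have "(\<Sum>p\<in>G \<times> J. Y p) = (\<Sum>e\<in>G. q e powr s * (\<Sum>i\<in>J. (w e i)\<^sup>2))"
          unfolding Y_def sum_distrib_left by (simp add: sum.cartesian_product)
        also have "\<dots> \<le> (\<Sum>e\<in>G. q e powr s * (norm e)\<^sup>2)"
          unfolding w_def by (intro sum_mono mult_left_mono bessel_finite[OF onb_onfam[OF onb] J]) auto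
        also have "\<dots> = Q"
          unfolding Q_def using onfam_norm[OF onb_onfam[OF E]] G(2) by (intro sum.cong) auto
        finally show "(\<Sum>p\<in>G \<times> J. Y p) \<le> Q" .
        have "(\<Sum>p\<in>G \<times> J. Z p) = (\<Sum>i\<in>J. g i powr s * (\<Sum>e\<in>G. (w e i)\<^sup>2))"
          unfolding Z_def sum_distrib_left by (subst sum.swap) (simp add: sum.cartesian_product)
        also have "\<dots> \<le> (\<Sum>i\<in>J. g i powr s * 1)"
        proof (intro sum_mono mult_left_mono)
          fix i assume i: "i \<in> J"
          have "w e i = cmod (cinner (h i) e)" for e
            unfolding w_def by (metis cinner_commute complex_mod_cnj)
          then have "(\<Sum>e\<in>G. (w e i)\<^sup>2) \<le> (norm (h i))\<^sup>2"
            using bessel_finite[OF onb_onfam[OF E] G(1,2), of "h i"] by simp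
          also have "norm (h i) = 1"
            using onfam_norm[OF onb_onfam[OF onb]] i J(2) by blast
          finally show "(\<Sum>e\<in>G. (w e i)\<^sup>2) \<le> 1"
            by simp
        qed simp
        also have "\<dots> \<le> c"
          using c[OF J] by simp
        finally show "(\<Sum>p\<in>G \<times> J. Z p) \<le> c" .
      qed (use pos Q in \<open>auto simp: X_def Y_def Z_def\<close>)
      finally show ?thesis .
    qed
    \<comment> \<open>Trace duality: \<open>q e powr s\<close> is \<open>q e powr (s - 1)\<close>
      times the pairing of \<open>B e\<close> with \<open>v e\<close>, and this pairing is expanded
      over \<open>h\<close>.\<close>
    define r where "r e i = q e powr (s - 1) * Re (cinner e (h i) * cinner (B (h i)) (v e))" for e i
    have "((\<lambda>i. r e i) has_sum q e powr s) I" if e: "e \<in> G" for e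
    proof -
      have "cinner (B e) (v e) = of_real (q e)"
        using nB[OF e] G(3)[OF e] by (simp add: v_def cinner_scaleR_right cinner_self power2_eq_square)
      then have "((\<lambda>i. cinner e (h i) * cinner (B (h i)) (v e)) has_sum of_real (q e)) I"
        using has_sum_cinner_left[OF bounded_op_has_sum[OF onb B, of e], of "v e"]
        by (simp add: cinner_scaleC_left)
      from has_sum_cmult_right[OF has_sum_Re[OF this], of "q e powr (s - 1)"]
      show ?thesis
        using powr_mult_base[of "q e" "s - 1"] G(3)[OF e] by (simp add: r_def mult.commute)
    qed
    then have "((\<lambda>i. \<Sum>e\<in>G. r e i) has_sum Q) I"
      unfolding Q_def by (rule has_sum_sum)
    then have "Q \<le> a powr (1/2) * Q powr ?b * c powr ?c"
    proof (rule has_sum_le_finite_sums)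
      fix J assume J: "finite J" "J \<subseteq> I"
      have "(\<Sum>i\<in>J. \<Sum>e\<in>G. r e i) = (\<Sum>e\<in>G. \<Sum>i\<in>J. r e i)"
        by (rule sum.swap)
      also have "\<dots> \<le> (\<Sum>e\<in>G. \<Sum>i\<in>J. q e powr (s - 1) * (w e i * (g i * u e i)))"
        unfolding r_def
      proof (intro sum_mono mult_left_mono)
        fix e i assume "i \<in> J"
        then have i: "i \<in> I"
          using J by blast
        have "Re (cinner e (h i) * cinner (B (h i)) (v e)) \<le> cmod (cinner e (h i) * cinner (B (h i)) (v e))"
          by (rule complex_Re_le_cmod)
        also have "\<dots> = w e i * (g i * u e i)"
          using g[OF i] by (simp add: t[OF i] cinner_scaleR_left norm_mult w_def u_def)
        finally show "Re (cinner e (h i) * cinner (B (h i)) (v e)) \<le> w e i * (g i * u e i)" .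
      qed simp
      also have "\<dots> \<le> a powr (1/2) * Q powr ?b * c powr ?c"
        using main[OF J] by (simp add: sum_distrib_left)
      finally show "(\<Sum>i\<in>J. \<Sum>e\<in>G. r e i) \<le> a powr (1/2) * Q powr ?b * c powr ?c" .
    qed
    \<comment> \<open>Since \<open>1/s + ?b = 1\<close>, one positive power of \<open>Q\<close>
      cancels and the dual side disappears.\<close>
    then have "Q powr (1/s) * Q powr ?b \<le> (a powr (1/2) * c powr ?c) * Q powr ?b"
      using Q s by (simp flip: powr_add add: mult_ac diff_divide_distrib)
    then have "Q powr (1/s) \<le> a powr (1/2) * c powr ?c"
      using Q by (simp add: mult_le_cancel_right)
    then have "(Q powr (1/s)) powr s \<le> (a powr (1/2) * c powr ?c) powr s"
      using s by (intro powr_mono2) auto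
    then show ?thesis
      using Q s by (simp add: FQ powr_powr)
  qed
qed

section \<open>Unbounded multiplication operators\<close>

lemma Lp_norm_2: "Lp_norm 2 M u = epowr (\<integral>\<^sup>+x. ennreal ((cmod (u x))\<^sup>2) \<partial>M) (1 / 2)"
  by (simp add: Lp_norm_def)

lemma epowr_finite_iff: "epowr x p < \<infinity> \<longleftrightarrow> x < \<infinity>"
  by (auto simp: epowr_def less_top)

lemma Lp_2_iff:
  "u \<in> Lp 2 M \<longleftrightarrow> u \<in> borel_measurable M \<and> (\<integral>\<^sup>+x. ennreal ((cmod (u x))\<^sup>2) \<partial>M) < \<infinity>"
  unfolding Lp_def Lp_norm_2 epowr_finite_iff by simp

text \<open>Turns unordered sums over a set of naturals into series, to which termwise integration
  applies.\<close>

lemma infsum_nat_ennreal: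
  fixes F :: "nat \<Rightarrow> ennreal"
  shows "infsum F I = (\<Sum>m. F m * indicator I m)"
proof -
  have "infsum F I = infsum (\<lambda>m. F m * indicator I m) UNIV"
    by (rule infsum_cong_neutral) auto
  moreover have "((\<lambda>m. F m * indicator I m) has_sum infsum (\<lambda>m. F m * indicator I m) UNIV) UNIV"
    by (rule has_sum_infsum) (simp add: nonneg_summable_on_complete)
  ultimately show ?thesis
    using has_sum_imp_sums sums_unique by metis
qed

lemma infsum_ennreal_le_iff:
  fixes f :: "'i \<Rightarrow> real"
  assumes "\<And>i. i \<in> A \<Longrightarrow> 0 \<le> f i" "0 \<le> c"
  shows "(\<Sum>\<^sub>\<infinity>i\<in>A. ennreal (f i)) \<le> ennreal c \<longleftrightarrow> (\<forall>F. finite F \<longrightarrow> F \<subseteq> A \<longrightarrow> sum f F \<le> c)"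
proof -
  have "(\<Sum>i\<in>F. ennreal (f i)) = ennreal (sum f F)" if "F \<subseteq> A" for F
    using that assms(1) by (intro sum_ennreal) auto
  then have "(\<Sum>i\<in>F. ennreal (f i)) \<le> ennreal c \<longleftrightarrow> sum f F \<le> c" if "F \<subseteq> A" for F
    using that assms by (simp add: ennreal_le_iff)
  then show ?thesis
    by (subst nonneg_infsum_complete) (auto simp: SUP_le_iff)
qed

section \<open>The unitary onto L^2 and the graphs of conjugated multiplication operators\<close>

lemma unitary_L2_measurable: "unitary_L2 U M \<Longrightarrow> U x \<in> borel_measurable M"
  by (simp add: unitary_L2_def Lp_2_iff)

lemma unitary_L2_norm:
  assumes "unitary_L2 U M"
  shows "(\<integral>\<^sup>+t. ennreal ((cmod (U x t))\<^sup>2) \<partial>M) = ennreal ((norm x)\<^sup>2)"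
proof -
  have m: "U x \<in> borel_measurable M" and fin: "(\<integral>\<^sup>+t. ennreal ((cmod (U x t))\<^sup>2) \<partial>M) < \<infinity>"
    using assms by (auto simp: unitary_L2_def Lp_2_iff)
  have int: "integrable M (\<lambda>t. (cmod (U x t))\<^sup>2)"
    by (rule integrableI_nonneg) (use m fin in auto)
  have "of_real ((norm x)\<^sup>2) = (\<integral>t. U x t * cnj (U x t) \<partial>M)"
    using assms by (simp add: unitary_L2_def cinner_self)
  also have "\<dots> = (\<integral>t. of_real ((cmod (U x t))\<^sup>2) \<partial>M)"
    by (simp add: complex_norm_square del: of_real_power)
  also have "\<dots> = of_real (\<integral>t. (cmod (U x t))\<^sup>2 \<partial>M)"
    by (rule integral_of_real[OF int])
  finally have "(norm x)\<^sup>2 = (\<integral>t. (cmod (U x t))\<^sup>2 \<partial>M)"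
    by (simp only: of_real_eq_iff)
  then show ?thesis
    by (subst nn_integral_eq_integral[OF int]) simp_all
qed

lemma unitary_L2_diff:
  assumes "unitary_L2 U M"
  shows "AE t in M. U (x - y) t = U x t - U y t"
proof -
  have "x - y = x + (- 1) *\<^sub>C y"
    using scaleR_scaleC[of "-1" y] by simp
  moreover have "AE t in M. U (x + (- 1) *\<^sub>C y) t = U x t + U ((- 1) *\<^sub>C y) t"
    "AE t in M. U ((- 1) *\<^sub>C y) t = (- 1) * U y t"
    using assms unfolding unitary_L2_def by blast+
  ultimately show ?thesis
    by auto
qed

text \<open>\<open>U\<close> takes values in L^2, so the two membership conditions of
  \<open>mult_op\<close> are automatic.\<close>

lemma conj_mult_op_iff:
  assumes "unitary_L2 U M"
  shows "(x, y) \<in> conj_mult_op U M f \<longleftrightarrow> (AE t in M. U y t = f t * U x t)"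
  using assms by (auto simp: conj_mult_op_def mult_op_def unitary_L2_def)

lemma conj_mult_op_zero:
  assumes "unitary_L2 U M"
  shows "(0, 0) \<in> conj_mult_op U M f"
proof -
  have "AE t in M. U (0 - 0) t = U 0 t - U 0 t"
    by (rule unitary_L2_diff[OF assms])
  then have "AE t in M. U 0 t = f t * U 0 t"
    by eventually_elim simp
  then show ?thesis
    by (simp add: conj_mult_op_iff[OF assms])
qed

lemma conj_mult_op_add:
  assumes U: "unitary_L2 U M" and "(x, y) \<in> conj_mult_op U M f" "(x', y') \<in> conj_mult_op U M f"
  shows "(x + x', y + y') \<in> conj_mult_op U M f"
proof -
  have "AE t in M. U (x + x') t = U x t + U x' t" "AE t in M. U (y + y') t = U y t + U y' t"
    using U by (auto simp: unitary_L2_def)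
  then have "AE t in M. U (y + y') t = f t * U (x + x') t"
    using assms(2,3) unfolding conj_mult_op_iff[OF U] by eventually_elim (simp add: algebra_simps)
  then show ?thesis
    by (simp add: conj_mult_op_iff[OF U])
qed

lemma conj_mult_op_scaleC:
  assumes U: "unitary_L2 U M" and "(x, y) \<in> conj_mult_op U M f"
  shows "(c *\<^sub>C x, c *\<^sub>C y) \<in> conj_mult_op U M f"
proof -
  have "AE t in M. U (c *\<^sub>C x) t = c * U x t" "AE t in M. U (c *\<^sub>C y) t = c * U y t"
    using U by (auto simp: unitary_L2_def)
  then have "AE t in M. U (c *\<^sub>C y) t = f t * U (c *\<^sub>C x) t"
    using assms(2) unfolding conj_mult_op_iff[OF U] by eventually_elim (simp add: algebra_simps)
  then show ?thesis
    by (simp add: conj_mult_op_iff[OF U])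
qed

lemma conj_mult_op_sum:
  assumes U: "unitary_L2 U M" and "\<And>i. i \<in> F \<Longrightarrow> (x i, y i) \<in> conj_mult_op U M f"
  shows "(\<Sum>i\<in>F. x i, \<Sum>i\<in>F. y i) \<in> conj_mult_op U M f"
  using assms(2)
  by (induction F rule: infinite_finite_induct) (auto intro: conj_mult_op_zero[OF U] conj_mult_op_add[OF U])

lemma conj_mult_op_norm:
  assumes U: "unitary_L2 U M" and "(x, y) \<in> conj_mult_op U M f"
  shows "ennreal ((norm y)\<^sup>2) = (\<integral>\<^sup>+t. ennreal ((cmod (f t * U x t))\<^sup>2) \<partial>M)"
  unfolding unitary_L2_norm[OF U, symmetric]
  by (rule nn_integral_cong_AE) (use assms(2) in \<open>auto simp: conj_mult_op_iff[OF U]\<close>)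

lemma conj_mult_op_exists:
  assumes U: "unitary_L2 U M" and f: "f \<in> borel_measurable M"
    and fin: "(\<integral>\<^sup>+t. ennreal ((cmod (f t * U x t))\<^sup>2) \<partial>M) < \<infinity>"
  shows "\<exists>y. (x, y) \<in> conj_mult_op U M f"
proof -
  have L: "(\<lambda>t. f t * U x t) \<in> Lp 2 M"
    using fin f unitary_L2_measurable[OF U, of x] by (simp add: Lp_2_iff)
  have "\<forall>u\<in>Lp 2 M. \<exists>y. AE t in M. U y t = u t"
    using U by (simp add: unitary_L2_def)
  from bspec[OF this L] show ?thesis
    by (simp add: conj_mult_op_iff[OF U])
qed

lemma conj_mult_op_unique:
  assumes U: "unitary_L2 U M" and "(x, y) \<in> conj_mult_op U M f" "(x, y') \<in> conj_mult_op U M f"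
  shows "y = y'"
proof -
  have "AE t in M. U (y - y') t = 0"
    using unitary_L2_diff[OF U, of y y'] assms(2,3) unfolding conj_mult_op_iff[OF U]
    by eventually_elim simp
  then have "(\<integral>\<^sup>+t. ennreal ((cmod (U (y - y') t))\<^sup>2) \<partial>M) = (\<integral>\<^sup>+t. 0 \<partial>M)"
    by (intro nn_integral_cong_AE) auto
  then show ?thesis
    by (simp add: unitary_L2_norm[OF U])
qed

text \<open>Where \<open>|f| \<le> k\<close>, multiplication by \<open>f\<close> is bounded, so that limits may be taken there.\<close>
lemma closed_conj_mult_op:
  assumes U: "unitary_L2 U M" and f: "f \<in> borel_measurable M"
  shows "closed (conj_mult_op U M f)"
  unfolding closed_sequential_limits
proof (intro allI impI, elim conjE)
  fix z l assume z: "\<forall>n. z n \<in> conj_mult_op U M f" "z \<longlonglongrightarrow> l"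
  obtain x y where l: "l = (x, y)"
    by (cases l)
  define a b where "a n = fst (z n)" and "b n = snd (z n)" for n
  have lim: "a \<longlonglongrightarrow> x" "b \<longlonglongrightarrow> y"
    using tendsto_fst[OF z(2)] tendsto_snd[OF z(2)] by (simp_all add: a_def[abs_def] b_def[abs_def] l)
  have ab: "AE t in M. U (b n) t = f t * U (a n) t" for n
    using z(1)[rule_format, of n] conj_mult_op_iff[OF U, of "a n" "b n" f] by (simp add: a_def b_def)
  note [measurable] = f unitary_L2_measurable[OF U]
  have "AE t in M. cmod (f t) \<le> real k \<longrightarrow> U y t = f t * U x t" for k
  proof -
    let ?S = "{t \<in> space M. cmod (f t) \<le> real k}"
    define \<phi> where "\<phi> t = indicator ?S t * ennreal ((cmod (U y t - f t * U x t))\<^sup>2)" for t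
    have [measurable]: "\<phi> \<in> borel_measurable M"
      unfolding \<phi>_def by measurable
    \<comment> \<open>The factors 2 come from squaring a sum of two terms, and
      \<open>(real k)\<^sup>2\<close> bounds the square of \<open>f\<close> on \<open>?S\<close>. As
      \<open>r n\<close> tends to 0, \<open>\<phi>\<close> vanishes almost everywhere.\<close>
    define r where "r n = 2 * (norm (y - b n))\<^sup>2 + 2 * (real k)\<^sup>2 * (norm (a n - x))\<^sup>2" for n
    have le: "(\<integral>\<^sup>+t. \<phi> t \<partial>M) \<le> ennreal (r n)" for n
    proof -
      have "AE t in M. \<phi> t \<le> 2 * ennreal ((cmod (U (y - b n) t))\<^sup>2) + ennreal (2 * (real k)\<^sup>2) * ennreal ((cmod (U (a n - x) t))\<^sup>2)"
        using ab[of n] unitary_L2_diff[OF U, of y "b n"] unitary_L2_diff[OF U, of "a n" x]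
      proof eventually_elim
        case (elim t)
        show ?case
        proof (cases "t \<in> ?S")
          case True
          have "U y t - f t * U x t = U (y - b n) t + f t * U (a n - x) t"
            unfolding elim(2,3) elim(1) by (simp add: algebra_simps)
          then have "cmod (U y t - f t * U x t) \<le> cmod (U (y - b n) t) + cmod (f t) * cmod (U (a n - x) t)"
            by (metis norm_mult norm_triangle_ineq)
          also have "\<dots> \<le> cmod (U (y - b n) t) + real k * cmod (U (a n - x) t)"
            using True by (intro add_left_mono mult_right_mono) auto
          finally have "(cmod (U y t - f t * U x t))\<^sup>2 \<le> (cmod (U (y - b n) t) + real k * cmod (U (a n - x) t))\<^sup>2"
            by (rule power_mono) simp
          also have "\<dots> \<le> 2 * (cmod (U (y - b n) t))\<^sup>2 + 2 * (real k)\<^sup>2 * (cmod (U (a n - x) t))\<^sup>2"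
            using sum_squares_bound[of "cmod (U (y - b n) t)" "real k * cmod (U (a n - x) t)"]
            by (simp add: power2_sum power_mult_distrib)
          finally have "ennreal ((cmod (U y t - f t * U x t))\<^sup>2)
              \<le> ennreal (2 * (cmod (U (y - b n) t))\<^sup>2 + 2 * (real k)\<^sup>2 * (cmod (U (a n - x) t))\<^sup>2)"
            by (rule ennreal_leI)
          then show ?thesis
            using True by (simp add: \<phi>_def ennreal_mult ennreal_plus)
        qed (simp add: \<phi>_def)
      qed
      then have "(\<integral>\<^sup>+t. \<phi> t \<partial>M) \<le> (\<integral>\<^sup>+t. 2 * ennreal ((cmod (U (y - b n) t))\<^sup>2)
          + ennreal (2 * (real k)\<^sup>2) * ennreal ((cmod (U (a n - x) t))\<^sup>2) \<partial>M)"
        by (rule nn_integral_mono_AE)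
      also have "\<dots> = ennreal (r n)"
        by (simp add: nn_integral_add nn_integral_cmult unitary_L2_norm[OF U] r_def ennreal_mult ennreal_plus)
      finally show ?thesis .
    qed
    have "r \<longlonglongrightarrow> 2 * (norm (y - y))\<^sup>2 + 2 * (real k)\<^sup>2 * (norm (x - x))\<^sup>2"
      unfolding r_def by (intro tendsto_intros lim)
    then have "(\<lambda>n. ennreal (r n)) \<longlonglongrightarrow> ennreal 0"
      by (intro tendsto_ennrealI) simp
    then have "(\<integral>\<^sup>+t. \<phi> t \<partial>M) \<le> ennreal 0"
      by (rule tendsto_lowerbound) (use le in auto)
    then have "AE t in M. \<phi> t = 0"
      by (simp add: nn_integral_0_iff_AE)
    then show ?thesis
      using AE_space by eventually_elim (auto simp: \<phi>_def)
  qed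
  then have "AE t in M. \<forall>k. cmod (f t) \<le> real k \<longrightarrow> U y t = f t * U x t"
    unfolding AE_all_countable by blast
  then have "AE t in M. U y t = f t * U x t"
    by eventually_elim (metis real_arch_simple)
  then show "l \<in> conj_mult_op U M f"
    by (simp add: l conj_mult_op_iff[OF U])
qed

text \<open>Termwise integration of the density. The inner integral is the squared norm of the image
  of \<open>h m\<close> if \<open>h m\<close> is in the domain of multiplication and infinite
  otherwise, so the formula is free of domain conditions.\<close>

lemma nn_integral_zeta_measure:
  fixes I :: "nat set"
  assumes U: "unitary_L2 U M" and f: "f \<in> borel_measurable M"
  shows "(\<integral>\<^sup>+t. ennreal ((cmod (f t))\<^sup>2) \<partial>zeta_measure U M I h lam G s) =
    (\<Sum>\<^sub>\<infinity>m\<in>I. ennreal (G (lam m) powr s) * (\<integral>\<^sup>+t. ennreal ((cmod (f t * U (h m) t))\<^sup>2) \<partial>M))"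
proof -
  note [measurable] = f unitary_L2_measurable[OF U]
  let ?w = "\<lambda>m t. ennreal (G (lam m) powr s * (cmod (U (h m) t))\<^sup>2) * indicator I m"
  have "(\<integral>\<^sup>+t. ennreal ((cmod (f t))\<^sup>2) \<partial>zeta_measure U M I h lam G s)
      = (\<integral>\<^sup>+t. (\<Sum>m. ?w m t) * ennreal ((cmod (f t))\<^sup>2) \<partial>M)"
    unfolding zeta_measure_def infsum_nat_ennreal by (subst nn_integral_density) auto
  also have "\<dots> = (\<integral>\<^sup>+t. (\<Sum>m. ?w m t * ennreal ((cmod (f t))\<^sup>2)) \<partial>M)"
    by (simp add: ennreal_suminf_multc)
  also have "\<dots> = (\<Sum>m. \<integral>\<^sup>+t. ?w m t * ennreal ((cmod (f t))\<^sup>2) \<partial>M)"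
    by (rule nn_integral_suminf) measurable
  also have "\<dots> = (\<Sum>m. ennreal (G (lam m) powr s) * (\<integral>\<^sup>+t. ennreal ((cmod (f t * U (h m) t))\<^sup>2) \<partial>M) * indicator I m)"
  proof (rule suminf_cong)
    fix m
    have "(\<integral>\<^sup>+t. ?w m t * ennreal ((cmod (f t))\<^sup>2) \<partial>M)
        = (\<integral>\<^sup>+t. (ennreal (G (lam m) powr s) * indicator I m) * ennreal ((cmod (f t * U (h m) t))\<^sup>2) \<partial>M)"
      by (rule nn_integral_cong) (simp add: ennreal_mult norm_mult power_mult_distrib mult_ac)
    also have "\<dots> = (ennreal (G (lam m) powr s) * indicator I m) * (\<integral>\<^sup>+t. ennreal ((cmod (f t * U (h m) t))\<^sup>2) \<partial>M)"
      by (rule nn_integral_cmult) measurable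
    finally show "(\<integral>\<^sup>+t. ?w m t * ennreal ((cmod (f t))\<^sup>2) \<partial>M)
        = ennreal (G (lam m) powr s) * (\<integral>\<^sup>+t. ennreal ((cmod (f t * U (h m) t))\<^sup>2) \<partial>M) * indicator I m"
      by (simp add: mult_ac)
  qed
  finally show ?thesis
    by (simp add: infsum_nat_ennreal)
qed

section \<open>Hilbert-Schmidt operators\<close>

lemma compact_bounded_combinations:
  fixes b :: "'i \<Rightarrow> 'h::chilbert_space"
  assumes "finite F"
  shows "compact {\<Sum>i\<in>F. c i *\<^sub>C b i |c. \<forall>i\<in>F. cmod (c i) \<le> R}"
  using assms
proof (induction F)
  case (insert j F)
  let ?C = "{\<Sum>i\<in>F. c i *\<^sub>C b i |c. \<forall>i\<in>F. cmod (c i) \<le> R}"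
  have "compact ((\<lambda>a. a *\<^sub>C b j) ` cball 0 R)"
    by (intro compact_continuous_image bounded_linear.continuous_on[OF
          bounded_bilinear.bounded_linear_left[OF bounded_bilinear_scaleC]] continuous_intros) simp
  then have "compact {x + y |x y. x \<in> (\<lambda>a. a *\<^sub>C b j) ` cball 0 R \<and> y \<in> ?C}"
    by (rule compact_sums[OF _ insert.IH])
  also have "{x + y |x y. x \<in> (\<lambda>a. a *\<^sub>C b j) ` cball 0 R \<and> y \<in> ?C} =
      {\<Sum>i\<in>insert j F. c i *\<^sub>C b i |c. \<forall>i\<in>insert j F. cmod (c i) \<le> R}"
  proof (intro set_eqI iffI)
    fix z assume "z \<in> {x + y |x y. x \<in> (\<lambda>a. a *\<^sub>C b j) ` cball 0 R \<and> y \<in> ?C}"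
    then obtain a c where ac: "z = a *\<^sub>C b j + (\<Sum>i\<in>F. c i *\<^sub>C b i)" "cmod a \<le> R" "\<forall>i\<in>F. cmod (c i) \<le> R"
      by auto
    have "(\<Sum>i\<in>F. (c(j := a)) i *\<^sub>C b i) = (\<Sum>i\<in>F. c i *\<^sub>C b i)"
      using insert.hyps by (intro sum.cong) auto
    then have "z = (\<Sum>i\<in>insert j F. (c(j := a)) i *\<^sub>C b i)"
      using insert.hyps ac(1) by simp
    then show "z \<in> {\<Sum>i\<in>insert j F. c i *\<^sub>C b i |c. \<forall>i\<in>insert j F. cmod (c i) \<le> R}"
      using ac(2,3) by (intro CollectI exI[of _ "c(j := a)"]) auto
  next
    fix z assume "z \<in> {\<Sum>i\<in>insert j F. c i *\<^sub>C b i |c. \<forall>i\<in>insert j F. cmod (c i) \<le> R}"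
    then obtain c where "z = c j *\<^sub>C b j + (\<Sum>i\<in>F. c i *\<^sub>C b i)" "cmod (c j) \<le> R" "\<forall>i\<in>F. cmod (c i) \<le> R"
      using insert.hyps by auto
    then show "z \<in> {x + y |x y. x \<in> (\<lambda>a. a *\<^sub>C b j) ` cball 0 R \<and> y \<in> ?C}"
      by fastforce
  qed
  finally show ?case .
qed simp

text \<open>Cauchy-Schwarz between the coefficients, controlled by Bessel's inequality, and the
  norms of the \<open>b i\<close>, which may be far from orthogonal.\<close>

lemma sum_scaleC_norm_le:
  fixes b :: "'i \<Rightarrow> 'h::chilbert_space"
  assumes on: "onfam I h" and F: "finite F" "F \<subseteq> I" and S: "(\<Sum>i\<in>F. (norm (b i))\<^sup>2) \<le> S"
  shows "norm (\<Sum>i\<in>F. cinner x (h i) *\<^sub>C b i) \<le> sqrt S * norm x"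
proof -
  have "norm (\<Sum>i\<in>F. cinner x (h i) *\<^sub>C b i) \<le> (\<Sum>i\<in>F. \<bar>cmod (cinner x (h i))\<bar> * \<bar>norm (b i)\<bar>)"
    using norm_sum[of "\<lambda>i. cinner x (h i) *\<^sub>C b i" F] by (simp add: norm_scaleC)
  also have "\<dots> \<le> L2_set (\<lambda>i. cmod (cinner x (h i))) F * L2_set (\<lambda>i. norm (b i)) F"
    by (rule L2_set_mult_ineq)
  also have "\<dots> \<le> norm x * sqrt S"
  proof (rule mult_mono)
    show "L2_set (\<lambda>i. cmod (cinner x (h i))) F \<le> norm x"
      unfolding L2_set_def using bessel_finite[OF on F, of x] by (intro real_le_lsqrt) (auto intro: sum_nonneg)
    show "L2_set (\<lambda>i. norm (b i)) F \<le> sqrt S"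
      unfolding L2_set_def using S by simp
  qed (auto intro: L2_set_nonneg)
  finally show ?thesis
    by (simp add: mult.commute)
qed

text \<open>Truncating the series to a finite index set errs, uniformly on bounded sets, by the
  square root of the tail. Truncations map bounded sets into compact ones, so images of bounded sets
  are totally bounded.\<close>

lemma hilbert_schmidt_op_exists:
  fixes h b :: "'i \<Rightarrow> 'h::chilbert_space"
  assumes onb: "onb I h" and b: "(\<lambda>i. (norm (b i))\<^sup>2) summable_on I"
  shows "\<exists>B. compact_op B \<and> (\<forall>i\<in>I. B (h i) = b i)"
proof -
  have on: "onfam I h"
    by (rule onb_onfam[OF onb])
  have "(\<lambda>i. cinner x (h i) *\<^sub>C b i) summable_on I" for x
  proof (rule abs_summable_summable)
    have "(\<lambda>i. (cmod (cinner x (h i)))\<^sup>2 + (norm (b i))\<^sup>2) summable_on I"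
      by (intro summable_on_add bessel_summable[OF on] b)
    moreover have "norm (cinner x (h i) *\<^sub>C b i) \<le> (cmod (cinner x (h i)))\<^sup>2 + (norm (b i))\<^sup>2" for i
      using sum_squares_bound[of "cmod (cinner x (h i))" "norm (b i)"]
        mult_nonneg_nonneg[OF norm_ge_zero[of "cinner x (h i)"] norm_ge_zero[of "b i"]]
      unfolding norm_scaleC by linarith
    ultimately show "(\<lambda>i. norm (cinner x (h i) *\<^sub>C b i)) summable_on I"
      by (rule summable_on_comparison_test) auto
  qed
  then obtain B where B: "\<And>x. ((\<lambda>i. cinner x (h i) *\<^sub>C b i) has_sum B x) I"
    unfolding summable_on_def by metis
  have tail: "norm (B x - (\<Sum>i\<in>F. cinner x (h i) *\<^sub>C b i)) \<le> sqrt S * norm x"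
    if F: "finite F" "F \<subseteq> I" and S: "\<And>J. finite J \<Longrightarrow> J \<subseteq> I - F \<Longrightarrow> (\<Sum>i\<in>J. (norm (b i))\<^sup>2) \<le> S" for F S x
  proof -
    have "((\<lambda>i. cinner x (h i) *\<^sub>C b i) has_sum (B x - (\<Sum>i\<in>F. cinner x (h i) *\<^sub>C b i))) (I - F)"
      by (rule has_sum_Diff[OF B has_sum_finite[OF F(1)] F(2)])
    then have "((\<lambda>J. norm (\<Sum>i\<in>J. cinner x (h i) *\<^sub>C b i)) \<longlongrightarrow>
        norm (B x - (\<Sum>i\<in>F. cinner x (h i) *\<^sub>C b i))) (finite_subsets_at_top (I - F))"
      unfolding has_sum_def by (rule tendsto_norm)
    then show ?thesis
      by (rule tendsto_upperbound)
        (auto intro!: eventually_finite_subsets_at_top_weakI sum_scaleC_norm_le[OF on] S)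
  qed
  have bB: "bounded_op B"
  proof (rule bounded_opI)
    show "B (x + y) = B x + B y" for x y
      using has_sum_unique[OF B[of "x + y"]] has_sum_add[OF B[of x] B[of y]]
      by (simp add: cinner_add_left scaleC_add_left)
    show "B (c *\<^sub>C x) = c *\<^sub>C B x" for c x
      using has_sum_unique[OF B[of "c *\<^sub>C x"]]
        has_sum_bounded_linear[OF bounded_bilinear.bounded_linear_right[OF bounded_bilinear_scaleC] B[of x], of c]
      by (simp add: cinner_scaleC_left scaleC_scaleC)
    show "norm (B x) \<le> sqrt (\<Sum>\<^sub>\<infinity>i\<in>I. (norm (b i))\<^sup>2) * norm x" for x
      using tail[of "{}" "\<Sum>\<^sub>\<infinity>i\<in>I. (norm (b i))\<^sup>2" x] finite_sum_le_infsum[OF b] by simp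
  qed
  have "compact (closure (B ` S))" if "bounded S" for S
    unfolding compact_eq_totally_bounded
  proof (intro conjI allI impI)
    show "complete (closure (B ` S))"
      by (simp add: complete_eq_closed)
    fix \<epsilon> :: real assume \<epsilon>: "0 < \<epsilon>"
    obtain R where R: "0 < R" "\<And>x. x \<in> S \<Longrightarrow> norm x \<le> R"
      using \<open>bounded S\<close> unfolding bounded_pos by auto
    \<comment> \<open>The truncation error on the ball of radius \<open>R\<close> becomes
      \<open>sqrt \<delta> * R = \<epsilon> / 3\<close>; the finite net for \<open>C\<close> and the
      passage to the closure cost the other two thirds.\<close>
    define \<delta> where "\<delta> = (\<epsilon> / (3 * R))\<^sup>2"
    have \<delta>: "0 < \<delta>"
      using \<epsilon> R by (simp add: \<delta>_def)
    obtain F where F: "finite F" "F \<subseteq> I" "dist (\<Sum>i\<in>F. (norm (b i))\<^sup>2) (\<Sum>\<^sub>\<infinity>i\<in>I. (norm (b i))\<^sup>2) \<le> \<delta>"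
      using infsum_finite_approximation[OF b \<delta>] by blast
    have S: "(\<Sum>i\<in>J. (norm (b i))\<^sup>2) \<le> \<delta>" if "finite J" "J \<subseteq> I - F" for J
    proof -
      have "(\<Sum>i\<in>J. (norm (b i))\<^sup>2) + (\<Sum>i\<in>F. (norm (b i))\<^sup>2) = (\<Sum>i\<in>J \<union> F. (norm (b i))\<^sup>2)"
        using that F by (intro sum.union_disjoint[symmetric]) auto
      also have "\<dots> \<le> (\<Sum>\<^sub>\<infinity>i\<in>I. (norm (b i))\<^sup>2)"
        using that F by (intro finite_sum_le_infsum[OF b]) auto
      finally show ?thesis
        using F(3) unfolding dist_real_def by linarith
    qed
    have sq: "sqrt \<delta> * R = \<epsilon> / 3"
      using \<epsilon> R by (simp add: \<delta>_def)
    have \<epsilon>3: "0 < \<epsilon> / 3"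
      using \<epsilon> by simp
    define C where "C = {\<Sum>i\<in>F. c i *\<^sub>C b i |c. \<forall>i\<in>F. cmod (c i) \<le> R}"
    have "compact C"
      unfolding C_def by (rule compact_bounded_combinations[OF F(1)])
    from compact_eq_totally_bounded[THEN iffD1, THEN conjunct2, rule_format, OF this \<epsilon>3]
    obtain k where k: "finite k" "C \<subseteq> (\<Union>x\<in>k. ball x (\<epsilon> / 3))"
      by (elim exE conjE)
    have "closure (B ` S) \<subseteq> (\<Union>x\<in>k. ball x \<epsilon>)"
    proof
      fix y assume "y \<in> closure (B ` S)"
      then obtain x where x: "x \<in> S" "dist (B x) y < \<epsilon> / 3"
        using closure_approachable[THEN iffD1, rule_format, OF _ \<epsilon>3] by blast
      let ?z = "\<Sum>i\<in>F. cinner x (h i) *\<^sub>C b i"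
      have "cmod (cinner x (h i)) \<le> R" if "i \<in> F" for i
        using cinner_Cauchy_Schwarz[of x "h i"] onfam_norm[OF on, of i] F(2) that R(2)[OF x(1)] by force
      then have "?z \<in> C"
        unfolding C_def by (intro CollectI exI[of _ "\<lambda>i. cinner x (h i)"]) simp
      then obtain w where w: "w \<in> k" "dist w ?z < \<epsilon> / 3"
        using k(2) by (meson UN_E mem_ball subsetD)
      have "norm (B x - ?z) \<le> sqrt \<delta> * norm x"
        by (rule tail[OF F(1,2) S])
      also have "\<dots> \<le> sqrt \<delta> * R"
        using R(2)[OF x(1)] \<delta> by (intro mult_left_mono) auto
      finally have "dist ?z (B x) \<le> \<epsilon> / 3"
        by (simp add: sq dist_norm norm_minus_commute)
      then have "dist w y < \<epsilon>"
        using w(2) x(2) dist_triangle[of w y ?z] dist_triangle[of ?z y "B x"] by linarith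
      then show "y \<in> (\<Union>x\<in>k. ball x \<epsilon>)"
        using w(1) by auto
    qed
    then show "\<exists>k. finite k \<and> closure (B ` S) \<subseteq> (\<Union>x\<in>k. ball x \<epsilon>)"
      using k(1) by blast
  qed
  then have "compact_op B"
    using bB by (simp add: compact_op_def)
  moreover have "B (h j) = b j" if "j \<in> I" for j
  proof -
    have "((\<lambda>i. cinner (h j) (h i) *\<^sub>C b i) has_sum cinner (h j) (h j) *\<^sub>C b j) I"
      by (rule has_sum_single) (use on that in \<open>auto simp: onfam_def\<close>)
    then show ?thesis
      using has_sum_unique[OF B[of "h j"]] on that by (simp add: onfam_def scaleC_one)
  qed
  ultimately show ?thesis
    by blast
qed

section \<open>The ideal L(1,infinity) and the zeta measures\<close>

text \<open>\<open>C\<close> is the value of \<open>norm_L1inf\<close>, the same for all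
  \<open>p\<close>; the growth of \<open>p / (p - 1)\<close> as \<open>p\<close> tends to 1 is what
  the factor \<open>s - 1\<close> in the zeta seminorm compensates.\<close>

lemma L1inf_powr_summable:
  fixes h :: "'i \<Rightarrow> 'h::chilbert_space" and B :: "'h \<Rightarrow> 'h"
  assumes onb: "onb I h" and B: "B \<in> L1inf"
    and K: "\<And>i. i \<in> I \<Longrightarrow> cadjoint B (B (h i)) = (q i)\<^sup>2 *\<^sub>R h i" and q: "\<And>i. i \<in> I \<Longrightarrow> 0 \<le> q i"
  shows "\<exists>C\<ge>0. \<forall>p>1. (\<Sum>\<^sub>\<infinity>i\<in>I. ennreal (q i powr p)) \<le> ennreal (C powr p * (p / (p - 1)))"
proof -
  have cB: "compact_op B" and fin: "norm_L1inf B < \<infinity>"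
    using B by (auto simp: L1inf_def)
  have dec: "decseq (singular_values B)"
    by (rule singular_values_props[OF onb cB K q])
  have nonneg: "0 \<le> singular_values B n" for n
    by (rule singular_values_props[OF onb cB K q])
  have sv_sum: "(\<Sum>\<^sub>\<infinity>n. ennreal (singular_values B n powr p)) = (\<Sum>\<^sub>\<infinity>i\<in>I. ennreal (q i powr p))" for p
    using singular_values_props(3)[OF onb cB K q, of "\<lambda>l. ennreal (l powr p)"] by simp
  define C where "C = enn2real (norm_L1inf B)"
  have C: "0 \<le> C" "norm_L1inf B = ennreal C"
    using fin by (auto simp: C_def less_top)
  have "(\<Sum>n<k. singular_values B n) \<le> C * ln (1 + real k)" if "1 \<le> k" for k
  proof -
    have "ennreal ((\<Sum>n<k. singular_values B n) / ln (1 + real k)) \<le> ennreal C"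
      unfolding C(2)[symmetric] norm_L1inf_def by (rule SUP_upper) (use that in auto)
    then have "(\<Sum>n<k. singular_values B n) / ln (1 + real k) \<le> C"
      using C(1) by (simp add: ennreal_le_iff)
    then show ?thesis
      using that by (simp add: pos_divide_le_eq)
  qed
  note le = log_sum_imp_powr_sum[OF dec nonneg C(1) this]
  have "(\<Sum>\<^sub>\<infinity>i\<in>I. ennreal (q i powr p)) \<le> ennreal (C powr p * (p / (p - 1)))" if p: "1 < p" for p
  proof -
    have "(\<Sum>\<^sub>\<infinity>n. ennreal (singular_values B n powr p)) \<le> ennreal (C powr p * (p / (p - 1)))"
    proof (subst infsum_ennreal_le_iff)
      show "\<forall>F. finite F \<longrightarrow> F \<subseteq> UNIV \<longrightarrow> (\<Sum>n\<in>F. singular_values B n powr p) \<le> C powr p * (p / (p - 1))"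
      proof (intro allI impI)
        fix F :: "nat set" assume "finite F"
        then obtain k where "F \<subseteq> {..<k}"
          using finite_nat_iff_bounded by blast
        then have "(\<Sum>n\<in>F. singular_values B n powr p) \<le> (\<Sum>n<k. singular_values B n powr p)"
          by (intro sum_mono2) auto
        then show "(\<Sum>n\<in>F. singular_values B n powr p) \<le> C powr p * (p / (p - 1))"
          using le[OF _ p, of k] by linarith
      qed
    qed (use p in auto)
    then show ?thesis
      by (simp only: sv_sum)
  qed
  then show ?thesis
    using C(1) by blast
qed

lemma L1inf_I:
  fixes h :: "'i \<Rightarrow> 'h::chilbert_space" and B :: "'h \<Rightarrow> 'h"
  assumes onb: "onb I h" and B: "compact_op B"
    and K: "\<And>i. i \<in> I \<Longrightarrow> cadjoint B (B (h i)) = (q i)\<^sup>2 *\<^sub>R h i" and q: "\<And>i. i \<in> I \<Longrightarrow> 0 \<le> q i"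
    and c: "0 < c"
    and le: "\<And>p F. 1 < p \<Longrightarrow> p < 2 \<Longrightarrow> finite F \<Longrightarrow> F \<subseteq> I \<Longrightarrow> (\<Sum>i\<in>F. q i powr p) \<le> (c / (p - 1)) powr p"
  shows "B \<in> L1inf"
proof -
  have nonneg: "0 \<le> singular_values B n" for n
    by (rule singular_values_props[OF onb B K q])
  have "(\<Sum>n<k. singular_values B n powr p) \<le> (c / (p - 1)) powr p" if p: "1 < p" "p < 2" for p k
  proof -
    have "(\<Sum>\<^sub>\<infinity>n. ennreal (singular_values B n powr p)) = (\<Sum>\<^sub>\<infinity>i\<in>I. ennreal (q i powr p))"
      using singular_values_props(3)[OF onb B K q, of "\<lambda>l. ennreal (l powr p)"] by simp
    also have "\<dots> \<le> ennreal ((c / (p - 1)) powr p)"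
      by (subst infsum_ennreal_le_iff) (use le[OF p] in auto)
    finally show ?thesis
      by (subst (asm) infsum_ennreal_le_iff) auto
  qed
  note bd = powr_sum_imp_log_sum[OF nonneg c this]
  have "norm_L1inf B \<le> ennreal (2 * exp 1 * c)"
    unfolding norm_L1inf_def
  proof (rule SUP_least)
    fix k :: nat assume "k \<in> {1..}"
    then have k: "1 \<le> k"
      by simp
    then have "0 < ln (1 + real k)"
      by simp
    then show "ennreal ((\<Sum>n<k. singular_values B n) / ln (1 + real k)) \<le> ennreal (2 * exp 1 * c)"
      using bd[OF _ _ k] by (intro ennreal_leI) (simp add: pos_divide_le_eq del: ln_gt_zero_iff)
  qed
  then show ?thesis
    using B by (auto simp: L1inf_def intro: le_less_trans)
qed

lemma norm_Z1_eq:
  fixes h :: "'i \<Rightarrow> 'h::chilbert_space" and B :: "'h \<Rightarrow> 'h"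
  assumes onb: "onb I h" and B: "bounded_op B"
    and K: "\<And>i. i \<in> I \<Longrightarrow> cadjoint B (B (h i)) = (q i)\<^sup>2 *\<^sub>R h i" and q: "\<And>i. i \<in> I \<Longrightarrow> 0 \<le> q i"
  shows "norm_Z1 B = Limsup (at_right 1) (\<lambda>s. ennreal (s - 1) * epowr (\<Sum>\<^sub>\<infinity>i\<in>I. ennreal (q i powr s)) (1 / s))"
  unfolding norm_Z1_def
proof (rule Limsup_eq)
  have "\<forall>\<^sub>F s::real in at_right 1. 1 < s"
    by (rule eventually_at_right_less)
  then show "\<forall>\<^sub>F s in at_right 1. ennreal (s - 1) * epowr (trace_pos (fun_calc (op_graph (abs_op B)) (\<lambda>l. l powr s))) (1 / s)
      = ennreal (s - 1) * epowr (\<Sum>\<^sub>\<infinity>i\<in>I. ennreal (q i powr s)) (1 / s)"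
    by eventually_elim (simp add: trace_abs_op_powr[OF onb B K q])
qed

lemma epowr_le:
  assumes "X \<le> ennreal (r powr s)" "0 \<le> r" "0 < s"
  shows "epowr X (1 / s) \<le> ennreal r"
proof -
  have X: "X < \<infinity>"
    using assms(1) by (simp add: le_less_trans)
  have "enn2real X \<le> r powr s"
    using assms(1) by (simp add: enn2real_leI)
  then have "enn2real X powr (1 / s) \<le> (r powr s) powr (1 / s)"
    using assms(3) by (intro powr_mono2) auto
  also have "\<dots> = r"
    using assms by (simp add: powr_powr)
  finally show ?thesis
    using X by (auto simp: epowr_def ennreal_leI)
qed

lemma le_if_mult_epowr_less:
  assumes "ennreal a * epowr X (1 / s) < ennreal c" "0 < a" "0 < s"
  shows "X \<le> ennreal ((c / a) powr s)"
proof -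
  have X: "X \<noteq> \<infinity>"
    using assms by (auto simp: epowr_def ennreal_mult_top)
  have "ennreal (a * enn2real X powr (1 / s)) < ennreal c"
    using assms(1,2) X by (simp add: epowr_def ennreal_mult)
  then have "a * enn2real X powr (1 / s) < c"
    using assms(2) by (simp add: ennreal_less_iff)
  then have "enn2real X powr (1 / s) \<le> c / a"
    using assms(2) by (simp add: field_simps)
  then have "(enn2real X powr (1 / s)) powr s \<le> (c / a) powr s"
    using assms(3) by (intro powr_mono2) auto
  then have "enn2real X \<le> (c / a) powr s"
    using assms(3) by (simp add: powr_powr)
  then show ?thesis
    using X by (metis ennreal_enn2real_if ennreal_leI infinity_ennreal_def)
qed

text \<open>The exact power of \<open>1 / (s - 1)\<close> is \<open>3/2 - s/2\<close>, below 1
  because \<open>s > 1\<close>; since \<open>s - 1 < 1\<close>, replacing it by 1 only enlarges the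
  bound.\<close>

lemma zeta_exponents_le:
  fixes s N c :: real
  assumes "1 < s" "s < 2" "0 < N" "0 < c"
  shows "(N\<^sup>2 / (s - 1)) powr (1/2) * ((c / (s - 1)) powr s) powr (1/s - 1/2)
    \<le> N * c powr (1 - s/2) / (s - 1)"
proof -
  have "(N\<^sup>2 / (s - 1)) powr (1/2) = N / (s - 1) powr (1/2)"
    using assms by (simp add: powr_divide powr_half_sqrt)
  moreover have "((c / (s - 1)) powr s) powr (1/s - 1/2) = c powr (1 - s/2) / (s - 1) powr (1 - s/2)"
  proof -
    have "s * (1/s - 1/2) = 1 - s/2"
      using assms by (simp add: field_simps)
    then show ?thesis
      using assms by (simp add: powr_powr powr_divide)
  qed
  moreover have "1 / ((s - 1) powr (1/2) * (s - 1) powr (1 - s/2)) \<le> 1 / (s - 1)"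
  proof -
    have "(s - 1) powr 1 \<le> (s - 1) powr (1/2 + (1 - s/2))"
      using assms by (intro powr_mono') auto
    then show ?thesis
      using assms by (intro divide_left_mono mult_pos_pos) (auto simp flip: powr_add)
  qed
  then have "N * c powr (1 - s/2) * (1 / ((s - 1) powr (1/2) * (s - 1) powr (1 - s/2)))
      \<le> N * c powr (1 - s/2) * (1 / (s - 1))"
    using assms by (intro mult_left_mono) auto
  ultimately show ?thesis
    by simp
qed

text \<open>The product is a preimage of \<open>T\<close> under a continuous map. With
  \<open>T\<close> a multiplication graph it is thus already closed, and the closure in
  \<open>bounded_closure\<close> adds nothing.\<close>

lemma closed_op_graph_comp:
  assumes "bounded_op P" "closed T"
  shows "closed (op_graph P O T)"
proof -
  have "op_graph P O T = (\<lambda>p. (P (fst p), snd p)) -` T"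
    by (auto simp: op_graph_def relcomp_unfold)
  moreover have "closed ((\<lambda>p. (P (fst p), snd p)) -` T)"
    by (intro closed_vimage assms(2) continuous_intros
        bounded_linear.continuous_on[OF bounded_op_linear[OF assms(1)]])
  ultimately show ?thesis
    by simp
qed

lemma bounded_closure_eqI:
  assumes "op_graph B = closure T"
  shows "bounded_closure T = B"
  unfolding bounded_closure_def
proof (rule the_equality[where P="\<lambda>B. op_graph B = closure T", OF assms])
  fix C assume "op_graph C = closure T"
  then have "op_graph C = op_graph B"
    using assms by simp
  then show "C = B"
    by (auto simp: op_graph_def set_eq_iff)
qed

text \<open>The bounds \<open>N'\<close> and \<open>c\<close> stay strictly above \<open>N\<close>
  and \<open>z\<close>: a limit superior yields eventual bounds only strictly above its value, and
  positivity is secured even if \<open>N\<close> or \<open>z\<close> is 0. As \<open>s\<close> tends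
  to 1 the exponent \<open>1 - s/2\<close> tends to \<open>1/2\<close>; then the slack tends to
  0.\<close>

lemma zeta_Limsup_le:
  fixes q :: "'i \<Rightarrow> real" and g :: "'j \<Rightarrow> real" and Z :: ennreal
  assumes N: "0 \<le> N"
    and Z: "Z = Limsup (at_right 1) (\<lambda>s. ennreal (s - 1) * epowr (\<Sum>\<^sub>\<infinity>j\<in>J. ennreal (g j powr s)) (1 / s))"
    and Zfin: "Z < \<infinity>"
    and le: "\<And>N' c s. N < N' \<Longrightarrow> 0 < c \<Longrightarrow> 1 < s \<Longrightarrow> s < 2 \<Longrightarrow>
      (\<Sum>\<^sub>\<infinity>j\<in>J. ennreal (g j powr s)) \<le> ennreal ((c / (s - 1)) powr s) \<Longrightarrow>
      (\<Sum>\<^sub>\<infinity>i\<in>E. ennreal (q i powr s)) \<le> ennreal ((N' * c powr (1 - s/2) / (s - 1)) powr s)"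
  shows "Limsup (at_right 1) (\<lambda>s. ennreal (s - 1) * epowr (\<Sum>\<^sub>\<infinity>i\<in>E. ennreal (q i powr s)) (1 / s))
    \<le> ennreal N * epowr Z (1 / 2)"
proof -
  let ?L = "Limsup (at_right 1) (\<lambda>s. ennreal (s - 1) * epowr (\<Sum>\<^sub>\<infinity>i\<in>E. ennreal (q i powr s)) (1 / s))"
  define z where "z = enn2real Z"
  have z: "0 \<le> z" "Z = ennreal z"
    using Zfin by (auto simp: z_def less_top)
  have bound: "?L \<le> ennreal (N' * sqrt c)" if N': "N < N'" and c: "z < c" for N' c
  proof -
    have c0: "0 < c"
      using z c by simp
    have ev: "\<forall>\<^sub>F s::real in at_right 1. s \<in> {1<..<2}"
      by (rule eventually_at_right_real) simp
    have "Z < ennreal c"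
      using z c by (simp add: ennreal_less_iff)
    then have "\<forall>\<^sub>F s in at_right 1. ennreal (s - 1) * epowr (\<Sum>\<^sub>\<infinity>j\<in>J. ennreal (g j powr s)) (1 / s) < ennreal c"
      unfolding Z by (rule Limsup_lessD)
    then have "\<forall>\<^sub>F s in at_right 1. ennreal (s - 1) * epowr (\<Sum>\<^sub>\<infinity>i\<in>E. ennreal (q i powr s)) (1 / s)
        \<le> ennreal (N' * c powr (1 - s/2))"
      using ev
    proof eventually_elim
      case (elim s)
      then have s: "1 < s" "s < 2"
        by auto
      let ?r = "N' * c powr (1 - s/2)"
      have r: "0 \<le> ?r"
        using N N' by simp
      have "(\<Sum>\<^sub>\<infinity>j\<in>J. ennreal (g j powr s)) \<le> ennreal ((c / (s - 1)) powr s)"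
        by (rule le_if_mult_epowr_less) (use elim s in auto)
      then have "epowr (\<Sum>\<^sub>\<infinity>i\<in>E. ennreal (q i powr s)) (1 / s) \<le> ennreal (?r / (s - 1))"
        using s r by (intro epowr_le le[OF N' c0 s]) auto
      then have "ennreal (s - 1) * epowr (\<Sum>\<^sub>\<infinity>i\<in>E. ennreal (q i powr s)) (1 / s) \<le> ennreal (s - 1) * ennreal (?r / (s - 1))"
        by (rule mult_left_mono) simp
      also have "\<dots> = ennreal ?r"
        using s r by (simp flip: ennreal_mult)
      finally show ?case .
    qed
    then have "?L \<le> Limsup (at_right 1) (\<lambda>s. ennreal (N' * c powr (1 - s/2)))"
      by (rule Limsup_mono)
    also have "\<dots> = ennreal (N' * sqrt c)"
    proof (rule lim_imp_Limsup)
      have "((\<lambda>s. c powr (1 - s/2)) \<longlongrightarrow> c powr (1 - 1/2)) (at_right 1)"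
        using c0 by (intro tendsto_intros) auto
      then have "((\<lambda>s. N' * c powr (1 - s/2)) \<longlongrightarrow> N' * c powr (1 - 1/2)) (at_right 1)"
        by (rule tendsto_mult[OF tendsto_const])
      then show "((\<lambda>s. ennreal (N' * c powr (1 - s/2))) \<longlongrightarrow> ennreal (N' * sqrt c)) (at_right 1)"
        using c0 by (intro tendsto_ennrealI) (simp add: powr_half_sqrt)
    qed simp
    finally show ?thesis .
  qed
  have "((\<lambda>d. (N + d) * sqrt (z + d)) \<longlongrightarrow> (N + 0) * sqrt (z + 0)) (at_right (0::real))"
    by (intro tendsto_intros)
  then have "((\<lambda>d. ennreal ((N + d) * sqrt (z + d))) \<longlongrightarrow> ennreal (N * sqrt z)) (at_right (0::real))"
    by (intro tendsto_ennrealI) simp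
  moreover have "\<forall>\<^sub>F d::real in at_right 0. ?L \<le> ennreal ((N + d) * sqrt (z + d))"
    using eventually_at_right_less[of 0] by eventually_elim (rule bound, auto)
  ultimately have "?L \<le> ennreal (N * sqrt z)"
    by (rule tendsto_lowerbound) simp
  also have "\<dots> = ennreal N * epowr Z (1 / 2)"
    using N z by (simp add: epowr_def powr_half_sqrt ennreal_mult)
  finally show ?thesis .
qed

section \<open>The product of a multiplication operator with a diagonal operator\<close>

context
  fixes U :: "'h::chilbert_space \<Rightarrow> 'f \<Rightarrow> complex" and M :: "'f measure" and f :: "'f \<Rightarrow> complex"
    and I :: "nat set" and h :: "nat \<Rightarrow> 'h" and lam :: "nat \<Rightarrow> real" and G :: "real \<Rightarrow> real" and GD :: "'h \<Rightarrow> 'h"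
  assumes U: "unitary_L2 U M" and f: "f \<in> borel_measurable M" and onb: "onb I h"
    and G: "\<And>x. 0 \<le> G x" and GD: "bounded_op GD" and GD_h: "\<And>m. m \<in> I \<Longrightarrow> GD (h m) = G (lam m) *\<^sub>R h m"
begin

lemma closed_mult_comp: "closed (op_graph GD O conj_mult_op U M f)"
  by (rule closed_op_graph_comp[OF GD closed_conj_mult_op[OF U f]])

lemma mem_mult_comp: "(x, y) \<in> op_graph GD O conj_mult_op U M f \<longleftrightarrow> (GD x, y) \<in> conj_mult_op U M f"
  by (auto simp: op_graph_def relcomp_unfold)

lemma L2_zeta_measure_if_L1inf:
  assumes "closure_in_L1inf (op_graph GD O conj_mult_op U M f)"
  shows "f \<in> Lp 2 (zeta_measure U M I h lam G 2)"
proof -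
  obtain B where B: "bounded_op B" "op_graph B = op_graph GD O conj_mult_op U M f"
    and L: "B \<in> L1inf"
    using assms bounded_closure_eqI closure_closed[OF closed_mult_comp] unfolding closure_in_L1inf_def by metis
  have cB: "compact_op B"
    using L by (simp add: L1inf_def)
  obtain E q where E: "onb E (\<lambda>x. x)" and q: "\<And>e. e \<in> E \<Longrightarrow> 0 \<le> q e"
    and K: "\<And>e. e \<in> E \<Longrightarrow> cadjoint B (B e) = (q e)\<^sup>2 *\<^sub>R e"
    using compact_op_spectral[OF onb cB] by blast
  note [measurable] = f unitary_L2_measurable[OF U]
  \<comment> \<open>Obtained by reading \<open>(GD (h m), B (h m))\<close> as a member of the
    multiplication graph. If \<open>G (lam m) = 0\<close>, both sides vanish even when the integral
    is infinite, because \<open>0 * \<infinity> = 0\<close> in \<open>ennreal\<close>.\<close>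
  have "ennreal (G (lam m) powr 2) * (\<integral>\<^sup>+t. ennreal ((cmod (f t * U (h m) t))\<^sup>2) \<partial>M) = ennreal ((norm (B (h m)))\<^sup>2)"
    if m: "m \<in> I" for m
  proof -
    have "(h m, B (h m)) \<in> op_graph B"
      by (simp add: op_graph_def)
    then have "(of_real (G (lam m)) *\<^sub>C h m, B (h m)) \<in> conj_mult_op U M f"
      unfolding B(2) mem_mult_comp GD_h[OF m] scaleR_scaleC .
    from conj_mult_op_norm[OF U this]
    have "ennreal ((norm (B (h m)))\<^sup>2) = (\<integral>\<^sup>+t. ennreal ((cmod (f t * U (of_real (G (lam m)) *\<^sub>C h m) t))\<^sup>2) \<partial>M)" .
    also have "\<dots> = (\<integral>\<^sup>+t. ennreal (G (lam m) powr 2) * ennreal ((cmod (f t * U (h m) t))\<^sup>2) \<partial>M)"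
    proof (rule nn_integral_cong_AE)
      have "AE t in M. U (of_real (G (lam m)) *\<^sub>C h m) t = of_real (G (lam m)) * U (h m) t"
        using U by (simp add: unitary_L2_def)
      then show "AE t in M. ennreal ((cmod (f t * U (of_real (G (lam m)) *\<^sub>C h m) t))\<^sup>2)
          = ennreal (G (lam m) powr 2) * ennreal ((cmod (f t * U (h m) t))\<^sup>2)"
        by eventually_elim (simp add: norm_mult power_mult_distrib G mult_ac flip: ennreal_mult)
    qed
    also have "\<dots> = ennreal (G (lam m) powr 2) * (\<integral>\<^sup>+t. ennreal ((cmod (f t * U (h m) t))\<^sup>2) \<partial>M)"
      by (rule nn_integral_cmult) measurable
    finally show ?thesis ..
  qed
  then have "(\<integral>\<^sup>+t. ennreal ((cmod (f t))\<^sup>2) \<partial>zeta_measure U M I h lam G 2) = (\<Sum>\<^sub>\<infinity>m\<in>I. ennreal ((norm (B (h m)))\<^sup>2))"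
    unfolding nn_integral_zeta_measure[OF U f] by (rule infsum_cong)
  also have "\<dots> = (\<Sum>\<^sub>\<infinity>e\<in>E. ennreal ((q e)\<^sup>2))"
    by (rule sum_norm_square_singular[OF onb E B(1) K])
  also have "\<dots> = (\<Sum>\<^sub>\<infinity>e\<in>E. ennreal (q e powr 2))"
    using q by (intro infsum_cong) simp
  also have "\<dots> < \<infinity>"
  proof -
    obtain C where "\<forall>p>1. (\<Sum>\<^sub>\<infinity>e\<in>E. ennreal (q e powr p)) \<le> ennreal (C powr p * (p / (p - 1)))"
      using L1inf_powr_summable[OF E L K q] by blast
    from this[rule_format, of 2] show ?thesis
      by (simp add: le_less_trans)
  qed
  finally show ?thesis
    using f by (simp add: Lp_2_iff zeta_measure_def)
qed

lemma nn_integral_zeta_measure_le: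
  assumes f: "f \<in> Lp_1inf 2 (zeta_measure U M I h lam G)"
    and N: "norm_1inf 2 (zeta_measure U M I h lam G) f = ennreal N" "0 \<le> N" and s: "1 < s" "s \<le> 2"
  shows "(\<integral>\<^sup>+t. ennreal ((cmod (f t))\<^sup>2) \<partial>zeta_measure U M I h lam G s) \<le> ennreal (N\<^sup>2 / (s - 1))"
proof -
  let ?A = "\<integral>\<^sup>+t. ennreal ((cmod (f t))\<^sup>2) \<partial>zeta_measure U M I h lam G s"
  \<comment> \<open>The exponent in \<open>norm_1inf\<close> is a quotient of extended reals, hence
    the detour.\<close>
  have half: "enn2real (1 / 2) = 1 / 2"
    by (metis enn2real_ennreal divide_ennreal ennreal_1 ennreal_numeral zero_le_one zero_le_numeral zero_less_numeral zero_le_divide_1_iff)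
  have "?A < \<infinity>"
    using f s by (auto simp: Lp_1inf_def Lp_2_iff)
  then obtain a where a: "?A = ennreal a" "0 \<le> a"
    by (metis ennreal_cases infinity_ennreal_def less_irrefl)
  have "ennreal ((s - 1) powr enn2real (1 / 2)) * Lp_norm 2 (zeta_measure U M I h lam G s) f \<le> ennreal N"
    unfolding N(1)[symmetric] norm_1inf_def by (rule SUP_upper) (use s in auto)
  then have "ennreal (sqrt (s - 1) * sqrt a) \<le> ennreal N"
    using s a by (simp add: Lp_norm_2 half epowr_def powr_half_sqrt ennreal_mult)
  then have "sqrt (s - 1) * sqrt a \<le> N"
    using N(2) by (simp add: ennreal_le_iff)
  then have "(sqrt (s - 1) * sqrt a)\<^sup>2 \<le> N\<^sup>2"
    using s a by (intro power_mono) auto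
  then have "a \<le> N\<^sup>2 / (s - 1)"
    using s a by (simp add: power_mult_distrib field_simps)
  then show ?thesis
    unfolding a(1) by (rule ennreal_leI)
qed

text \<open>Basis vectors with \<open>G (lam m) = 0\<close> may lie outside the domain of
  multiplication, so \<open>t m\<close> is set to 0 there; for the others the estimate at
  \<open>s = 2\<close> gives membership. The same estimate makes the vectors
  \<open>G (lam m) *\<^sub>R t m\<close> square summable, so they define a Hilbert-Schmidt
  operator.\<close>

lemma mult_comp_hilbert_schmidt:
  assumes fL: "f \<in> Lp_1inf 2 (zeta_measure U M I h lam G)"
    and N: "norm_1inf 2 (zeta_measure U M I h lam G) f = ennreal N" "0 \<le> N"
  obtains B t where "compact_op B" "op_graph B = op_graph GD O conj_mult_op U M f"
    "\<And>m. m \<in> I \<Longrightarrow> B (h m) = G (lam m) *\<^sub>R t m"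
    "\<And>s J. 1 < s \<Longrightarrow> s \<le> 2 \<Longrightarrow> finite J \<Longrightarrow> J \<subseteq> I \<Longrightarrow>
      (\<Sum>m\<in>J. G (lam m) powr s * (norm (t m))\<^sup>2) \<le> N\<^sup>2 / (s - 1)"
proof -
  let ?T = "conj_mult_op U M f"
  let ?A = "\<lambda>m. \<integral>\<^sup>+t. ennreal ((cmod (f t * U (h m) t))\<^sup>2) \<partial>M"
  have sum_le: "(\<Sum>\<^sub>\<infinity>m\<in>I. ennreal (G (lam m) powr s) * ?A m) \<le> ennreal (N\<^sup>2 / (s - 1))" if "1 < s" "s \<le> 2" for s
    unfolding nn_integral_zeta_measure[OF U f, symmetric] by (rule nn_integral_zeta_measure_le[OF fL N that])
  have "\<exists>y. (h m, y) \<in> ?T" if m: "m \<in> I" "0 < G (lam m)" for m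
  proof (rule conj_mult_op_exists[OF U f])
    have "ennreal (G (lam m) powr 2) * ?A m \<le> (\<Sum>\<^sub>\<infinity>m\<in>I. ennreal (G (lam m) powr 2) * ?A m)"
      using infsum_mono_set_ennreal[of "{m}" I "\<lambda>m. ennreal (G (lam m) powr 2) * ?A m"] m
      by (simp del: powr_numeral)
    also have "\<dots> < \<infinity>"
      using sum_le[of 2] by (simp add: le_less_trans)
    finally show "?A m < \<infinity>"
      using m by (auto simp: ennreal_mult_less_top)
  qed
  then obtain t0 where t0: "\<And>m. m \<in> I \<Longrightarrow> 0 < G (lam m) \<Longrightarrow> (h m, t0 m) \<in> ?T"
    by metis
  define t where "t m = (if 0 < G (lam m) then t0 m else 0)" for m
  have t: "(GD (h m), G (lam m) *\<^sub>R t m) \<in> ?T" if m: "m \<in> I" for m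
  proof (cases "0 < G (lam m)")
    case True
    then show ?thesis
      using conj_mult_op_scaleC[OF U t0[OF m], of "of_real (G (lam m))"] by (simp add: GD_h[OF m] t_def scaleR_scaleC)
  next
    case False
    then have "G (lam m) = 0"
      using G[of "lam m"] by simp
    then show ?thesis
      by (simp add: GD_h[OF m] conj_mult_op_zero[OF U])
  qed
  have t_sum: "(\<Sum>m\<in>J. G (lam m) powr s * (norm (t m))\<^sup>2) \<le> N\<^sup>2 / (s - 1)"
    if s: "1 < s" "s \<le> 2" and J: "finite J" "J \<subseteq> I" for s J
  proof -
    have "ennreal (G (lam m) powr s * (norm (t m))\<^sup>2) = ennreal (G (lam m) powr s) * ?A m" if m: "m \<in> I" for m
    proof (cases "0 < G (lam m)")
      case True
      then show ?thesis
        using conj_mult_op_norm[OF U t0[OF m True]] by (simp add: t_def ennreal_mult)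
    next
      case False
      then have "G (lam m) = 0"
        using G[of "lam m"] by simp
      then show ?thesis
        by simp
    qed
    then have "(\<Sum>\<^sub>\<infinity>m\<in>I. ennreal (G (lam m) powr s * (norm (t m))\<^sup>2)) \<le> ennreal (N\<^sup>2 / (s - 1))"
      using sum_le[OF s] by (simp cong: infsum_cong)
    then show ?thesis
      using s J by (subst (asm) infsum_ennreal_le_iff) auto
  qed
  have "(\<lambda>m. (norm (G (lam m) *\<^sub>R t m))\<^sup>2) summable_on I"
  proof (rule nonneg_bdd_above_summable_on)
    show "bdd_above (sum (\<lambda>m. (norm (G (lam m) *\<^sub>R t m))\<^sup>2) ` {F. F \<subseteq> I \<and> finite F})"
    proof (rule bdd_aboveI)
      fix x assume "x \<in> sum (\<lambda>m. (norm (G (lam m) *\<^sub>R t m))\<^sup>2) ` {F. F \<subseteq> I \<and> finite F}"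
      then obtain J where J: "finite J" "J \<subseteq> I" "x = (\<Sum>m\<in>J. (norm (G (lam m) *\<^sub>R t m))\<^sup>2)"
        by auto
      then show "x \<le> N\<^sup>2"
        using t_sum[of 2 J] G by (simp add: power_mult_distrib)
    qed
  qed simp
  from hilbert_schmidt_op_exists[OF onb this]
  obtain B where B: "compact_op B" "\<And>m. m \<in> I \<Longrightarrow> B (h m) = G (lam m) *\<^sub>R t m"
    by blast
  \<comment> \<open>This holds for finite combinations of basis vectors, hence for all
    \<open>x\<close> because the graph of multiplication is closed; uniqueness of values then
    identifies the two graphs.\<close>
  have BT: "(GD x, B x) \<in> ?T" for x
  proof -
    let ?P = "\<lambda>J. (\<Sum>m\<in>J. cinner x (h m) *\<^sub>C GD (h m), \<Sum>m\<in>J. cinner x (h m) *\<^sub>C B (h m))"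
    have "(?P \<longlongrightarrow> (GD x, B x)) (finite_subsets_at_top I)"
      using bounded_op_has_sum[OF onb GD, of x] bounded_op_has_sum[OF onb compact_op_bounded[OF B(1)], of x]
      unfolding has_sum_def by (rule tendsto_Pair)
    moreover have "\<forall>\<^sub>F J in finite_subsets_at_top I. ?P J \<in> ?T"
    proof (rule eventually_finite_subsets_at_top_weakI)
      fix J assume "finite J" "J \<subseteq> I"
      then show "?P J \<in> ?T"
        by (intro conj_mult_op_sum[OF U] conj_mult_op_scaleC[OF U]) (use t B(2) in auto)
    qed
    ultimately show ?thesis
      using Lim_in_closed_set[OF closed_conj_mult_op[OF U f]] by (metis finite_subsets_at_top_neq_bot)
  qed
  have "op_graph B = op_graph GD O ?T"
  proof (intro set_eqI)
    fix p
    show "p \<in> op_graph B \<longleftrightarrow> p \<in> op_graph GD O ?T"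
      using mem_mult_comp[of "fst p" "snd p"] BT[of "fst p"] conj_mult_op_unique[OF U BT[of "fst p"], of "snd p"]
      by (cases p) (auto simp: op_graph_def)
  qed
  then show thesis
    by (rule that[OF B(1) _ B(2) t_sum])
qed

lemma mult_comp_L1inf:
  assumes GDL: "GD \<in> L1inf" and fL: "f \<in> Lp_1inf 2 (zeta_measure U M I h lam G)"
  shows "closure_in_L1inf (op_graph GD O conj_mult_op U M f)"
    and "norm_Z1 (bounded_closure (op_graph GD O conj_mult_op U M f))
      \<le> norm_1inf 2 (zeta_measure U M I h lam G) f * epowr (norm_Z1 GD) (1 / 2)"
proof -
  let ?R = "op_graph GD O conj_mult_op U M f"
  define N where "N = enn2real (norm_1inf 2 (zeta_measure U M I h lam G) f)"
  have N: "norm_1inf 2 (zeta_measure U M I h lam G) f = ennreal N" "0 \<le> N"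
    using fL by (auto simp: N_def Lp_1inf_def less_top)
  obtain B t where B: "compact_op B" "op_graph B = ?R"
    and t: "\<And>m. m \<in> I \<Longrightarrow> B (h m) = G (lam m) *\<^sub>R t m"
    and t_sum: "\<And>s J. 1 < s \<Longrightarrow> s \<le> 2 \<Longrightarrow> finite J \<Longrightarrow> J \<subseteq> I \<Longrightarrow>
      (\<Sum>m\<in>J. G (lam m) powr s * (norm (t m))\<^sup>2) \<le> N\<^sup>2 / (s - 1)"
    using mult_comp_hilbert_schmidt[OF fL N] by blast
  have bB: "bounded_op B"
    by (rule compact_op_bounded[OF B(1)])
  have closure: "op_graph B = closure ?R"
    using B(2) closure_closed[OF closed_mult_comp] by simp
  have bc: "bounded_closure ?R = B"
    by (rule bounded_closure_eqI[OF closure])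
  obtain E q where E: "onb E (\<lambda>x. x)" and q: "\<And>e. e \<in> E \<Longrightarrow> 0 \<le> q e"
    and K: "\<And>e. e \<in> E \<Longrightarrow> cadjoint B (B e) = (q e)\<^sup>2 *\<^sub>R e"
    using compact_op_spectral[OF onb B(1)] by blast
  have KG: "cadjoint GD (GD (h m)) = (G (lam m))\<^sup>2 *\<^sub>R h m" if m: "m \<in> I" for m
    using diag_cadjoint[OF onb GD GD_h m] bounded_op_scaleR[OF bounded_op_cadjoint[OF onb GD]]
    by (simp add: GD_h[OF m] power2_eq_square)
  obtain C where C: "0 \<le> C"
    "\<And>p. 1 < p \<Longrightarrow> (\<Sum>\<^sub>\<infinity>m\<in>I. ennreal (G (lam m) powr p)) \<le> ennreal (C powr p * (p / (p - 1)))"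
    using L1inf_powr_summable[OF onb GDL KG G] by blast
  \<comment> \<open>The factor 2 absorbs \<open>s\<close>, since
    \<open>s \<le> 2 \<le> 2 powr s\<close> for \<open>1 < s < 2\<close>; the added 1 gives
    \<open>1 \<le> k\<close>, used to compare powers of \<open>k\<close>.\<close>
  define k where "k = 2 * C + 1"
  have k: "1 \<le> k"
    using C(1) by (simp add: k_def)
  have Gk: "(\<Sum>\<^sub>\<infinity>m\<in>I. ennreal (G (lam m) powr s)) \<le> ennreal ((k / (s - 1)) powr s)" if s: "1 < s" "s < 2" for s
  proof -
    have "C powr s * (s / (s - 1)) \<le> C powr s * (2 / (s - 1))"
      using s by (intro mult_left_mono divide_right_mono) auto
    also have "\<dots> \<le> k powr s * (1 / (s - 1))"
    proof -
      have "C powr s * 2 \<le> C powr s * 2 powr s"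
        using s powr_mono[of 1 s 2] by (intro mult_left_mono) auto
      also have "\<dots> \<le> k powr s"
        using s C(1) by (auto simp: k_def mult.commute simp flip: powr_mult intro!: powr_mono2)
      finally show ?thesis
        using s by (simp add: divide_right_mono)
    qed
    also have "\<dots> \<le> k powr s * (1 / (s - 1)) powr s"
      using s powr_mono[of 1 s "1 / (s - 1)"] by (intro mult_left_mono) auto
    also have "\<dots> = (k / (s - 1)) powr s"
      using s k by (simp add: powr_divide)
    finally show ?thesis
      using C(2)[OF s(1)] by (meson ennreal_leI order_trans)
  qed
  \<comment> \<open>Uniform in \<open>N'\<close> and \<open>c\<close>: membership in the ideal uses
    a crude pair, the seminorm estimate uses pairs close to the optimal one.\<close>
  have key: "(\<Sum>e\<in>F. q e powr s) \<le> (N' * c powr (1 - s/2) / (s - 1)) powr s"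
    if N': "N < N'" and c: "0 < c" and s: "1 < s" "s < 2"
      and Gc: "(\<Sum>\<^sub>\<infinity>m\<in>I. ennreal (G (lam m) powr s)) \<le> ennreal ((c / (s - 1)) powr s)"
      and F: "finite F" "F \<subseteq> E" for N' c s :: real and F
  proof -
    have N'0: "0 < N'"
      using N(2) N' by simp
    have "(\<Sum>e\<in>F. q e powr s) \<le> ((N'\<^sup>2 / (s - 1)) powr (1/2) * ((c / (s - 1)) powr s) powr (1/s - 1/2)) powr s"
    proof (rule schatten_Hoelder[OF onb E bB K q G t s])
      fix J assume J: "finite J" "J \<subseteq> I"
      have "(\<Sum>m\<in>J. G (lam m) powr s * (norm (t m))\<^sup>2) \<le> N\<^sup>2 / (s - 1)"
        using t_sum s J by simp
      also have "\<dots> \<le> N'\<^sup>2 / (s - 1)"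
        using N' N(2) s by (intro divide_right_mono power_mono) auto
      finally show "(\<Sum>m\<in>J. G (lam m) powr s * (norm (t m))\<^sup>2) \<le> N'\<^sup>2 / (s - 1)" .
      show "(\<Sum>m\<in>J. G (lam m) powr s) \<le> (c / (s - 1)) powr s"
        using Gc J by (subst (asm) infsum_ennreal_le_iff) auto
    qed (use N'0 c s F in auto)
    also have "\<dots> \<le> (N' * c powr (1 - s/2) / (s - 1)) powr s"
      by (intro powr_mono2 zeta_exponents_le s N'0 c) (use s in auto)
    finally show ?thesis .
  qed
  have "B \<in> L1inf"
  proof (rule L1inf_I[OF E B(1) K q])
    \<comment> \<open>The crude pair is \<open>N' = N + 1\<close> and \<open>c = k\<close>;
      \<open>k powr (1 - s/2) \<le> k\<close> makes the constant independent of
      \<open>s\<close>.\<close>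
    show "0 < (N + 1) * k"
      using N(2) k by simp
    fix s :: real and F assume s: "1 < s" "s < 2" and F: "finite F" "F \<subseteq> E"
    have "(\<Sum>e\<in>F. q e powr s) \<le> ((N + 1) * k powr (1 - s/2) / (s - 1)) powr s"
      by (rule key[OF _ _ s Gk[OF s] F]) (use k in auto)
    also have "\<dots> \<le> ((N + 1) * k / (s - 1)) powr s"
    proof (rule powr_mono2)
      have "k powr (1 - s/2) \<le> k powr 1"
        using s k by (intro powr_mono) auto
      then show "(N + 1) * k powr (1 - s/2) / (s - 1) \<le> (N + 1) * k / (s - 1)"
        using N(2) s k by (simp add: divide_right_mono mult_left_mono)
    qed (use s N(2) in auto)
    finally show "(\<Sum>e\<in>F. q e powr s) \<le> ((N + 1) * k / (s - 1)) powr s" .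
  qed
  moreover have "Domain ?R = UNIV"
    unfolding B(2)[symmetric] by (auto simp: op_graph_def)
  ultimately show "closure_in_L1inf ?R"
    using bB closure bc by (auto simp: closure_in_L1inf_def)
  have Z_GD: "norm_Z1 GD = Limsup (at_right 1)
      (\<lambda>s. ennreal (s - 1) * epowr (\<Sum>\<^sub>\<infinity>m\<in>I. ennreal (G (lam m) powr s)) (1 / s))"
    by (rule norm_Z1_eq[OF onb GD KG G])
  have Z_B: "norm_Z1 B = Limsup (at_right 1)
      (\<lambda>s. ennreal (s - 1) * epowr (\<Sum>\<^sub>\<infinity>e\<in>E. ennreal (q e powr s)) (1 / s))"
    by (rule norm_Z1_eq[OF E bB K q])
  have "norm_Z1 GD \<le> ennreal k"
    unfolding Z_GD
  proof (rule Limsup_bounded)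
    have "\<forall>\<^sub>F s::real in at_right 1. s \<in> {1<..<2}"
      by (rule eventually_at_right_real) simp
    then show "\<forall>\<^sub>F s in at_right 1. ennreal (s - 1) * epowr (\<Sum>\<^sub>\<infinity>m\<in>I. ennreal (G (lam m) powr s)) (1 / s) \<le> ennreal k"
    proof eventually_elim
      case (elim s)
      then have "epowr (\<Sum>\<^sub>\<infinity>m\<in>I. ennreal (G (lam m) powr s)) (1 / s) \<le> ennreal (k / (s - 1))"
        using k by (intro epowr_le Gk) auto
      then have "ennreal (s - 1) * epowr (\<Sum>\<^sub>\<infinity>m\<in>I. ennreal (G (lam m) powr s)) (1 / s) \<le> ennreal (s - 1) * ennreal (k / (s - 1))"
        by (rule mult_left_mono) simp
      also have "\<dots> = ennreal k"
        using elim k by (simp flip: ennreal_mult)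
      finally show ?case .
    qed
  qed
  then have Z: "norm_Z1 GD < \<infinity>"
    by (simp add: le_less_trans)
  show "norm_Z1 (bounded_closure ?R) \<le> norm_1inf 2 (zeta_measure U M I h lam G) f * epowr (norm_Z1 GD) (1 / 2)"
    unfolding bc N(1) Z_B
  proof (rule zeta_Limsup_le[OF N(2) Z_GD Z])
    fix N' c s :: real
    assume *: "N < N'" "0 < c" "1 < s" "s < 2"
      "(\<Sum>\<^sub>\<infinity>m\<in>I. ennreal (G (lam m) powr s)) \<le> ennreal ((c / (s - 1)) powr s)"
    show "(\<Sum>\<^sub>\<infinity>e\<in>E. ennreal (q e powr s))
        \<le> ennreal ((N' * c powr (1 - s/2) / (s - 1)) powr s)"
      by (subst infsum_ennreal_le_iff) (use key[OF *] in auto)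
  qed
qed

end

theorem corollary4p5:
  fixes D :: "('h::chilbert_space \<times> 'h) set"
    and G :: "real \<Rightarrow> real"
    and A :: "'n::finite \<Rightarrow> 'h \<Rightarrow> 'h"
    and U :: "'h \<Rightarrow> 'f::topological_space \<Rightarrow> complex"
    and M :: "'f measure"
    and e :: "'f \<Rightarrow> real ^ 'n"
    and I :: "nat set" and h :: "nat \<Rightarrow> 'h" and lam :: "nat \<Rightarrow> real"
    and f :: "'f \<Rightarrow> complex"
  defines "GD \<equiv> fun_calc D G"
    and "TfGD \<equiv> op_graph (fun_calc D G) O conj_mult_op U M f"
    and "\<mu> \<equiv> zeta_measure U M I h lam G"
  assumes "separable_space (euclidean :: 'h topology)"
    and "selfadjoint D" and "compact_resolvent D"
    and "onb I h" and "\<forall>m\<in>I. (h m, lam m *\<^sub>R h m) \<in> D"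
    and "G \<in> borel_measurable borel" and "\<forall>x. 0 \<le> G x" and "bounded (range G)"
    and "GD \<in> L1inf"
    and "commuting_selfadjoint A" and "nondegenerate A"
    and "joint_spectral_rep A U M e"
    and "f \<in> borel_measurable M"
  shows "(closure_in_L1inf TfGD \<longrightarrow> f \<in> Lp 2 (\<mu> 2)) \<and>
    (f \<in> Lp_1inf 2 \<mu> \<longrightarrow>
       closure_in_L1inf TfGD \<and>
       norm_Z1 (bounded_closure TfGD) \<le> norm_1inf 2 \<mu> f * epowr (norm_Z1 GD) (1 / 2))"
proof -
  have U: "unitary_L2 U M"
    using \<open>joint_spectral_rep A U M e\<close> by (simp add: joint_spectral_rep_def)
  have bGD: "bounded_op GD"
    using \<open>GD \<in> L1inf\<close> by (simp add: L1inf_def compact_op_def)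
  have eig: "\<And>m. m \<in> I \<Longrightarrow> (h m, lam m *\<^sub>R h m) \<in> D"
    using \<open>\<forall>m\<in>I. (h m, lam m *\<^sub>R h m) \<in> D\<close> by blast
  have G: "\<And>x. 0 \<le> G x"
    using \<open>\<forall>x. 0 \<le> G x\<close> by blast
  obtain C where C: "\<And>x. \<bar>G x\<bar> \<le> C"
    using \<open>bounded (range G)\<close> unfolding bounded_iff by auto
  \<comment> \<open>Comparison of coefficients: by orthonormality only \<open>i = m\<close>
    contributes, so repeated eigenvalues cause no trouble.\<close>
  have GD_h: "GD (h m) = G (lam m) *\<^sub>R h m" if m: "m \<in> I" for m
  proof (rule onb_extI[OF \<open>onb I h\<close>])
    fix i assume i: "i \<in> I"
    have "cinner (GD (h m)) (h i) = of_real (G (lam i)) * cinner (h m) (h i)"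
      unfolding GD_def
      by (rule fun_calc_coeff[OF \<open>onb I h\<close> eigenspace_selfadjoint[OF \<open>onb I h\<close> \<open>selfadjoint D\<close> eig] C i])
    then show "cinner (GD (h m)) (h i) = cinner (G (lam m) *\<^sub>R h m) (h i)"
      using onb_onfam[OF \<open>onb I h\<close>] m i by (auto simp: onfam_def cinner_scaleR_left)
  qed
  note ctx = U \<open>f \<in> borel_measurable M\<close> \<open>onb I h\<close> G bGD GD_h
  show ?thesis
    unfolding TfGD_def GD_def[symmetric] \<mu>_def
    using L2_zeta_measure_if_L1inf[OF ctx] mult_comp_L1inf[OF ctx \<open>GD \<in> L1inf\<close>] by blast
qed

end
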